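(* Let $\mathfrak{A}$ be a unital $C^*$-algebra, let $\omega\in\mathscr{P}(\mathfrak{A})$ be a pure state, and let $p_{\mathsf{U}(\mathfrak{A})}:\mathsf{U}(\mathfrak{A})\to\mathscr{P}_\omega(\mathfrak{A})$ be the continuous surjection which maps $U\in\mathsf{U}(\mathfrak{A})$ to $U\cdot\omega$. Furthermore, let the isotropy group $$\mathsf{U}_\omega(\mathfrak{A})=\{U\in\mathsf{U}(\mathfrak{A}) : U\cdot\omega=\omega\}$$ act on $\mathsf{U}(\mathfrak{A})$ and on itself by right multiplication. Then the fibers of $p_{\mathsf{U}(\mathfrak{A})}$ are exactly the orbits of $\mathsf{U}_\omega(\mathfrak{A})$, and $p_{\mathsf{U}(\mathfrak{A})}:\mathsf{U}(\mathfrak{A})\to\mathscr{P}_\omega(\mathfrak{A})$ is a locally trivial principal $\mathsf{U}_\omega(\mathfrak{A})$-bundle.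
   Context: $\mathsf{U}(\mathfrak{A})$ is the group of unitary elements of $\mathfrak{A}$ with the norm topology, and $\mathsf{U}_\omega(\mathfrak{A})$ carries the subspace topology. $\mathscr{P}(\mathfrak{A})$ is the set of pure states of $\mathfrak{A}$ with the topology induced by the norm of $\mathfrak{A}^*$. For $U\in\mathsf{U}(\mathfrak{A})$ and $\omega\in\mathscr{P}(\mathfrak{A})$, $U\cdot\omega$ is the pure state $A\mapsto\omega(U^*AU)$. $\mathscr{P}_\omega(\mathfrak{A})$ is the superselection sector of $\omega$, i.e. the set of pure states whose GNS representations are unitarily equivalent to that of $\omega$; for unital $\mathfrak{A}$ it equals $\{U\cdot\omega : U\in\mathsf{U}(\mathfrak{A})\}$. It carries the norm topology. *)

theory Defs
  imports "HOL-Analysis.Analysis" "HOL-Algebra.Group"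
begin

section \<open>Unital C*-algebras\<close>

text \<open>
  The sort \<^class>\<open>real_normed_algebra_1\<close> includes \<open>norm 1 = 1\<close>. In a unital C*-algebra this follows
  from the C*-identity unless the algebra is zero, and the zero algebra has no states.
\<close>

class unital_cstar_algebra = real_normed_algebra_1 + banach +
  fixes scaleC :: "complex \<Rightarrow> 'a \<Rightarrow> 'a"  (infixr "*\<^sub>C" 75)
    and adj :: "'a \<Rightarrow> 'a"
  assumes scaleC_add_right: "c *\<^sub>C (a + b) = c *\<^sub>C a + c *\<^sub>C b"
    and scaleC_add_left: "(c + d) *\<^sub>C a = c *\<^sub>C a + d *\<^sub>C a"
    and scaleC_scaleC: "c *\<^sub>C (d *\<^sub>C a) = (c * d) *\<^sub>C a"
    and scaleC_complex_of_real: "complex_of_real r *\<^sub>C a = r *\<^sub>R a"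
    and mult_scaleC_left: "(c *\<^sub>C a) * b = c *\<^sub>C (a * b)"
    and mult_scaleC_right: "a * (c *\<^sub>C b) = c *\<^sub>C (a * b)"
    and norm_scaleC: "norm (c *\<^sub>C a) = cmod c * norm a"
    and adj_adj: "adj (adj a) = a"
    and adj_add: "adj (a + b) = adj a + adj b"
    and adj_scaleC: "adj (c *\<^sub>C a) = cnj c *\<^sub>C adj a"
    and adj_mult: "adj (a * b) = adj b * adj a"
    and cstar_identity: "norm (adj a * a) = (norm a)\<^sup>2"

definition unitaries :: "'a::unital_cstar_algebra set" where
  "unitaries = {u. adj u * u = 1 \<and> u * adj u = 1}"


section \<open>States\<close>

text \<open>
  The type \<^typ>\<open>'a \<Rightarrow>\<^sub>L complex\<close> consists of the bounded real-linear maps; the topological dual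
  is the subset of complex-linear ones, and the operator norm restricts to the norm of the dual.
\<close>

definition complex_linear :: "('a::unital_cstar_algebra \<Rightarrow>\<^sub>L complex) \<Rightarrow> bool" where
  "complex_linear \<phi> \<longleftrightarrow> (\<forall>c a. blinfun_apply \<phi> (c *\<^sub>C a) = c * blinfun_apply \<phi> a)"

definition positive_functional :: "('a::unital_cstar_algebra \<Rightarrow>\<^sub>L complex) \<Rightarrow> bool" where
  "positive_functional \<phi> \<longleftrightarrow>
     (\<forall>a. Im (blinfun_apply \<phi> (adj a * a)) = 0 \<and> 0 \<le> Re (blinfun_apply \<phi> (adj a * a)))"

definition states :: "('a::unital_cstar_algebra \<Rightarrow>\<^sub>L complex) set" where
  "states = {\<phi>. complex_linear \<phi> \<and> positive_functional \<phi> \<and> norm \<phi> = 1}"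

definition pure_states :: "('a::unital_cstar_algebra \<Rightarrow>\<^sub>L complex) set" where
  "pure_states = {\<omega>. \<omega> extreme_point_of states}"

lift_definition unitary_act ::
  "'a::unital_cstar_algebra \<Rightarrow> ('a \<Rightarrow>\<^sub>L complex) \<Rightarrow> ('a \<Rightarrow>\<^sub>L complex)"
  is "\<lambda>u \<omega> a. \<omega> (adj u * a * u)"
proof -
  fix u :: 'a and \<omega> :: "'a \<Rightarrow> complex"
  assume "bounded_linear \<omega>"
  moreover have "bounded_linear (\<lambda>a. adj u * a * u)"
    by (intro bounded_linear_const_mult bounded_linear_mult_const bounded_linear_ident)
  ultimately show "bounded_linear (\<lambda>a. \<omega> (adj u * a * u))"
    by (rule bounded_linear_compose)
qed

definition isotropy_unitaries ::
  "('a::unital_cstar_algebra \<Rightarrow>\<^sub>L complex) \<Rightarrow> 'a set" where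
  "isotropy_unitaries \<omega> = {u \<in> unitaries. unitary_act u \<omega> = \<omega>}"

definition isotropy_group ::
  "('a::unital_cstar_algebra \<Rightarrow>\<^sub>L complex) \<Rightarrow> 'a monoid" where
  "isotropy_group \<omega> = \<lparr>carrier = isotropy_unitaries \<omega>, monoid.mult = (*), one = 1\<rparr>"


section \<open>The GNS representation and superselection sectors\<close>

text \<open>
  Hilbert space representations are given with explicit carrier and operations, since the GNS Hilbert
  space depends on the state. Inner products are conjugate-linear in the first argument.
\<close>

record ('h, 'a) hilbert_rep =
  hcarrier :: "'h set"
  hadd :: "'h \<Rightarrow> 'h \<Rightarrow> 'h"
  hscale :: "complex \<Rightarrow> 'h \<Rightarrow> 'h"
  hinner :: "'h \<Rightarrow> 'h \<Rightarrow> complex"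
  hact :: "'a \<Rightarrow> 'h \<Rightarrow> 'h"

definition unitarily_equivalent ::
  "('h, 'a) hilbert_rep \<Rightarrow> ('k, 'a) hilbert_rep \<Rightarrow> bool" where
  "unitarily_equivalent R S \<longleftrightarrow>
     (\<exists>V. bij_betw V (hcarrier R) (hcarrier S) \<and>
          (\<forall>x\<in>hcarrier R. \<forall>y\<in>hcarrier R. V (hadd R x y) = hadd S (V x) (V y)) \<and>
          (\<forall>c. \<forall>x\<in>hcarrier R. V (hscale R c x) = hscale S c (V x)) \<and>
          (\<forall>x\<in>hcarrier R. \<forall>y\<in>hcarrier R. hinner S (V x) (V y) = hinner R x y) \<and>
          (\<forall>a. \<forall>x\<in>hcarrier R. V (hact R a x) = hact S a (V x)))"

text \<open>
  The completion of the algebra modulo \<open>{a. \<omega> (adj a * a) = 0}\<close> with inner product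
  \<open>\<omega> (adj a * b)\<close> is realised as the set of Cauchy sequences for the seminorm
  \<open>sqrt (\<omega> (adj a * a))\<close>, modulo sequences whose difference tends to zero in that seminorm.
\<close>

definition gns_seminorm :: "('a::unital_cstar_algebra \<Rightarrow>\<^sub>L complex) \<Rightarrow> 'a \<Rightarrow> real" where
  "gns_seminorm \<omega> a = sqrt (Re (blinfun_apply \<omega> (adj a * a)))"

definition gns_Cauchy :: "('a::unital_cstar_algebra \<Rightarrow>\<^sub>L complex) \<Rightarrow> (nat \<Rightarrow> 'a) set" where
  "gns_Cauchy \<omega> = {X. \<forall>e>0. \<exists>N. \<forall>m\<ge>N. \<forall>n\<ge>N. gns_seminorm \<omega> (X m - X n) < e}"

definition gns_rel ::
  "('a::unital_cstar_algebra \<Rightarrow>\<^sub>L complex) \<Rightarrow> ((nat \<Rightarrow> 'a) \<times> (nat \<Rightarrow> 'a)) set" where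
  "gns_rel \<omega> = {(X, Y). X \<in> gns_Cauchy \<omega> \<and> Y \<in> gns_Cauchy \<omega> \<and>
                        (\<lambda>n. gns_seminorm \<omega> (X n - Y n)) \<longlonglongrightarrow> 0}"

definition gns ::
  "('a::unital_cstar_algebra \<Rightarrow>\<^sub>L complex) \<Rightarrow> ((nat \<Rightarrow> 'a) set, 'a) hilbert_rep" where
  "gns \<omega> = \<lparr>
     hcarrier = gns_Cauchy \<omega> // gns_rel \<omega>,
     hadd = (\<lambda>x y. gns_rel \<omega> `` {\<lambda>n. X n + Y n | X Y. X \<in> x \<and> Y \<in> y}),
     hscale = (\<lambda>c x. gns_rel \<omega> `` {\<lambda>n. c *\<^sub>C X n | X. X \<in> x}),
     hinner = (\<lambda>x y. THE z. \<forall>X\<in>x. \<forall>Y\<in>y. (\<lambda>n. blinfun_apply \<omega> (adj (X n) * Y n)) \<longlonglongrightarrow> z),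
     hact = (\<lambda>a x. gns_rel \<omega> `` {\<lambda>n. a * X n | X. X \<in> x})\<rparr>"

definition superselection_sector ::
  "('a::unital_cstar_algebra \<Rightarrow>\<^sub>L complex) \<Rightarrow> ('a \<Rightarrow>\<^sub>L complex) set" where
  "superselection_sector \<omega> = {\<psi> \<in> pure_states. unitarily_equivalent (gns \<psi>) (gns \<omega>)}"


section \<open>Locally trivial principal bundles\<close>

definition is_topological_group :: "('g, 'm) monoid_scheme \<Rightarrow> 'g topology \<Rightarrow> bool" where
  "is_topological_group G T \<longleftrightarrow>
     group G \<and> topspace T = carrier G \<and>
     continuous_map (prod_topology T T) T (\<lambda>(g, h). g \<otimes>\<^bsub>G\<^esub> h) \<and>
     continuous_map T T (\<lambda>g. inv\<^bsub>G\<^esub> g)"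

definition continuous_right_action ::
  "('g, 'm) monoid_scheme \<Rightarrow> 'g topology \<Rightarrow> 'e topology \<Rightarrow> ('e \<Rightarrow> 'g \<Rightarrow> 'e) \<Rightarrow> bool" where
  "continuous_right_action G T E act \<longleftrightarrow>
     continuous_map (prod_topology E T) E (\<lambda>(e, g). act e g) \<and>
     (\<forall>e\<in>topspace E. act e \<one>\<^bsub>G\<^esub> = e) \<and>
     (\<forall>e\<in>topspace E. \<forall>g\<in>carrier G. \<forall>h\<in>carrier G. act (act e g) h = act e (g \<otimes>\<^bsub>G\<^esub> h))"

definition locally_trivial_principal_bundle ::
  "('g, 'm) monoid_scheme \<Rightarrow> 'g topology \<Rightarrow> 'e topology \<Rightarrow> ('e \<Rightarrow> 'g \<Rightarrow> 'e) \<Rightarrow>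
   'b topology \<Rightarrow> ('e \<Rightarrow> 'b) \<Rightarrow> bool" where
  "locally_trivial_principal_bundle G T E act B p \<longleftrightarrow>
     is_topological_group G T \<and>
     continuous_right_action G T E act \<and>
     continuous_map E B p \<and> p ` topspace E = topspace B \<and>
     (\<forall>e\<in>topspace E. \<forall>g\<in>carrier G. p (act e g) = p e) \<and>
     (\<forall>b\<in>topspace B. \<exists>W \<phi>.
        openin B W \<and> b \<in> W \<and>
        homeomorphic_map (subtopology E {e \<in> topspace E. p e \<in> W})
          (prod_topology (subtopology B W) T) \<phi> \<and>
        (\<forall>e\<in>topspace E. p e \<in> W \<longrightarrow>
           fst (\<phi> e) = p e \<and>
           (\<forall>g\<in>carrier G. \<phi> (act e g) = (p e, snd (\<phi> e) \<otimes>\<^bsub>G\<^esub> g))))"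

end

theory Submission
  imports Defs
begin

text \<open>
  Vectors of the GNS space of a pure state \<open>\<omega>\<close> are approximated by algebra elements with the seminorm
  \<open>sn \<omega> a = sqrt (\<omega> (a* a))\<close>; the cyclic vector is \<open>1\<close>. Purity says that bounded operators commuting with the
  algebra are scalar. Applied to the bounded transform of a skew-symmetric operator, it shows that
  self-adjoint elements move the cyclic vector in all directions a self-adjoint operator could; a
  Cayley transform then makes the unitary group act with dense orbits on unit vectors. Comparing the action
  of a few such unitaries on a two-dimensional subspace shows that orthogonal vector states are uniformly separated, which bounds the norms of the
  self-adjoint elements needed and the distance of vectors by the distance of their states.

  Near \<open>\<omega>\<close>, averaging the self-adjoint generators with a partition of unity and applying the Cayley transform
  gives a continuous map into the unitaries that is a section of the orbit map up to a quadratic error.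
  The infinite product of the Newton iteration is an exact local section, which trivialises the orbit
  map. The same estimates show that the orbit is norm closed, hence equal to the superselection sector.
\<close>

section \<open>C*-algebra basics\<close>

text \<open>The tension that shapes the proof: a section must be continuous for the norm of the
  algebra, whereas purity speaks about the GNS seminorm, in which elements of large norm may look
  small. The bridge is \<open>pure_offdiagonal\<close>. Unitaries have norm 1 for free, so a lower
  bound for their off-diagonal matrix entries that is the same for all orthonormal pairs serves
  twice: it bounds distances of vectors by distances of states, and it drives a greedy approximation
  of any vector orthogonal to the cyclic one by self-adjoint elements whose norm is linear in its
  length. The value 1/50 is a comfortable margin, and the later constants 100, 80000 and 10^14
  descend from it. None of them depends on the state, so local sections exist on balls of one fixed
  radius about all points of the orbit; this is what makes the orbit closed. In the analysis of
  purity an operator is represented by the functional of its matrix coefficients with the cyclic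
  vector, and a vector of the completion by a sequence of algebra elements.\<close>

lemma scaleC_zero_left [simp]:
  fixes a :: "'a::unital_cstar_algebra"
  shows "0 *\<^sub>C a = 0"
  using scaleC_complex_of_real[of 0 a] by simp

lemma scaleC_zero_right [simp]:
  shows "c *\<^sub>C (0::'a::unital_cstar_algebra) = 0"
  using scaleC_add_right[of c 0 "0::'a"] by simp

lemma scaleC_one [simp]:
  fixes a :: "'a::unital_cstar_algebra"
  shows "1 *\<^sub>C a = a"
  using scaleC_complex_of_real[of 1 a] by simp

lemma scaleC_minus_right [simp]:
  fixes a :: "'a::unital_cstar_algebra"
  shows "c *\<^sub>C (- a) = - (c *\<^sub>C a)"
  using scaleC_add_right[of c a "- a"] by (simp add: minus_unique)

lemma scaleC_minus_left [simp]:
  fixes a :: "'a::unital_cstar_algebra"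
  shows "(- c) *\<^sub>C a = - (c *\<^sub>C a)"
  using scaleC_add_left[of c "- c" a] by (simp add: minus_unique)

lemma scaleC_diff_right:
  fixes a b :: "'a::unital_cstar_algebra"
  shows "c *\<^sub>C (a - b) = c *\<^sub>C a - c *\<^sub>C b"
  using scaleC_add_right[of c a "- b"] by simp

lemma scaleC_diff_left:
  fixes a :: "'a::unital_cstar_algebra"
  shows "(c - d) *\<^sub>C a = c *\<^sub>C a - d *\<^sub>C a"
  using scaleC_add_left[of c "- d" a] by simp

lemma scaleC_scaleR:
  fixes a :: "'a::unital_cstar_algebra"
  shows "c *\<^sub>C (r *\<^sub>R a) = r *\<^sub>R (c *\<^sub>C a)"
  by (metis scaleC_complex_of_real scaleC_scaleC mult.commute)

lemma adj_zero [simp]: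
  shows "adj (0::'a::unital_cstar_algebra) = 0"
  using adj_add[of "0::'a" 0] by simp

lemma adj_one [simp]:
  shows "adj (1::'a::unital_cstar_algebra) = 1"
  by (metis adj_adj adj_mult mult_1_right)

lemma adj_minus [simp]:
  fixes a :: "'a::unital_cstar_algebra"
  shows "adj (- a) = - adj a"
  using adj_add[of a "- a"] by (simp add: minus_unique)

lemma adj_diff:
  fixes a b :: "'a::unital_cstar_algebra"
  shows "adj (a - b) = adj a - adj b"
  using adj_add[of a "- b"] by simp

lemma adj_scaleR:
  fixes a :: "'a::unital_cstar_algebra"
  shows "adj (r *\<^sub>R a) = r *\<^sub>R adj a"
  by (metis adj_scaleC complex_cnj_complex_of_real scaleC_complex_of_real)

lemma norm_adj [simp]:
  fixes a :: "'a::unital_cstar_algebra"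
  shows "norm (adj a) = norm a"
proof -
  have *: "norm b \<le> norm (adj b)" for b :: 'a
  proof (cases "norm b = 0")
    case False
    have "norm b * norm b \<le> norm (adj b) * norm b"
      by (metis cstar_identity norm_mult_ineq power2_eq_square)
    thus ?thesis using False by simp
  qed simp
  show ?thesis using *[of a] *[of "adj a"] by (simp add: adj_adj)
qed

declare adj_adj [simp]

lemmas cstar_simps = scaleC_add_right scaleC_diff_right mult_scaleC_left mult_scaleC_right
  scaleC_scaleC adj_add adj_diff adj_scaleC adj_mult

lemma bounded_linear_adj: "bounded_linear (adj :: 'a::unital_cstar_algebra \<Rightarrow> 'a)"
  by (rule bounded_linear_intro[of _ 1]) (auto simp: adj_add adj_scaleR)

lemma bounded_linear_scaleC: "bounded_linear (\<lambda>a::'a::unital_cstar_algebra. c *\<^sub>C a)"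
  by (rule bounded_linear_intro[of _ "cmod c"])
     (auto simp: scaleC_add_right scaleC_scaleR norm_scaleC mult.commute)

lemmas continuous_on_adj [continuous_intros] = bounded_linear.continuous_on[OF bounded_linear_adj]
lemmas continuous_on_scaleC [continuous_intros] = bounded_linear.continuous_on[OF bounded_linear_scaleC]

section \<open>Self-adjoint elements\<close>

definition selfadj :: "'a::unital_cstar_algebra set" where
  "selfadj = {h. adj h = h}"

lemma selfadj_add: "h \<in> selfadj \<Longrightarrow> k \<in> selfadj \<Longrightarrow> h + k \<in> selfadj"
  by (simp add: selfadj_def adj_add)

lemma selfadj_diff: "h \<in> selfadj \<Longrightarrow> k \<in> selfadj \<Longrightarrow> h - k \<in> selfadj"
  by (simp add: selfadj_def adj_diff)

lemma selfadj_scaleR: "h \<in> selfadj \<Longrightarrow> r *\<^sub>R h \<in> selfadj"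
  by (simp add: selfadj_def adj_scaleR)

lemma selfadj_zero [simp]: "0 \<in> selfadj" and selfadj_one [simp]: "1 \<in> selfadj"
  by (simp_all add: selfadj_def)

lemma closed_selfadj: "closed (selfadj :: 'a::unital_cstar_algebra set)"
  unfolding selfadj_def by (intro closed_Collect_eq continuous_intros)

lemma convex_selfadj: "convex selfadj"
  by (rule convexI) (intro selfadj_add selfadj_scaleR; assumption)

subsection \<open>Unitaries\<close>

lemma unitaries_one [simp]: "1 \<in> unitaries"
  by (simp add: unitaries_def)

lemma unitaries_adj: "u \<in> unitaries \<Longrightarrow> adj u \<in> unitaries"
  by (simp add: unitaries_def)

lemma unitaries_mult:
  assumes "u \<in> unitaries" "v \<in> unitaries" shows "u * v \<in> unitaries"
proof -
  have "adj v * (adj u * u) * v = 1" "u * (v * adj v) * adj u = 1"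
    using assms by (simp_all add: unitaries_def)
  thus ?thesis by (simp add: unitaries_def adj_mult mult.assoc)
qed

lemma unitaries_scaleC:
  assumes "u \<in> unitaries" "cmod c = 1" shows "c *\<^sub>C u \<in> unitaries"
proof -
  have "cnj c * c = 1" using assms(2) by (metis complex_norm_square mult.commute of_real_1 one_power2)
  thus ?thesis using assms by (simp add: unitaries_def cstar_simps mult.commute)
qed

lemma norm_unitary:
  fixes u :: "'a::unital_cstar_algebra"
  assumes "u \<in> unitaries" shows "norm u = 1"
proof -
  have "(norm u)\<^sup>2 = 1"
    using cstar_identity[of u] assms by (simp add: unitaries_def)
  thus ?thesis by (metis norm_ge_zero power2_eq_imp_eq zero_le_one one_power2)
qed

lemma unitary_cancel:
  assumes "u \<in> unitaries"
  shows "adj u * (u * a) = a" "u * (adj u * a) = a" "a * u * adj u = a" "a * adj u * u = a"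
  using assms by (simp_all add: unitaries_def flip: mult.assoc) (simp_all add: unitaries_def mult.assoc)

lemma closed_unitaries: "closed (unitaries :: 'a::unital_cstar_algebra set)"
  unfolding unitaries_def by (intro closed_Collect_conj closed_Collect_eq continuous_intros)

subsection \<open>Cayley transform\<close>

lemma one_minus_invertible:
  fixes x :: "'a::unital_cstar_algebra"
  assumes "norm x < 1"
  obtains y where "(1 - x) * y = 1" "y * (1 - x) = 1"
proof
  let ?S = "\<Sum>n. x ^ n"
  have s: "summable (\<lambda>n. x ^ n)" by (rule complete_algebra_summable_geometric[OF assms])
  have sh: "?S = 1 + (\<Sum>n. x ^ Suc n)" using suminf_split_head[OF s] by simp
  have "(\<Sum>n. x ^ Suc n) = x * ?S" using suminf_mult[OF s, of x] by simp
  with sh show "(1 - x) * ?S = 1" by (simp add: algebra_simps)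
  have "(\<Sum>n. x ^ Suc n) = ?S * x"
    using suminf_mult2[OF s, of x] by (simp add: power_commutes)
  with sh show "?S * (1 - x) = 1" by (simp add: algebra_simps)
qed

definition is_inv :: "'a::unital_cstar_algebra \<Rightarrow> 'a \<Rightarrow> bool" where
  "is_inv a g \<longleftrightarrow> a * g = 1 \<and> g * a = 1"

text \<open>\<open>1 + \<i> *\<^sub>C h\<close> is the adjoint of
  \<open>1 - \<i> *\<^sub>C h\<close> and commutes with it, so their quotient
  \<open>2 *\<^sub>R g - 1\<close> is unitary. Then \<open>g\<close> is the mean of a unitary and
  \<open>1\<close>, which bounds its norm independently of \<open>h\<close>.\<close>

lemma cayley_of_inverse:
  fixes h g :: "'a::unital_cstar_algebra"
  assumes h: "h \<in> selfadj" and g: "is_inv (1 - \<i> *\<^sub>C h) g"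
  shows "2 *\<^sub>R g - 1 \<in> unitaries" "norm g \<le> 1"
proof -
  let ?m = "1 - \<i> *\<^sub>C h" and ?p = "1 + \<i> *\<^sub>C h"
  let ?u = "2 *\<^sub>R g - 1"
  have mp: "?m + ?p = 2 *\<^sub>R 1" by (simp add: scaleR_2)
  have u1: "?u = ?p * g"
  proof -
    have "(?m + ?p) * g = 1 + ?p * g" using g by (simp only: distrib_right is_inv_def)
    thus ?thesis unfolding mp by (simp add: scaleR_2 mult_2 algebra_simps)
  qed
  have u2: "?u = g * ?p"
  proof -
    have "g * (?m + ?p) = 1 + g * ?p" using g by (simp only: distrib_left is_inv_def)
    thus ?thesis unfolding mp by (simp add: scaleR_2 mult_2_right algebra_simps)
  qed
  have am: "adj ?m = ?p" "adj ?p = ?m" using h by (simp_all add: selfadj_def cstar_simps)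
  have comm: "?m * ?p = ?p * ?m" by (simp add: algebra_simps)
  have ag: "adj g * ?p = 1" "?p * adj g = 1"
    using g am by (metis adj_mult adj_one is_inv_def)+
  have a1: "adj ?u = adj g * ?m" unfolding u1 adj_mult am ..
  have a2: "adj ?u = ?m * adj g" unfolding u2 adj_mult am ..
  have "adj ?u * ?u = adj g * (?m * ?p) * g" unfolding a1 unfolding u1 by (simp only: mult.assoc)
  also have "\<dots> = (adj g * ?p) * (?m * g)" unfolding comm by (simp only: mult.assoc)
  also have "\<dots> = 1" using g ag by (simp add: is_inv_def)
  finally have 1: "adj ?u * ?u = 1" .
  have "?u * adj ?u = g * (?p * ?m) * adj g" unfolding a2 unfolding u2 by (simp only: mult.assoc)
  also have "\<dots> = (g * ?m) * (?p * adj g)" unfolding comm[symmetric] by (simp only: mult.assoc)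
  also have "\<dots> = 1" using g ag by (simp add: is_inv_def)
  finally show *: "?u \<in> unitaries" using 1 by (simp add: unitaries_def)
  have "2 * norm g = norm (?u + 1)" by simp
  also have "\<dots> \<le> norm ?u + norm (1::'a)" by (rule norm_triangle_ineq)
  finally show "norm g \<le> 1" using norm_unitary[OF *] by simp
qed

text \<open>Continuity method: \<open>h\<close> is reached from 0 in \<open>N\<close> equal steps.
  All inverses met on the way have norm at most 1, so one step size with \<open>norm k < 1\<close>
  stays inside the radius of the Neumann series at every step.\<close>

lemma cayley_invertible:
  fixes h :: "'a::unital_cstar_algebra"
  assumes h: "h \<in> selfadj"
  shows "\<exists>g. is_inv (1 - \<i> *\<^sub>C h) g"
proof -
  obtain N :: nat where N: "norm h < real N" using reals_Archimedean2 by blast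
  hence N0: "real N > 0" using norm_ge_zero[of h] by linarith
  define t where "t n = real n / real N" for n :: nat
  have "\<exists>g. is_inv (1 - \<i> *\<^sub>C (t n *\<^sub>R h)) g" for n
  proof (induction n)
    case 0
    show ?case by (rule exI[of _ 1]) (simp add: t_def is_inv_def)
  next
    case (Suc n)
    let ?m = "1 - \<i> *\<^sub>C (t n *\<^sub>R h)"
    define k where "k = (1 / real N) *\<^sub>R (\<i> *\<^sub>C h)"
    obtain g where g: "is_inv ?m g" using Suc by blast
    have ng: "norm g \<le> 1" by (rule cayley_of_inverse(2)[OF selfadj_scaleR[OF h] g])
    have nk: "norm k < 1" using N N0 by (simp add: k_def norm_scaleC)
    have "norm (g * k) < 1" 
      using norm_mult_ineq[of g k] mult_mono[OF ng order_refl, of "norm k"] nk by simp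
    then obtain y where y: "(1 - g * k) * y = 1" "y * (1 - g * k) = 1"
      by (rule one_minus_invertible)
    have "t (Suc n) = t n + 1 / real N" by (simp add: t_def add_divide_distrib)
    hence e: "1 - \<i> *\<^sub>C (t (Suc n) *\<^sub>R h) = ?m - k"
      by (simp add: k_def scaleC_scaleR scaleR_add_left scaleC_add_right algebra_simps)
    have e2: "?m - k = ?m * (1 - g * k)"
      using g by (simp add: right_diff_distrib is_inv_def flip: mult.assoc)
    have "is_inv (?m - k) (y * g)"
    proof -
      have "?m * (1 - g * k) * (y * g) = ?m * ((1 - g * k) * y) * g" by (simp only: mult.assoc)
      also have "\<dots> = 1" using g y by (simp add: is_inv_def)
      finally have 1: "?m * (1 - g * k) * (y * g) = 1" .
      have "y * g * (?m * (1 - g * k)) = y * (g * ?m) * (1 - g * k)" by (simp only: mult.assoc)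
      also have "\<dots> = 1" using g y by (simp add: is_inv_def)
      finally show ?thesis using 1 by (simp add: is_inv_def e2)
    qed
    thus ?case unfolding e by blast
  qed
  from this[of N] show ?thesis using N0 by (simp add: t_def)
qed

definition cay_inv :: "'a::unital_cstar_algebra \<Rightarrow> 'a" where
  "cay_inv h = (SOME g. is_inv (1 - \<i> *\<^sub>C h) g)"

definition cayley :: "'a::unital_cstar_algebra \<Rightarrow> 'a" where
  "cayley h = 2 *\<^sub>R cay_inv h - 1"

context
  fixes h :: "'a::unital_cstar_algebra"
  assumes h: "h \<in> selfadj"
begin

lemma cay_inv: "is_inv (1 - \<i> *\<^sub>C h) (cay_inv h)"
  unfolding cay_inv_def by (rule someI_ex[OF cayley_invertible[OF h]])

lemma norm_cay_inv: "norm (cay_inv h) \<le> 1"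
  by (rule cayley_of_inverse(2)[OF h cay_inv])

lemma cayley_unitary: "cayley h \<in> unitaries"
  unfolding cayley_def by (rule cayley_of_inverse(1)[OF h cay_inv])

lemma cayley_mult: "cayley h * (1 - \<i> *\<^sub>C h) = 1 + \<i> *\<^sub>C h"
proof -
  have "cay_inv h * (1 - \<i> *\<^sub>C h) = 1" using cay_inv by (simp add: is_inv_def)
  hence "cayley h * (1 - \<i> *\<^sub>C h) = 2 *\<^sub>R 1 - (1 - \<i> *\<^sub>C h)"
    by (simp only: cayley_def left_diff_distrib[of "2 *\<^sub>R cay_inv h"] mult_scaleR_left mult_1_left)
  thus ?thesis by (simp add: scaleR_2)
qed

text \<open>With k = \<i> h the resolvent satisfies g = 1 + g k; substituting once more leaves the
  remainder g k k. The first-order term is twice \<i> h, hence the factor 1/2 in the later choice of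
  generators.\<close>

lemma cayley_expand: "cayley h - 1 - 2 *\<^sub>R (\<i> *\<^sub>C h) = - 2 *\<^sub>R (cay_inv h * h * h)"
proof -
  let ?g = "cay_inv h" and ?k = "\<i> *\<^sub>C h"
  have g: "?g * (1 - ?k) = 1" using cay_inv by (simp add: is_inv_def)
  hence 1: "?g - 1 = ?g * ?k" by (simp add: algebra_simps)
  have "?g - 1 - ?k = ?g * ?k - ?g * (1 - ?k) * ?k" using 1 g by simp
  also have "\<dots> = ?g * ?k * ?k" by (simp add: algebra_simps)
  also have "\<dots> = - (?g * h * h)" by (simp add: cstar_simps)
  finally have "2 *\<^sub>R (?g - 1 - ?k) = 2 *\<^sub>R (- (?g * h * h))" by simp
  thus ?thesis by (simp add: cayley_def algebra_simps scaleR_2)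
qed

lemma norm_cayley_expand: "norm (cayley h - 1 - 2 *\<^sub>R (\<i> *\<^sub>C h)) \<le> 2 * (norm h)\<^sup>2"
proof -
  have "norm (cay_inv h * h * h) \<le> norm (cay_inv h) * norm h * norm h"
    by (metis norm_mult_ineq mult_right_mono norm_ge_zero order_trans)
  also have "\<dots> \<le> 1 * norm h * norm h" by (intro mult_right_mono norm_cay_inv) auto
  finally show ?thesis unfolding cayley_expand by (simp add: power2_eq_square)
qed

lemma norm_cayley_minus_one: "norm (cayley h - 1) \<le> 2 * norm h"
proof -
  have e: "cay_inv h - 1 = cay_inv h * (\<i> *\<^sub>C h)"
    using cay_inv by (simp add: is_inv_def algebra_simps)
  have "cayley h - 1 = 2 *\<^sub>R (cay_inv h - 1)"
    by (simp add: cayley_def scaleR_diff_right scaleR_2)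
  hence "norm (cayley h - 1) = 2 * norm (cay_inv h * (\<i> *\<^sub>C h))" unfolding e by simp
  also have "\<dots> \<le> 2 * (norm (cay_inv h) * norm h)"
    using norm_mult_ineq[of "cay_inv h" "\<i> *\<^sub>C h"] by (simp add: norm_scaleC)
  also have "\<dots> \<le> 2 * (1 * norm h)"
    by (intro mult_left_mono mult_right_mono norm_cay_inv) auto
  finally show ?thesis by simp
qed

end

text \<open>Resolvent identity; both resolvents are bounded by 1, so the estimate is global on
  \<open>selfadj\<close>.\<close>

lemma norm_cayley_diff:
  fixes h k :: "'a::unital_cstar_algebra"
  assumes h: "h \<in> selfadj" and k: "k \<in> selfadj"
  shows "norm (cayley h - cayley k) \<le> 2 * norm (h - k)"
proof -
  let ?g = "cay_inv h" and ?l = "cay_inv k"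
  have 1: "?g * (1 - \<i> *\<^sub>C h) = 1" "(1 - \<i> *\<^sub>C k) * ?l = 1"
    using cay_inv[OF h] cay_inv[OF k] by (simp_all add: is_inv_def)
  have "?g - ?l = ?g * ((1 - \<i> *\<^sub>C k) * ?l) - (?g * (1 - \<i> *\<^sub>C h)) * ?l" unfolding 1 by simp
  also have "\<dots> = ?g * (\<i> *\<^sub>C (h - k)) * ?l" by (simp add: algebra_simps scaleC_diff_right)
  finally have e: "?g - ?l = ?g * (\<i> *\<^sub>C (h - k)) * ?l" .
  have "norm (?g * (\<i> *\<^sub>C (h - k)) * ?l) \<le> norm ?g * norm (h - k) * norm ?l"
    using norm_mult_ineq[of "?g * (\<i> *\<^sub>C (h - k))" ?l]
      mult_right_mono[OF norm_mult_ineq[of ?g "\<i> *\<^sub>C (h - k)"], of "norm ?l"]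
    by (simp add: norm_scaleC)
  also have "\<dots> \<le> 1 * norm (h - k) * 1"
    by (intro mult_mono norm_cay_inv h k) auto
  finally have "norm (?g - ?l) \<le> norm (h - k)" unfolding e by simp
  moreover have "cayley h - cayley k = 2 *\<^sub>R (?g - ?l)" by (simp add: cayley_def algebra_simps)
  ultimately show ?thesis by simp
qed

section \<open>Positive functionals\<close>

text \<open>Bare functions instead of bounded maps: functionals arise below as pointwise limits, and
  linearity passes to these before any bound is known.\<close>

definition clin :: "('a::unital_cstar_algebra \<Rightarrow> complex) \<Rightarrow> bool" where
  "clin f \<longleftrightarrow> (\<forall>a b. f (a + b) = f a + f b) \<and> (\<forall>c a. f (c *\<^sub>C a) = c * f a)"

lemma clin_add: "clin f \<Longrightarrow> f (a + b) = f a + f b"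
  and clin_scaleC: "clin f \<Longrightarrow> f (c *\<^sub>C a) = c * f a"
  by (auto simp: clin_def)

lemma clin_minus: "clin f \<Longrightarrow> f (- a) = - f a"
  using clin_scaleC[of f "-1" a] by simp

lemma clin_diff: "clin f \<Longrightarrow> f (a - b) = f a - f b"
  using clin_add[of f a "- b"] by (simp add: clin_minus)

lemma clin_zero: "clin f \<Longrightarrow> f 0 = 0"
  using clin_scaleC[of f 0 0] by simp

lemma clin_scaleR: "clin f \<Longrightarrow> f (r *\<^sub>R a) = of_real r * f a"
  using clin_scaleC[of f "of_real r" a] by (simp add: scaleC_complex_of_real)

lemmas clin_simps = clin_add clin_scaleC clin_minus clin_diff clin_zero clin_scaleR

lemma clin_mult_left: "clin f \<Longrightarrow> clin (\<lambda>x. f (a * x))"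
  by (simp add: clin_def distrib_left mult_scaleC_right)

lemma clin_mult_right: "clin f \<Longrightarrow> clin (\<lambda>x. f (x * a))"
  by (simp add: clin_def distrib_right mult_scaleC_left)

lemma clin_limit:
  assumes f: "\<And>n. clin (f n)" and F: "\<And>a. (\<lambda>n. f n a) \<longlonglongrightarrow> F a"
  shows "clin F"
  unfolding clin_def
proof (intro conjI allI)
  show "F (a + b) = F a + F b" for a b
    by (rule LIMSEQ_unique[OF F]) (simp add: clin_add[OF f] tendsto_add F)
  show "F (c *\<^sub>C a) = c * F a" for c a
    by (rule LIMSEQ_unique[OF F]) (simp add: clin_scaleC[OF f] tendsto_mult_left F)
qed

lemma phase_exists: "\<exists>c. cmod c = 1 \<and> c * z = of_real (cmod z)"
proof (cases "z = 0")
  case False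
  have "(cnj z / of_real (cmod z)) * z = of_real ((cmod z)\<^sup>2) / of_real (cmod z)"
    by (simp add: complex_norm_square mult.commute del: of_real_power)
  thus ?thesis using False by (intro exI[of _ "cnj z / of_real (cmod z)"]) (auto simp: power2_eq_square norm_divide)
qed (auto intro: exI[of _ 1])

text \<open>Kept apart from \<open>pos_fun\<close> because the competitors in the definition of
  purity are only known to be positive; domination by a bounded functional then bounds them.\<close>

definition pos_lin :: "('a::unital_cstar_algebra \<Rightarrow> complex) \<Rightarrow> bool" where
  "pos_lin f \<longleftrightarrow> clin f \<and> (\<forall>a. Im (f (adj a * a)) = 0 \<and> 0 \<le> Re (f (adj a * a)))"

definition pos_fun :: "('a::unital_cstar_algebra \<Rightarrow> complex) \<Rightarrow> bool" where
  "pos_fun f \<longleftrightarrow> pos_lin f \<and> (\<exists>K. \<forall>a. cmod (f a) \<le> K * norm a)"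

definition sn :: "('a::unital_cstar_algebra \<Rightarrow> complex) \<Rightarrow> 'a \<Rightarrow> real" where
  "sn f a = sqrt (Re (f (adj a * a)))"

lemma pos_fun_lin: "pos_fun f \<Longrightarrow> pos_lin f" by (simp add: pos_fun_def)

lemma pos_lin_clin: "pos_lin f \<Longrightarrow> clin f" by (simp add: pos_lin_def)

text \<open>The discriminant criterion, read off at the minimiser \<open>s = 1 / q\<close>. The
  factor \<open>m\<close> occurs in both the linear and the quadratic term because in applications
  the step is proportional to a quantity whose squared modulus is \<open>m\<close>.\<close>

lemma quadratic_bound:
  fixes p q m :: real
  assumes "\<And>s. 0 \<le> p - 2 * s * m + s\<^sup>2 * m * q" "0 \<le> m" "0 \<le> q"
  shows "m \<le> p * q"
proof (cases "q = 0")
  case True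
  have "m = 0"
  proof (rule ccontr)
    assume "m \<noteq> 0"
    thus False using assms(1)[of "(p + 1) / (2 * m)"] True by (simp add: field_simps)
  qed
  thus ?thesis using True by simp
next
  case False
  hence "q > 0" using assms(3) by simp
  thus ?thesis using assms(1)[of "1 / q"] by (simp add: power2_eq_square field_simps)
qed

section \<open>The GNS seminorm and the Cauchy-Schwarz inequality\<close>

context
  fixes f :: "'a::unital_cstar_algebra \<Rightarrow> complex"
  assumes f: "pos_lin f"
begin

lemma pos_lin_real: "f (adj a * a) = of_real (Re (f (adj a * a)))"
  using f by (simp add: pos_lin_def complex_eq_iff)

lemma pos_lin_nonneg: "0 \<le> Re (f (adj a * a))"
  using f by (simp add: pos_lin_def)

lemma sn_power2: "(sn f a)\<^sup>2 = Re (f (adj a * a))"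
  by (simp add: sn_def pos_lin_nonneg)

lemma sn_nonneg [simp]: "0 \<le> sn f a"
  by (simp add: sn_def pos_lin_nonneg)

lemma pos_lin_sn: "f (adj a * a) = of_real ((sn f a)\<^sup>2)"
  unfolding sn_power2 by (rule pos_lin_real)

lemma pos_lin_herm: "f (adj b * a) = cnj (f (adj a * b))"
proof -
  note l = pos_lin_clin[OF f]
  have "Im (f (adj (a + b) * (a + b))) = 0" "Im (f (adj a * a)) = 0" "Im (f (adj b * b)) = 0"
    "Im (f (adj (a + \<i> *\<^sub>C b) * (a + \<i> *\<^sub>C b))) = 0"
    using f by (simp_all add: pos_lin_def)
  thus ?thesis
    by (simp add: cstar_simps clin_simps[OF l] algebra_simps complex_eq_iff)
qed

lemma pos_lin_adj: "f (adj a) = cnj (f a)"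
  using pos_lin_herm[of a 1] by simp

lemma pos_lin_expand:
  "Re (f (adj (a + b) * (a + b))) = Re (f (adj a * a)) + 2 * Re (f (adj a * b)) + Re (f (adj b * b))"
  using pos_lin_herm[of a b] by (simp add: adj_add algebra_simps clin_simps[OF pos_lin_clin[OF f]])

lemma Cauchy_Schwarz2: "(cmod (f (adj a * b)))\<^sup>2 \<le> Re (f (adj a * a)) * Re (f (adj b * b))"
proof (rule quadratic_bound)
  note l = pos_lin_clin[OF f]
  fix s :: real
  define z where "z = f (adj a * b)"
  define c where "c = - (of_real s * cnj z)"
  have "0 \<le> Re (f (adj (a + c *\<^sub>C b) * (a + c *\<^sub>C b)))" by (rule pos_lin_nonneg)
  also have "\<dots> = Re (f (adj a * a)) + 2 * Re (c * z) + Re (cnj c * c * f (adj b * b))"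
    unfolding pos_lin_expand by (simp add: cstar_simps clin_simps[OF l] z_def mult.assoc mult.left_commute)
  also have "c * z = of_real (- s * (cmod z)\<^sup>2)"
    by (simp only: c_def of_real_mult complex_norm_square of_real_minus) (simp add: mult.commute)
  also have "cnj c * c = of_real ((cmod c)\<^sup>2)" by (metis complex_norm_square mult.commute)
  also have "(cmod c)\<^sup>2 = s\<^sup>2 * (cmod z)\<^sup>2" by (simp add: c_def norm_mult power_mult_distrib)
  finally show "0 \<le> Re (f (adj a * a)) - 2 * s * (cmod (f (adj a * b)))\<^sup>2 
      + s\<^sup>2 * (cmod (f (adj a * b)))\<^sup>2 * Re (f (adj b * b))"
    by (simp add: z_def)
qed (auto simp: pos_lin_nonneg)

lemma Cauchy_Schwarz: "cmod (f (adj a * b)) \<le> sn f a * sn f b"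
  by (rule power2_le_imp_le) (use Cauchy_Schwarz2 in \<open>auto simp: power_mult_distrib sn_power2\<close>)

lemma Cauchy_Schwarz1: "cmod (f a) \<le> sn f 1 * sn f a"
  using Cauchy_Schwarz[of 1 a] by simp

lemma inner_diff:
  "cmod (f (adj x * y) - f (adj x' * y')) \<le> sn f (x - x') * sn f y + sn f x' * sn f (y - y')"
proof -
  have "f (adj x * y) - f (adj x' * y') = f (adj (x - x') * y) + f (adj x' * (y - y'))"
    by (simp add: adj_diff algebra_simps clin_diff[OF pos_lin_clin[OF f]])
  thus ?thesis
    using order_trans[OF norm_triangle_ineq add_mono[OF Cauchy_Schwarz Cauchy_Schwarz]] by simp
qed

lemma sn_triangle: "sn f (a + b) \<le> sn f a + sn f b"
proof (rule power2_le_imp_le)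
  have "Re (f (adj a * b)) \<le> sn f a * sn f b"
    using Cauchy_Schwarz[of a b] complex_Re_le_cmod order_trans by blast
  thus "(sn f (a + b))\<^sup>2 \<le> (sn f a + sn f b)\<^sup>2"
    unfolding power2_sum sn_power2 pos_lin_expand by simp
qed simp

lemma sn_zero [simp]: "sn f 0 = 0"
  by (simp add: sn_def clin_zero[OF pos_lin_clin[OF f]])

lemma sn_scaleC: "sn f (c *\<^sub>C a) = cmod c * sn f a"
proof -
  have "f (adj (c *\<^sub>C a) * (c *\<^sub>C a)) = (c * cnj c) * f (adj a * a)"
    by (simp add: cstar_simps clin_simps[OF pos_lin_clin[OF f]] mult_ac)
  also have "c * cnj c = of_real ((cmod c)\<^sup>2)" by (metis complex_norm_square)
  finally have "Re (f (adj (c *\<^sub>C a) * (c *\<^sub>C a))) = (cmod c)\<^sup>2 * Re (f (adj a * a))"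
    by simp
  thus ?thesis by (simp add: sn_def real_sqrt_mult)
qed

lemma sn_scaleR: "sn f (r *\<^sub>R a) = \<bar>r\<bar> * sn f a"
  using sn_scaleC[of "of_real r" a] by (simp add: scaleC_complex_of_real)

lemma sn_minus [simp]: "sn f (- a) = sn f a"
  by (simp add: sn_def)

lemma sn_minus_commute: "sn f (a - b) = sn f (b - a)"
  using sn_minus[of "a - b"] by simp

lemma sn_triangle_diff: "sn f (a - c) \<le> sn f (a - b) + sn f (b - c)"
  using sn_triangle[of "a - b" "b - c"] by simp

lemma sn_diff_le: "sn f (a - b) \<le> sn f a + sn f b"
  using sn_triangle[of a "- b"] by simp

lemma sn_unitary: "u \<in> unitaries \<Longrightarrow> sn f (u * a) = sn f a"
  by (simp add: sn_def adj_mult mult.assoc unitary_cancel)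

lemma sn_diff_Re: "(sn f (a - b))\<^sup>2 = (sn f a)\<^sup>2 - 2 * Re (f (adj a * b)) + (sn f b)\<^sup>2"
  using pos_lin_expand[of a "- b"] by (simp add: sn_power2 clin_simps[OF pos_lin_clin[OF f]])

lemma pos_lin_conj: "pos_lin (\<lambda>x. f (adj a * x * a))"
proof -
  have "adj a * (adj b * b) * a = adj (b * a) * (b * a)" for b
    by (simp add: adj_mult mult.assoc)
  moreover have "clin (\<lambda>x. f (adj a * x * a))"
    using pos_lin_clin[OF f] by (simp add: clin_def cstar_simps distrib_left distrib_right)
  ultimately show ?thesis using f by (simp add: pos_lin_def)
qed

end

lemma sn_conj: "sn (\<lambda>x. f (adj a * x * a)) b = sn f (b * a)"
  by (simp add: sn_def adj_mult mult.assoc)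

lemma pos_fun_conj:
  assumes "pos_fun f" shows "pos_fun (\<lambda>x. f (adj a * x * a))"
proof -
  obtain K where K: "\<And>x. cmod (f x) \<le> K * norm x" using assms by (auto simp: pos_fun_def)
  have K0: "K \<ge> 0" using K[of 1] norm_ge_zero[of "f 1"] by (simp del: norm_ge_zero)
  have "cmod (f (adj a * x * a)) \<le> (K * (norm a * norm a)) * norm x" for x
  proof -
    have "norm (adj a * x * a) \<le> norm a * norm x * norm a"
      using norm_mult_ineq[of "adj a * x" a] mult_right_mono[OF norm_mult_ineq[of "adj a" x], of "norm a"]
      by simp
    hence "K * norm (adj a * x * a) \<le> K * (norm a * norm x * norm a)"
      by (rule mult_left_mono[OF _ K0])
    thus ?thesis using K[of "adj a * x * a"] by (simp add: mult_ac)
  qed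
  thus ?thesis using pos_lin_conj[OF pos_fun_lin[OF assms]] by (auto simp: pos_fun_def)
qed

text \<open>Iterating Cauchy--Schwarz gives \<open>|f h|^(2^n) \<le> f 1^(2^n - 1) |f (h^(2^n))|\<close>; boundedness of \<open>f\<close>
  and the limit \<open>n \<rightarrow> \<infinity>\<close> then replace the bound of \<open>f\<close> by \<open>f 1\<close>.\<close>
lemma pos_fun_selfadj_bound:
  assumes f: "pos_fun f" and h: "h \<in> selfadj"
  shows "cmod (f h) \<le> Re (f 1) * norm h"
proof (rule ccontr)
  note pl = pos_fun_lin[OF f]
  assume c: "\<not> ?thesis"
  obtain K where K: "\<And>x. cmod (f x) \<le> K * norm x" using f by (auto simp: pos_fun_def)
  have K0: "K \<ge> 0" using K[of 1] norm_ge_zero[of "f 1"] by (simp del: norm_ge_zero)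
  define r where "r = Re (f 1)"
  have r0: "r \<ge> 0" using pos_lin_nonneg[OF pl, of 1] by (simp add: r_def)
  have hp: "adj (h ^ n) = h ^ n" for n
    using h by (induction n) (auto simp: selfadj_def adj_mult power_commutes)
  have step: "(cmod (f (h ^ n)))\<^sup>2 \<le> r * cmod (f (h ^ (2 * n)))" for n
  proof -
    have e: "adj (h ^ n) * h ^ n = h ^ (2 * n)" by (simp add: hp mult_2 power_add)
    have "(cmod (f (h ^ n)))\<^sup>2 \<le> r * Re (f (h ^ (2 * n)))"
      using Cauchy_Schwarz2[OF pl, of 1 "h ^ n"] by (simp add: r_def e)
    also have "\<dots> \<le> r * cmod (f (h ^ (2 * n)))" by (intro mult_left_mono complex_Re_le_cmod r0)
    finally show ?thesis .
  qed
  \<comment> \<open>An extra factor \<open>r\<close> on both sides replaces the exponent 2^n - 1 and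
    keeps the induction free of subtraction.\<close>
  have main: "r * cmod (f h) ^ (2 ^ n) \<le> r ^ (2 ^ n) * cmod (f (h ^ (2 ^ n)))" for n
  proof (induction n)
    case (Suc n)
    show ?case
    proof (cases "r = 0")
      case False
      hence rp: "r > 0" using r0 by simp
      have "r * (r * cmod (f h) ^ 2 ^ Suc n) = (r * cmod (f h) ^ (2 ^ n))\<^sup>2"
        by (simp add: power_mult_distrib power2_eq_square power_add mult_2 mult_ac)
      also have "\<dots> \<le> (r ^ (2 ^ n) * cmod (f (h ^ (2 ^ n))))\<^sup>2"
        by (intro power_mono Suc) (use r0 in auto)
      also have "\<dots> \<le> r ^ (2 ^ Suc n) * (r * cmod (f (h ^ (2 * 2 ^ n))))"
        using mult_left_mono[OF step[of "2 ^ n"], of "r ^ (2 ^ Suc n)"] r0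
        by (simp add: power_mult_distrib power_mult[symmetric] mult.commute)
      also have "\<dots> = r * (r ^ (2 ^ Suc n) * cmod (f (h ^ (2 ^ Suc n))))" by simp
      finally show ?thesis using rp by simp
    qed simp
  qed simp
  have fh: "cmod (f h) > r * norm h" using c by (simp add: r_def)
  have rp: "r > 0"
  proof (rule ccontr)
    assume "\<not> r > 0"
    hence "r = 0" using r0 by simp
    thus False using step[of 1] fh by simp
  qed
  have hpos: "norm h > 0"
  proof (rule ccontr)
    assume "\<not> norm h > 0"
    hence "h = 0" by simp
    thus False using fh clin_zero[OF pos_lin_clin[OF pl]] by simp
  qed
  define q where "q = cmod (f h) / (r * norm h)"
  have q1: "q > 1" using fh rp hpos by (simp add: q_def)
  have bd: "r * q ^ (2 ^ n) \<le> K" for n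
  proof -
    have "r * cmod (f h) ^ (2 ^ n) \<le> r ^ (2 ^ n) * (K * norm (h ^ (2 ^ n)))"
      using main[of n] mult_left_mono[OF K, of "r ^ (2 ^ n)"] r0 by (meson order_trans zero_le_power)
    also have "\<dots> \<le> r ^ (2 ^ n) * (K * norm h ^ (2 ^ n))"
      by (intro mult_left_mono norm_power_ineq K0) (use r0 in auto)
    finally have "r * cmod (f h) ^ (2 ^ n) \<le> K * (r * norm h) ^ (2 ^ n)"
      by (simp add: power_mult_distrib mult_ac)
    thus ?thesis using rp hpos by (simp add: q_def power_divide divide_le_eq)
  qed
  obtain n where n: "q ^ n > K / r" using real_arch_pow[OF q1] by blast
  have "q ^ n \<le> q ^ (2 ^ n)" using q1 by (intro power_increasing) (auto intro: less_imp_le[OF less_exp])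
  hence "r * q ^ (2 ^ n) > K" using n rp by (simp add: divide_less_eq mult.commute)
     (meson less_le_trans mult_left_mono less_imp_le mult_le_cancel_left_pos)
  thus False using bd[of n] by simp
qed

text \<open>The vector functional of \<open>a\<close>, evaluated at the self-adjoint element
  \<open>adj c * c\<close>, falls under \<open>pos_fun_selfadj_bound\<close>. In operator terms,
  left multiplication by \<open>c\<close> is bounded by \<open>norm c\<close> on the GNS
  space.\<close>

lemma sn_mult:
  assumes f: "pos_fun f" shows "sn f (c * a) \<le> norm c * sn f a"
proof (rule power2_le_imp_le)
  note pl = pos_fun_lin[OF f]
  let ?g = "\<lambda>x. f (adj a * x * a)"
  have "adj c * c \<in> selfadj" by (simp add: selfadj_def adj_mult)
  hence "cmod (?g (adj c * c)) \<le> Re (?g 1) * norm (adj c * c)"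
    by (rule pos_fun_selfadj_bound[OF pos_fun_conj[OF f]])
  also have "\<dots> = (norm c)\<^sup>2 * (sn f a)\<^sup>2"
    by (simp add: cstar_identity sn_power2[OF pl])
  also have "?g (adj c * c) = f (adj (c * a) * (c * a))" by (simp add: adj_mult mult.assoc)
  finally show "(sn f (c * a))\<^sup>2 \<le> (norm c * sn f a)\<^sup>2"
    unfolding sn_power2[OF pl] power_mult_distrib using complex_Re_le_cmod order_trans by blast
  show "0 \<le> norm c * sn f a" using sn_nonneg[OF pl] by simp
qed

lemma sn_le_norm:
  assumes f: "pos_fun f" shows "sn f a \<le> norm a * sn f 1"
  using sn_mult[OF f, of a 1] by simp

lemma pos_fun_bound:
  assumes f: "pos_fun f" shows "cmod (f a) \<le> Re (f 1) * norm a"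
proof -
  note pl = pos_fun_lin[OF f]
  have "cmod (f a) \<le> sn f 1 * (norm a * sn f 1)"
    using Cauchy_Schwarz1[OF pl, of a] mult_left_mono[OF sn_le_norm[OF f, of a] sn_nonneg[OF pl, of 1]]
    by linarith
  also have "\<dots> = (sn f 1)\<^sup>2 * norm a" by (simp add: power2_eq_square)
  finally show ?thesis by (simp add: sn_power2[OF pl])
qed

lemma pos_fun_dominated:
  assumes f: "pos_fun f" and g: "pos_lin g" and le: "\<And>a. Re (g (adj a * a)) \<le> Re (f (adj a * a))"
  shows "pos_fun g"
proof -
  have "cmod (g a) \<le> (sn g 1 * sn f 1) * norm a" for a
  proof -
    have "cmod (g a) \<le> sn g 1 * sn g a" by (rule Cauchy_Schwarz1[OF g])
    also have "\<dots> \<le> sn g 1 * sn f a" 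
      by (intro mult_left_mono sn_nonneg g) (use le in \<open>auto simp: sn_def\<close>)
    also have "\<dots> \<le> sn g 1 * (norm a * sn f 1)" by (intro mult_left_mono sn_nonneg g sn_le_norm f)
    finally show ?thesis by (simp add: mult_ac)
  qed
  thus ?thesis using g by (auto simp: pos_fun_def)
qed

text \<open>Irreducibility in order-theoretic form: a positive contraction T commuting with the
  representation yields the dominated functional a \<mapsto> \<langle>\<Omega>, T a
  \<Omega>\<rangle>, which must be a multiple of \<open>f\<close>. The multiple is
  \<open>g 1\<close> because \<open>f 1 = 1\<close>.\<close>

definition pure_fun :: "('a::unital_cstar_algebra \<Rightarrow> complex) \<Rightarrow> bool" where
  "pure_fun f \<longleftrightarrow> pos_fun f \<and> f 1 = 1 \<and>
     (\<forall>g. pos_lin g \<and> (\<forall>a. Re (g (adj a * a)) \<le> Re (f (adj a * a))) \<longrightarrow> (\<forall>a. g a = g 1 * f a))"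

lemma pure_fun_pos: "pure_fun f \<Longrightarrow> pos_fun f" and pure_fun_one: "pure_fun f \<Longrightarrow> f 1 = 1"
  by (auto simp: pure_fun_def)

lemma pure_funD:
  "pure_fun f \<Longrightarrow> pos_lin g \<Longrightarrow> (\<And>a. Re (g (adj a * a)) \<le> Re (f (adj a * a))) \<Longrightarrow> g a = g 1 * f a"
  by (auto simp: pure_fun_def)

section \<open>Passage between positive functionals and states as bounded linear maps\<close>

lemma complex_linear_clin: "complex_linear \<phi> \<longleftrightarrow> clin (blinfun_apply \<phi>)"
  by (simp add: complex_linear_def clin_def blinfun.add_right)

lemma pos_lin_blinfun:
  "pos_lin (blinfun_apply \<phi>) \<longleftrightarrow> complex_linear \<phi> \<and> positive_functional \<phi>"
  by (simp add: pos_lin_def complex_linear_clin positive_functional_def)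

lemma pos_fun_blinfun:
  "pos_fun (blinfun_apply \<phi>) \<longleftrightarrow> complex_linear \<phi> \<and> positive_functional \<phi>"
  unfolding pos_fun_def pos_lin_blinfun using norm_blinfun[of \<phi>] by blast

lemma norm_pos_blinfun:
  assumes "pos_fun (blinfun_apply \<phi>)" shows "norm \<phi> = Re (\<phi> 1)"
proof (rule antisym)
  show "norm \<phi> \<le> Re (\<phi> 1)"
    using pos_lin_nonneg[OF pos_fun_lin[OF assms], of 1]
    by (intro norm_blinfun_bound pos_fun_bound assms) auto
  show "Re (\<phi> 1) \<le> norm \<phi>"
    using norm_blinfun[of \<phi> 1] complex_Re_le_cmod[of "\<phi> 1"] by simp
qed

lemma states_iff:
  "\<phi> \<in> states \<longleftrightarrow> pos_fun (blinfun_apply \<phi>) \<and> \<phi> 1 = 1"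
proof -
  have "norm \<phi> = 1 \<longleftrightarrow> \<phi> 1 = 1" if p: "pos_fun (blinfun_apply \<phi>)"
  proof -
    have "Im (\<phi> (adj 1 * 1)) = 0" using pos_fun_lin[OF p] unfolding pos_lin_def by blast
    thus ?thesis using norm_pos_blinfun[OF p] by (auto simp: complex_eq_iff)
  qed
  thus ?thesis by (auto simp: states_def pos_fun_blinfun)
qed

lemma pos_fun_blinfun_exists:
  assumes "pos_fun g" obtains \<phi> where "blinfun_apply \<phi> = g"
proof -
  note l = pos_lin_clin[OF pos_fun_lin[OF assms]]
  have "bounded_linear g"
    using pos_fun_bound[OF assms]
    by (intro bounded_linear_intro[of _ "Re (g 1)"]) (auto simp: clin_simps[OF l] scaleR_conv_of_real[where 'a=complex] mult.commute)
  thus ?thesis using that bounded_linear_Blinfun_apply by blast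
qed

lemma pos_lin_diff:
  assumes "pos_lin f" "pos_lin g" "\<And>a. Re (g (adj a * a)) \<le> Re (f (adj a * a))"
  shows "pos_lin (\<lambda>a. f a - g a)"
  using assms by (auto simp: pos_lin_def clin_def algebra_simps)

lemma pos_lin_scale:
  assumes "pos_lin f" "0 \<le> t" shows "pos_lin (\<lambda>a. of_real t * f a)"
  using assms by (auto simp: pos_lin_def clin_def algebra_simps)

lemma pos_fun_scale:
  assumes "pos_fun f" "0 \<le> t" shows "pos_fun (\<lambda>a. of_real t * f a)"
proof -
  obtain K where "\<And>x. cmod (f x) \<le> K * norm x" using assms by (auto simp: pos_fun_def)
  hence "cmod (of_real t * f x) \<le> (t * K) * norm x" for x
    using assms(2) by (simp add: norm_mult mult_left_mono mult.assoc)
  thus ?thesis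
    unfolding pos_fun_def using pos_lin_scale[OF pos_fun_lin[OF assms(1)] assms(2)] by blast
qed

text \<open>A dominated \<open>g\<close> splits \<open>\<omega>\<close> into the normalisations of
  \<open>g\<close> and \<open>\<omega> - g\<close> with weights t = g 1 and 1 - t, and extremality
  identifies the two. For t = 0 or t = 1 one part has value 0 at the unit and therefore
  vanishes.\<close>

lemma pure_state_pure_fun:
  assumes "\<omega> \<in> pure_states" shows "pure_fun (blinfun_apply \<omega>)"
proof -
  have ext: "\<omega> extreme_point_of states" using assms by (simp add: pure_states_def)
  hence st: "\<omega> \<in> states" by (simp add: extreme_point_of_def)
  hence f: "pos_fun (blinfun_apply \<omega>)" and f1: "\<omega> 1 = 1" by (auto simp: states_iff)
  have zero: "g a = 0" if "pos_fun g" "Re (g 1) = 0" for g :: "'a \<Rightarrow> complex" and a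
    using pos_fun_bound[OF that(1), of a] that(2) by simp
  have "g a = g 1 * \<omega> a" 
    if g: "pos_lin g" and le: "\<And>a. Re (g (adj a * a)) \<le> Re (\<omega> (adj a * a))" for g a
  proof -
    let ?h = "\<lambda>a. \<omega> a - g a"
    have gp: "pos_fun g" by (rule pos_fun_dominated[OF f g le])
    have hl: "pos_lin ?h" by (rule pos_lin_diff[OF pos_fun_lin[OF f] g le])
    have hp: "pos_fun ?h"
      by (rule pos_fun_dominated[OF f hl]) (use pos_lin_nonneg[OF g] in auto)
    define t where "t = Re (g 1)"
    have g1: "g 1 = of_real t" 
    proof -
      have "Im (g (adj 1 * 1)) = 0" using g unfolding pos_lin_def by blast
      thus ?thesis by (auto intro: complex_eqI simp: t_def)
    qed
    have t: "0 \<le> t" "t \<le> 1" using pos_lin_nonneg[OF g, of 1] le[of 1] f1 by (simp_all add: t_def)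
    have "t = 0 \<or> t = 1 \<or> 0 < t \<and> t < 1" using t by linarith
    then consider "t = 0" | "t = 1" | "0 < t" "t < 1" by blast
    thus ?thesis
    proof cases
      case 1
      hence "g 1 = 0" using g1 by simp
      thus ?thesis using zero[OF gp, of a] by simp
    next
      case 2
      hence "g 1 = 1" using g1 by simp
      thus ?thesis using zero[OF hp, of a] f1 by simp
    next
      case 3
      have p1: "pos_fun (\<lambda>a. of_real (1/t) * g a)"
        by (rule pos_fun_scale[OF gp]) (use 3 in simp)
      then obtain \<phi> where \<phi>: "blinfun_apply \<phi> = (\<lambda>a. of_real (1/t) * g a)"
        by (rule pos_fun_blinfun_exists)
      have p2: "pos_fun (\<lambda>a. of_real (1/(1-t)) * ?h a)"
        by (rule pos_fun_scale[OF hp]) (use 3 in simp)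
      then obtain \<psi> where \<psi>: "blinfun_apply \<psi> = (\<lambda>a. of_real (1/(1-t)) * ?h a)"
        by (rule pos_fun_blinfun_exists)
      have "\<omega> 1 - g 1 = of_real (1 - t)" unfolding g1 f1 by simp
      hence "of_real (1/t) * g 1 = of_real (1 / t * t)"
          "of_real (1/(1-t)) * (\<omega> 1 - g 1) = of_real (1 / (1 - t) * (1 - t))"
        unfolding g1 by (simp_all only: of_real_mult)
      hence "of_real (1/t) * g 1 = 1" "of_real (1/(1-t)) * (\<omega> 1 - g 1) = 1"
        using 3 by simp_all
      hence s: "\<phi> \<in> states" "\<psi> \<in> states"
        using p1 p2 by (simp_all only: states_iff \<phi> \<psi>)
      have e: "\<omega> = (1 - t) *\<^sub>R \<psi> + t *\<^sub>R \<phi>"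
      proof (rule blinfun_eqI)
        fix x
        have "\<omega> x = (\<omega> x - g x) + g x" by simp
        also have "\<dots> = of_real (1-t) * (of_real (1/(1-t)) * (\<omega> x - g x)) + of_real t * (of_real (1/t) * g x)"
          using 3 by (simp add: mult.assoc[symmetric] flip: of_real_mult)
        finally show "\<omega> x = ((1 - t) *\<^sub>R \<psi> + t *\<^sub>R \<phi>) x"
          by (simp only: blinfun.add_left blinfun.scaleR_left \<phi> \<psi> scaleR_conv_of_real)
      qed
      have "\<psi> = \<phi>"
      proof (rule ccontr)
        assume "\<psi> \<noteq> \<phi>"
        hence "\<omega> \<in> open_segment \<psi> \<phi>" using e 3 unfolding in_segment by blast
        thus False using ext s unfolding extreme_point_of_def by blast
      qed
      hence "\<omega> = \<phi>" using e by (simp flip: scaleR_left_distrib)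
      thus ?thesis using \<phi> 3 by (simp add: g1)
    qed
  qed
  thus ?thesis using f f1 by (auto simp: pure_fun_def)
qed

section \<open>Approximate Riesz representation and purity\<close>

text \<open>The energy \<open>B c c - 2 * l c\<close> attains its infimum only in a completion, so
  an almost minimiser is taken: its first variation is small relative to \<open>B x x\<close>. The
  setting is real so that \<open>L\<close> may also be the space of self-adjoint elements.\<close>

lemma approx_Riesz:
  fixes B :: "'v::real_vector \<Rightarrow> 'v \<Rightarrow> real"
  assumes L: "subspace L" and K: "0 \<le> K" and \<delta>: "\<delta> > 0"
    and B: "\<And>c x s. c \<in> L \<Longrightarrow> x \<in> L \<Longrightarrow>
      B (c + s *\<^sub>R x) (c + s *\<^sub>R x) = B c c + 2 * s * B c x + s\<^sup>2 * B x x"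
    and l: "\<And>c x s. c \<in> L \<Longrightarrow> x \<in> L \<Longrightarrow> l (c + s *\<^sub>R x) = l c + s * l x"
    and pos: "\<And>x. x \<in> L \<Longrightarrow> 0 \<le> B x x"
    and bd: "\<And>x. x \<in> L \<Longrightarrow> (l x)\<^sup>2 \<le> K * B x x"
  shows "\<exists>c\<in>L. \<forall>x\<in>L. (B c x - l x)\<^sup>2 \<le> \<delta> * B x x"
proof -
  define J where "J c = B c c - 2 * l c" for c
  have J: "J c \<ge> - K" if "c \<in> L" for c
  proof -
    have four_sq: "2\<^sup>2 = (4::real)" by simp
    have "(2 * l c)\<^sup>2 \<le> (K + B c c)\<^sup>2"
    proof -
      have "(K + B c c)\<^sup>2 - 4 * (K * B c c) = (K - B c c)\<^sup>2" by (simp add: power2_eq_square algebra_simps)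
      thus ?thesis using bd[OF that] zero_le_power2[of "K - B c c"] 
        unfolding power_mult_distrib four_sq by linarith
    qed
    hence "2 * l c \<le> K + B c c" using K pos[OF that] by (rule_tac power2_le_imp_le) auto
    thus ?thesis by (simp add: J_def)
  qed
  have bdd: "bdd_below (J ` L)" using J by (auto intro!: bdd_belowI[of _ "- K"])
  have ne: "J ` L \<noteq> {}" using subspace_0[OF L] by blast
  have "Inf (J ` L) < Inf (J ` L) + \<delta>" using \<delta> by simp
  then obtain c where c: "c \<in> L" "J c < Inf (J ` L) + \<delta>"
    using cInf_lessD[OF ne] by blast
  have "(B c x - l x)\<^sup>2 \<le> \<delta> * B x x" if x: "x \<in> L" for x
  proof (rule quadratic_bound)
    fix s :: real
    \<comment> \<open>A step proportional to the first variation gives the inequality the form of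
      \<open>quadratic_bound\<close>.\<close>
    define r where "r = - s * (B c x - l x)"
    have "c + r *\<^sub>R x \<in> L" using L c x by (simp add: subspace_add subspace_scale)
    hence "Inf (J ` L) \<le> J (c + r *\<^sub>R x)" by (intro cInf_lower bdd) auto
    also have "\<dots> = J c + 2 * r * (B c x - l x) + r\<^sup>2 * B x x"
      unfolding J_def B[OF c(1) x] l[OF c(1) x] by (simp add: algebra_simps)
    finally have "0 \<le> \<delta> + 2 * r * (B c x - l x) + r\<^sup>2 * B x x" using c(2) by simp
    thus "0 \<le> \<delta> - 2 * s * (B c x - l x)\<^sup>2 + s\<^sup>2 * (B c x - l x)\<^sup>2 * B x x"
      by (simp only: r_def power_mult_distrib power2_minus) (simp add: power2_eq_square)
  qed (use pos[OF x] in auto)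
  thus ?thesis using c(1) by blast
qed

section \<open>Cauchy sequences for the GNS seminorm\<close>

definition sn_Cauchy :: "('a::unital_cstar_algebra \<Rightarrow> complex) \<Rightarrow> (nat \<Rightarrow> 'a) \<Rightarrow> bool" where
  "sn_Cauchy f X \<longleftrightarrow> (\<forall>e>0. \<exists>N. \<forall>m\<ge>N. \<forall>n\<ge>N. sn f (X m - X n) < e)"

lemma sn_CauchyI:
  assumes "\<And>m n. sn f (X m - X n) \<le> r m + r n" "r \<longlonglongrightarrow> 0"
  shows "sn_Cauchy f X"
  unfolding sn_Cauchy_def
proof (intro allI impI)
  fix e :: real assume "e > 0"
  hence "eventually (\<lambda>n. r n < e / 2) sequentially" by (intro order_tendstoD(2)[OF assms(2)]) simp
  then obtain N where N: "\<And>n. n \<ge> N \<Longrightarrow> r n < e / 2" by (auto simp: eventually_sequentially)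
  have "sn f (X m - X n) < e" if "m \<ge> N" "n \<ge> N" for m n
    using assms(1)[of m n] N[OF that(1)] N[OF that(2)] by linarith
  thus "\<exists>N. \<forall>m\<ge>N. \<forall>n\<ge>N. sn f (X m - X n) < e" by blast
qed

lemma sn_Cauchy_mono:
  assumes "sn_Cauchy f X" "\<And>a. sn g a \<le> sn f a" shows "sn_Cauchy g X"
  using assms unfolding sn_Cauchy_def by (meson le_less_trans)

lemma sn_Cauchy_bounded:
  assumes f: "pos_lin f" and X: "sn_Cauchy f X"
  obtains M where "M > 0" "\<And>n. sn f (X n) \<le> M"
proof -
  obtain N where N: "\<And>m n. m \<ge> N \<Longrightarrow> n \<ge> N \<Longrightarrow> sn f (X m - X n) < 1"
    using X unfolding sn_Cauchy_def by (meson zero_less_one)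
  define M where "M = Max (insert 0 ((\<lambda>n. sn f (X n)) ` {..N})) + 1"
  have le: "sn f (X n) \<le> M - 1" if "n \<le> N" for n
    using Max_ge[of "insert 0 ((\<lambda>n. sn f (X n)) ` {..N})" "sn f (X n)"] that by (simp add: M_def)
  have "sn f (X n) \<le> M" for n
  proof (cases "n \<le> N")
    case False
    have "sn f (X n) \<le> sn f (X n - X N) + sn f (X N)" using sn_triangle[OF f, of "X n - X N" "X N"] by simp
    thus ?thesis using N[of n N] False le[of N] by simp
  qed (use le[of n] in simp)
  moreover have "M > 0" using le[of 0] sn_nonneg[OF f, of "X 0"] by simp
  ultimately show ?thesis using that by blast
qed

lemma sn_Cauchy_convergent:
  assumes f: "pos_lin f" and X: "sn_Cauchy f X" and F: "clin F" and K: "\<And>b. cmod (F b) \<le> K * sn f b"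
  shows "convergent (\<lambda>n. F (X n))"
proof -
  have "Cauchy (\<lambda>n. F (X n))"
    unfolding Cauchy_def
  proof (intro allI impI)
    fix e :: real assume e: "e > 0"
    have "e / (\<bar>K\<bar> + 1) > 0" using e by simp
    then obtain N where N: "\<And>m n. m \<ge> N \<Longrightarrow> n \<ge> N \<Longrightarrow> sn f (X m - X n) < e / (\<bar>K\<bar> + 1)"
      using X unfolding sn_Cauchy_def by meson
    have "dist (F (X m)) (F (X n)) < e" if "m \<ge> N" "n \<ge> N" for m n
    proof -
      have "dist (F (X m)) (F (X n)) \<le> K * sn f (X m - X n)"
        using K[of "X m - X n"] by (simp add: dist_norm clin_diff[OF F])
      also have "\<dots> \<le> (\<bar>K\<bar> + 1) * sn f (X m - X n)" by (intro mult_right_mono sn_nonneg f) auto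
      also have "\<dots> < e" using N[OF that] by (simp add: pos_less_divide_eq mult.commute add_nonneg_pos)
      finally show ?thesis .
    qed
    thus "\<exists>N. \<forall>m\<ge>N. \<forall>n\<ge>N. dist (F (X m)) (F (X n)) < e" by blast
  qed
  thus ?thesis by (simp add: Cauchy_convergent_iff)
qed

text \<open>The members of the sequence are themselves test vectors: in \<langle>X n, X n\<rangle> =
  \<langle>X N, X n\<rangle> + \<langle>X n - X N, X n\<rangle> the Cauchy property makes the second
  term small for a fixed large N, and weak convergence the first.\<close>

lemma weakly_null_imp_null:
  assumes f: "pos_lin f" and X: "sn_Cauchy f X" and w: "\<And>a. (\<lambda>n. f (a * X n)) \<longlonglongrightarrow> 0"
  shows "(\<lambda>n. sn f (X n)) \<longlonglongrightarrow> 0"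
proof (rule tendstoI)
  fix e :: real assume e: "e > 0"
  obtain M where M: "M > 0" "\<And>n. sn f (X n) \<le> M" using sn_Cauchy_bounded[OF f X] by blast
  obtain N where N: "\<And>m n. m \<ge> N \<Longrightarrow> n \<ge> N \<Longrightarrow> sn f (X m - X n) < e\<^sup>2 / (2 * M)"
    using X e M(1) unfolding sn_Cauchy_def by (meson divide_pos_pos zero_less_power mult_pos_pos zero_less_numeral)
  have "eventually (\<lambda>n. cmod (f (adj (X N) * X n)) < e\<^sup>2 / 2) sequentially"
    using tendstoD[OF w[of "adj (X N)"], of "e\<^sup>2 / 2"] e by simp
  hence "eventually (\<lambda>n. sn f (X n) < e) sequentially"
    using eventually_ge_at_top[of N]
  proof eventually_elim
    case (elim n)
    have "(sn f (X n))\<^sup>2 = Re (f (adj (X N) * X n)) + Re (f (adj (X n - X N) * X n))"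
      unfolding sn_power2[OF f] by (simp add: adj_diff left_diff_distrib clin_diff[OF pos_lin_clin[OF f]])
    also have "\<dots> \<le> cmod (f (adj (X N) * X n)) + cmod (f (adj (X n - X N) * X n))"
      by (intro add_mono complex_Re_le_cmod)
    also have "cmod (f (adj (X n - X N) * X n)) \<le> sn f (X n - X N) * sn f (X n)"
      by (rule Cauchy_Schwarz[OF f])
    also have "\<dots> \<le> e\<^sup>2 / (2 * M) * M"
      by (intro mult_mono less_imp_le[OF N] M(2)) (use elim e M f in auto)
    also have "cmod (f (adj (X N) * X n)) + e\<^sup>2 / (2 * M) * M < e\<^sup>2"
      using elim M(1) by simp
    finally show ?case using e by (simp add: power_less_imp_less_base)
  qed
  thus "eventually (\<lambda>n. dist (sn f (X n)) 0 < e) sequentially" using f by simp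
qed

lemma conj_diff:
  assumes f: "pos_fun f"
  shows "cmod (f (adj x * a * x) - f (adj y * a * y)) \<le> norm a * (sn f x + sn f y) * sn f (x - y)"
proof -
  note pl = pos_fun_lin[OF f]
  have "cmod (f (adj x * (a * x)) - f (adj y * (a * y))) \<le> sn f (x - y) * sn f (a * x) + sn f y * sn f (a * x - a * y)"
    by (rule inner_diff[OF pl])
  also have "\<dots> \<le> sn f (x - y) * (norm a * sn f x) + sn f y * (norm a * sn f (x - y))"
    unfolding right_diff_distrib[symmetric] by (intro add_mono mult_left_mono sn_mult f sn_nonneg pl)
  finally show ?thesis by (simp add: algebra_simps)
qed

text \<open>\<open>G\<close> is the vector functional of the limit of \<open>X\<close> in the
  completion, a vector that need not come from an algebra element.\<close>

lemma conj_limit_exists: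
  assumes f: "pos_fun f" and X: "sn_Cauchy f X"
  obtains G where "pos_fun G" "\<And>a. (\<lambda>n. f (adj (X n) * a * X n)) \<longlonglongrightarrow> G a"
proof -
  note pl = pos_fun_lin[OF f]
  obtain M where M: "M > 0" "\<And>n. sn f (X n) \<le> M" using sn_Cauchy_bounded[OF pl X] by blast
  have "convergent (\<lambda>n. f (adj (X n) * a * X n))" for a
  proof -
    have "Cauchy (\<lambda>n. f (adj (X n) * a * X n))" unfolding Cauchy_def
    proof (intro allI impI)
      fix e :: real assume e: "e > 0"
      define K where "K = (norm a + 1) * (2 * M)"
      have K: "K > 0" using M by (simp add: K_def add_nonneg_pos)
      then obtain N where N: "\<And>m n. m \<ge> N \<Longrightarrow> n \<ge> N \<Longrightarrow> sn f (X m - X n) < e / K"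
        using X e unfolding sn_Cauchy_def by (meson divide_pos_pos)
      have "dist (f (adj (X m) * a * X m)) (f (adj (X n) * a * X n)) < e" if "m \<ge> N" "n \<ge> N" for m n
      proof -
        have "dist (f (adj (X m) * a * X m)) (f (adj (X n) * a * X n))
            \<le> norm a * (sn f (X m) + sn f (X n)) * sn f (X m - X n)"
          unfolding dist_norm by (rule conj_diff[OF f])
        also have "\<dots> \<le> K * sn f (X m - X n)"
          unfolding K_def using M(2)[of m] M(2)[of n]
          by (intro mult_right_mono mult_mono) (use pl in auto)
        also have "\<dots> < e" using N[OF that] K by (simp add: pos_less_divide_eq mult.commute)
        finally show ?thesis .
      qed
      thus "\<exists>N. \<forall>m\<ge>N. \<forall>n\<ge>N. dist (f (adj (X m) * a * X m)) (f (adj (X n) * a * X n)) < e" by blast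
    qed
    thus ?thesis by (simp add: Cauchy_convergent_iff)
  qed
  then obtain G where G: "\<And>a. (\<lambda>n. f (adj (X n) * a * X n)) \<longlonglongrightarrow> G a"
    unfolding convergent_def by metis
  have "clin G" by (rule clin_limit[OF pos_lin_clin[OF pos_lin_conj[OF pl]] G])
  moreover have "Im (G (adj a * a)) = 0 \<and> 0 \<le> Re (G (adj a * a))" for a
  proof -
    have e: "f (adj (X n) * (adj a * a) * X n) = of_real ((sn f (a * X n))\<^sup>2)" for n
      using pos_lin_sn[OF pl, of "a * X n"] by (simp add: adj_mult mult.assoc)
    have "(\<lambda>n. of_real ((sn f (a * X n))\<^sup>2)) \<longlonglongrightarrow> G (adj a * a)"
      using G[of "adj a * a"] unfolding e .
    hence "(\<lambda>n. Im (of_real ((sn f (a * X n))\<^sup>2))) \<longlonglongrightarrow> Im (G (adj a * a))"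
      and "(\<lambda>n. Re (of_real ((sn f (a * X n))\<^sup>2))) \<longlonglongrightarrow> Re (G (adj a * a))"
      by (intro tendsto_intros; assumption)+
    hence 1: "(\<lambda>n. 0) \<longlonglongrightarrow> Im (G (adj a * a))" 
      and 2: "(\<lambda>n. (sn f (a * X n))\<^sup>2) \<longlonglongrightarrow> Re (G (adj a * a))" by simp_all
    have "Im (G (adj a * a)) = 0" by (rule LIMSEQ_unique[OF 1 tendsto_const])
    moreover have "0 \<le> Re (G (adj a * a))" by (rule LIMSEQ_le_const[OF 2]) simp
    ultimately show ?thesis by simp
  qed
  ultimately have Gl: "pos_lin G" by (simp add: pos_lin_def)
  have "cmod (G a) \<le> M\<^sup>2 * norm a" for a
  proof (rule LIMSEQ_le_const2[OF tendsto_norm[OF G]])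
    have "cmod (f (adj (X n) * a * X n)) \<le> M\<^sup>2 * norm a" for n
    proof -
      have "cmod (f (adj (X n) * a * X n)) \<le> sn f (X n) * sn f (a * X n)"
        using Cauchy_Schwarz[OF pl, of "X n" "a * X n"] by (simp add: mult.assoc)
      also have "\<dots> \<le> sn f (X n) * (norm a * sn f (X n))" by (intro mult_left_mono sn_mult f sn_nonneg pl)
      also have "\<dots> = (sn f (X n))\<^sup>2 * norm a" by (simp add: power2_eq_square)
      also have "\<dots> \<le> M\<^sup>2 * norm a" by (intro mult_right_mono power_mono M(2) sn_nonneg pl) auto
      finally show ?thesis .
    qed
    thus "\<exists>N. \<forall>n\<ge>N. cmod (f (adj (X n) * a * X n)) \<le> M\<^sup>2 * norm a" by blast
  qed
  hence "pos_fun G" using Gl by (auto simp: pos_fun_def)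
  thus ?thesis using that G by blast
qed

lemma sn_conj_limit:
  assumes f: "pos_fun f" and G: "\<And>a. (\<lambda>n. f (adj (X n) * a * X n)) \<longlonglongrightarrow> G a"
  shows "(\<lambda>n. sn f (b * X n)) \<longlonglongrightarrow> sn G b"
proof -
  have "(\<lambda>n. sqrt (Re (f (adj (X n) * (adj b * b) * X n)))) \<longlonglongrightarrow> sqrt (Re (G (adj b * b)))"
    by (intro tendsto_intros G)
  thus ?thesis by (simp add: sn_def adj_mult mult.assoc)
qed

lemma conj_tendsto:
  assumes f: "pos_fun f" and X: "(\<lambda>n. sn f (X n - x)) \<longlonglongrightarrow> 0"
  shows "(\<lambda>n. f (adj (X n) * a * X n)) \<longlonglongrightarrow> f (adj x * a * x)"
proof -
  note pl = pos_fun_lin[OF f]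
  have "(\<lambda>n. norm a * (sn f (X n - x) + 2 * sn f x) * sn f (X n - x)) \<longlonglongrightarrow> norm a * (0 + 2 * sn f x) * 0"
    by (intro tendsto_intros X)
  hence lim: "(\<lambda>n. norm a * (sn f (X n - x) + 2 * sn f x) * sn f (X n - x)) \<longlonglongrightarrow> 0" by simp
  have "cmod (f (adj (X n) * a * X n) - f (adj x * a * x)) \<le> norm a * (sn f (X n - x) + 2 * sn f x) * sn f (X n - x)" for n
  proof -
    have "sn f (X n) + sn f x \<le> sn f (X n - x) + 2 * sn f x" using sn_triangle[OF pl, of "X n - x" x] by simp
    hence "norm a * (sn f (X n) + sn f x) * sn f (X n - x) \<le> norm a * (sn f (X n - x) + 2 * sn f x) * sn f (X n - x)"
      by (intro mult_right_mono mult_left_mono sn_nonneg pl) auto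
    thus ?thesis using conj_diff[OF f, of "X n" a x] by linarith
  qed
  hence "(\<lambda>n. f (adj (X n) * a * X n) - f (adj x * a * x)) \<longlonglongrightarrow> 0"
    by (intro Lim_null_comparison[OF _ lim]) auto
  thus ?thesis by (simp add: LIM_zero_iff)
qed

text \<open>The real version controls real parts only; rotating the argument by a phase turns the
  deviation at \<open>a\<close> into its modulus.\<close>

lemma approx_Riesz_functional:
  assumes X: "pos_fun X" and F: "clin F" and K: "\<And>a. cmod (F a) \<le> K * sn X a" and e: "e > 0"
  shows "\<exists>c. \<forall>a. cmod (X (adj c * a) - F a) \<le> e * sn X a"
proof -
  note pl = pos_fun_lin[OF X]
  note l = pos_lin_clin[OF pl]
  have "\<exists>c\<in>UNIV. \<forall>x\<in>UNIV. (Re (X (adj c * x)) - Re (F x))\<^sup>2 \<le> e\<^sup>2 * Re (X (adj x * x))"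
  proof (rule approx_Riesz[where K = "K\<^sup>2"])
    fix c x :: 'a and s :: real
    show "Re (X (adj (c + s *\<^sub>R x) * (c + s *\<^sub>R x))) =
      Re (X (adj c * c)) + 2 * s * Re (X (adj c * x)) + s\<^sup>2 * Re (X (adj x * x))"
      unfolding pos_lin_expand[OF pl] by (simp add: clin_simps[OF l] adj_scaleR power2_eq_square)
    show "Re (F (c + s *\<^sub>R x)) = Re (F c) + s * Re (F x)" by (simp add: clin_simps[OF F])
    show "0 \<le> Re (X (adj x * x))" by (rule pos_lin_nonneg[OF pl])
    have "\<bar>Re (F x)\<bar> \<le> K * sn X x" using abs_Re_le_cmod[of "F x"] K[of x] by linarith
    hence "(Re (F x))\<^sup>2 \<le> (K * sn X x)\<^sup>2" using abs_ge_zero[of "Re (F x)"] by (subst power2_abs[symmetric], intro power_mono) auto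
    thus "(Re (F x))\<^sup>2 \<le> K\<^sup>2 * Re (X (adj x * x))" by (simp add: power_mult_distrib sn_power2[OF pl])
  qed (use e in auto)
  then obtain c where c: "\<And>x. (Re (X (adj c * x)) - Re (F x))\<^sup>2 \<le> e\<^sup>2 * Re (X (adj x * x))" by blast
  have "cmod (X (adj c * a) - F a) \<le> e * sn X a" for a
  proof -
    define z where "z = X (adj c * a) - F a"
    obtain \<theta> where t1: "cmod \<theta> = 1" and t2: "\<theta> * z = of_real (cmod z)"
      using phase_exists by blast
    have "X (adj c * \<theta> *\<^sub>C a) - F (\<theta> *\<^sub>C a) = \<theta> * z"
      by (simp add: z_def clin_simps[OF l] clin_simps[OF F] cstar_simps right_diff_distrib)
    hence "Re (X (adj c * \<theta> *\<^sub>C a)) - Re (F (\<theta> *\<^sub>C a)) = cmod z"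
      by (metis t2 Re_complex_of_real minus_complex.simps(1))
    hence "(cmod z)\<^sup>2 \<le> e\<^sup>2 * (sn X (\<theta> *\<^sub>C a))\<^sup>2"
      using c[of "\<theta> *\<^sub>C a"] unfolding sn_power2[OF pl] by metis
    hence "(cmod z)\<^sup>2 \<le> (e * sn X a)\<^sup>2" by (simp add: sn_scaleC[OF pl] t1 power_mult_distrib)
    thus ?thesis unfolding z_def[symmetric] by (rule power2_le_imp_le) (use e pl in simp)
  qed
  thus ?thesis by blast
qed

text \<open>In the GNS space of \<open>f\<close> and that of \<open>X\<close>, \<open>F a = \<langle>\<Omega>, a T \<Omega>'\<rangle>\<close> for a bounded intertwiner \<open>T\<close>, and the
  \<open>c n\<close> converge to \<open>T* \<Omega>\<close>. As \<open>T T*\<close> commutes with the algebra, purity makes it the scalar \<open>t\<close>.\<close>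
lemma pure_coupling:
  assumes f: "pure_fun f" and X: "pos_fun X" and F: "clin F"
    and CS: "\<And>a b. cmod (F (adj a * b)) \<le> sn f a * sn X b"
  obtains c t where "t \<ge> 0"
    and "\<And>n a. cmod (X (adj (c n) * a) - F a) \<le> inverse (real (Suc n)) * sn X a"
    and "\<And>a. (\<lambda>n. F (a * c n)) \<longlonglongrightarrow> of_real t * f a"
    and "(\<lambda>n. (sn X (c n))\<^sup>2) \<longlonglongrightarrow> t"
    and "sn_Cauchy X c"
proof -
  note fp = pure_fun_pos[OF f]
  note fl = pos_fun_lin[OF fp]
  note pl = pos_fun_lin[OF X]
  note l = pos_lin_clin[OF pl]
  have f1: "sn f 1 = 1" by (simp add: sn_def pure_fun_one[OF f])
  have K: "cmod (F a) \<le> 1 * sn X a" for a using CS[of 1 a] f1 by simp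
  have "\<exists>c. \<forall>a. cmod (X (adj c * a) - F a) \<le> inverse (real (Suc n)) * sn X a" for n
    by (rule approx_Riesz_functional[OF X F K]) simp
  then obtain c where c: "\<And>n a. cmod (X (adj (c n) * a) - F a) \<le> inverse (real (Suc n)) * sn X a"
    by metis
  \<comment> \<open>The difference of two approximate representers is tested against itself.\<close>
  have C: "sn_Cauchy X c"
  proof (rule sn_CauchyI[OF _ LIMSEQ_inverse_real_of_nat])
    fix m n
    define d where "d = c m - c n"
    have "(sn X d)\<^sup>2 = cmod (X (adj d * d))" by (simp add: pos_lin_sn[OF pl] norm_power)
    also have "X (adj d * d) = (X (adj (c m) * d) - F d) - (X (adj (c n) * d) - F d)"
      by (simp add: d_def adj_diff left_diff_distrib clin_diff[OF l])
    also have "cmod \<dots> \<le> inverse (real (Suc m)) * sn X d + inverse (real (Suc n)) * sn X d"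
      by (rule order_trans[OF norm_triangle_ineq4 add_mono[OF c c]])
    finally have "sn X d * sn X d \<le> (inverse (real (Suc m)) + inverse (real (Suc n))) * sn X d"
      by (simp only: power2_eq_square distrib_right)
    hence "sn X d \<le> inverse (real (Suc m)) + inverse (real (Suc n))"
      using sn_nonneg[OF pl, of d] by (cases "sn X d = 0") (auto simp: mult_le_cancel_right)
    thus "sn X (c m - c n) \<le> inverse (real (Suc m)) + inverse (real (Suc n))" unfolding d_def .
  qed
  obtain M where M: "M > 0" "\<And>n. sn X (c n) \<le> M" using sn_Cauchy_bounded[OF pl C] by blast
  have "convergent (\<lambda>n. F (a * c n))" for a
    using sn_Cauchy_convergent[OF pl C clin_mult_left[OF F], of a "sn f (adj a)"] CS[of "adj a"] by simp
  then obtain \<phi> where \<phi>: "\<And>a. (\<lambda>n. F (a * c n)) \<longlonglongrightarrow> \<phi> a" unfolding convergent_def by metis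
  have \<phi>l: "clin \<phi>" by (rule clin_limit[OF clin_mult_right[OF F] \<phi>])
  have lim: "(\<lambda>n. of_real ((sn X (a * c n))\<^sup>2)) \<longlonglongrightarrow> \<phi> (adj a * a)" for a
  proof -
    have lim0: "(\<lambda>n. inverse (real (Suc n)) * (norm (adj a * a) * M)) \<longlonglongrightarrow> 0"
      by (rule tendsto_mult_left_zero[OF LIMSEQ_inverse_real_of_nat])
    have "cmod (of_real ((sn X (a * c n))\<^sup>2) - F (adj a * a * c n)) 
        \<le> inverse (real (Suc n)) * (norm (adj a * a) * M)" for n
    proof -
      have "of_real ((sn X (a * c n))\<^sup>2) = X (adj (c n) * (adj a * a * c n))"
        using pos_lin_sn[OF pl, of "a * c n"] by (simp add: adj_mult mult.assoc)
      hence "cmod (of_real ((sn X (a * c n))\<^sup>2) - F (adj a * a * c n)) 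
          \<le> inverse (real (Suc n)) * sn X (adj a * a * c n)" using c by simp
      also have "\<dots> \<le> inverse (real (Suc n)) * (norm (adj a * a) * sn X (c n))"
        by (intro mult_left_mono sn_mult X) auto
      also have "\<dots> \<le> inverse (real (Suc n)) * (norm (adj a * a) * M)"
        by (intro mult_left_mono M) auto
      finally show ?thesis .
    qed
    hence "(\<lambda>n. of_real ((sn X (a * c n))\<^sup>2) - F (adj a * a * c n)) \<longlonglongrightarrow> 0"
      by (intro Lim_null_comparison[OF _ lim0]) auto
    from tendsto_add[OF this \<phi>[of "adj a * a"]] show ?thesis by simp
  qed
  have limR: "(\<lambda>n. (sn X (a * c n))\<^sup>2) \<longlonglongrightarrow> Re (\<phi> (adj a * a))" for a
    using tendsto_Re[OF lim[of a]] by simp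
  have Re0: "Re (\<phi> (adj a * a)) \<ge> 0" for a
    by (rule LIMSEQ_le_const[OF limR]) simp
  have Im0: "Im (\<phi> (adj a * a)) = 0" for a
    using tendsto_Im[OF lim[of a]] LIMSEQ_unique[OF _ tendsto_const] by fastforce
  have \<phi>pos: "pos_lin \<phi>" using \<phi>l Re0 Im0 by (simp add: pos_lin_def)
  \<comment> \<open>In the limit Cauchy-Schwarz bounds the square of \<open>sn \<phi> a\<close> by
    \<open>sn f a * sn \<phi> a\<close>, and one factor cancels.\<close>
  have dom: "Re (\<phi> (adj a * a)) \<le> Re (f (adj a * a))" for a
  proof -
    have "(\<lambda>n. sqrt ((sn X (a * c n))\<^sup>2)) \<longlonglongrightarrow> sqrt (Re (\<phi> (adj a * a)))"
      by (intro tendsto_intros limR)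
    hence 1: "(\<lambda>n. sn f a * sn X (a * c n)) \<longlonglongrightarrow> sn f a * sn \<phi> a"
      using pl by (intro tendsto_intros) (simp add: sn_def[of \<phi>])
    have "cmod (\<phi> (adj a * a)) \<le> sn f a * sn \<phi> a"
      using CS[of a "a * c _"] 
      by (intro LIMSEQ_le[OF tendsto_norm[OF \<phi>] 1]) (auto simp: mult.assoc)
    hence "sn \<phi> a * sn \<phi> a \<le> sn f a * sn \<phi> a"
      by (simp add: pos_lin_sn[OF \<phi>pos] power2_eq_square norm_mult)
    hence "sn \<phi> a \<le> sn f a"
      using sn_nonneg[OF \<phi>pos, of a] sn_nonneg[OF fl, of a] 
      by (cases "sn \<phi> a = 0") (auto simp: mult_le_cancel_right)
    hence "(sn \<phi> a)\<^sup>2 \<le> (sn f a)\<^sup>2" using sn_nonneg[OF \<phi>pos] by (rule power_mono)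
    thus ?thesis unfolding sn_power2[OF \<phi>pos] sn_power2[OF fl] .
  qed
  define t where "t = Re (\<phi> 1)"
  have t1: "\<phi> 1 = of_real t" using Im0[of 1] by (auto simp: t_def intro: complex_eqI)
  have \<phi>f: "\<phi> a = of_real t * f a" for a
    using pure_funD[OF f \<phi>pos dom, of a] unfolding t1 .
  show ?thesis
  proof (rule that[of t c])
    show "t \<ge> 0" using Re0[of 1] by (simp add: t_def)
    show "(\<lambda>n. F (a * c n)) \<longlonglongrightarrow> of_real t * f a" for a using \<phi>[of a] unfolding \<phi>f .
    show "(\<lambda>n. (sn X (c n))\<^sup>2) \<longlonglongrightarrow> t" using limR[of 1] by (simp add: t_def)
  qed (use c C in auto)
qed

text \<open>Coupling \<open>f\<close> with the vector functional of \<open>x\<close> makes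
  \<open>c n * x\<close> converge to the projection of \<Omega> onto the closure of the vectors
  \<open>a * x\<close>. By purity this projection is t \<Omega>, and being a projection forces t^2 =
  t. For t = 0 the functional \<open>?F\<close> would vanish, although its value at
  \<open>adj x\<close> is the squared length of \<open>x\<close>.\<close>

lemma pure_cyclic:
  assumes f: "pure_fun f" and x: "sn f x > 0" and e: "e > 0"
  shows "\<exists>a. sn f (1 - a * x) < e"
proof -
  note fp = pure_fun_pos[OF f]
  note fl = pos_fun_lin[OF fp]
  note l = pos_lin_clin[OF fl]
  let ?X = "\<lambda>a. f (adj x * a * x)" and ?F = "\<lambda>a. f (a * x)"
  have sX: "sn ?X b = sn f (b * x)" for b by (rule sn_conj)
  have F: "clin ?F" by (rule clin_mult_right[OF l])
  have CS: "cmod (?F (adj a * b)) \<le> sn f a * sn ?X b" for a b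
    unfolding sX using Cauchy_Schwarz[OF fl, of a "b * x"] by (simp add: mult.assoc)
  obtain c t where t0: "t \<ge> 0"
    and c: "\<And>n a. cmod (?X (adj (c n) * a) - ?F a) \<le> inverse (real (Suc n)) * sn ?X a"
    and cF: "\<And>a. (\<lambda>n. ?F (a * c n)) \<longlonglongrightarrow> of_real t * f a"
    and ct: "(\<lambda>n. (sn ?X (c n))\<^sup>2) \<longlonglongrightarrow> t" and C: "sn_Cauchy ?X c"
    using pure_coupling[OF f pos_fun_conj[OF fp] F CS] by metis
  define d where "d n = c n * x - of_real t *\<^sub>C 1" for n
  have "sn_Cauchy f d"
    using C unfolding sn_Cauchy_def sX d_def by (simp add: left_diff_distrib)
  moreover have "(\<lambda>n. f (a * d n)) \<longlonglongrightarrow> 0" for a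
  proof -
    have "f (a * d n) = ?F (a * c n) - of_real t * f a" for n
      by (simp add: d_def right_diff_distrib clin_simps[OF l] cstar_simps mult.assoc)
    thus ?thesis using cF[of a] by (simp add: LIM_zero)
  qed
  ultimately have d0: "(\<lambda>n. sn f (d n)) \<longlonglongrightarrow> 0" by (rule weakly_null_imp_null[OF fl])
  have st: "sn f (of_real t *\<^sub>C 1) = t" using t0 by (simp add: sn_scaleC[OF fl]) (simp add: sn_def pure_fun_one[OF f])
  have "(\<lambda>n. sn f (c n * x)) \<longlonglongrightarrow> t"
  proof (rule Lim_transform2)
    show "(\<lambda>n. t) \<longlonglongrightarrow> t" by simp
    have "\<bar>t - sn f (c n * x)\<bar> \<le> sn f (d n)" for n
      using sn_triangle[OF fl, of "d n" "of_real t *\<^sub>C 1"] 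
        sn_diff_le[OF fl, of "c n * x" "d n"] by (simp add: st) (simp add: d_def st)
    thus "(\<lambda>n. t - sn f (c n * x)) \<longlonglongrightarrow> 0"
      by (intro Lim_null_comparison[OF _ d0]) (auto simp: real_norm_def)
  qed
  from tendsto_power[OF this, of 2] have "t\<^sup>2 = t" using ct unfolding sX by (rule LIMSEQ_unique)
  hence "t = 0 \<or> t = 1" by (simp add: power2_eq_square)
  moreover have "t \<noteq> 0"
  proof
    assume t: "t = 0"
    have y0: "(\<lambda>n. sn f (c n * x)) \<longlonglongrightarrow> 0" using d0 by (simp add: d_def t)
    have "?F a = 0" for a
    proof -
      have "cmod (?F a) \<le> inverse (real (Suc n)) * sn ?X a + sn f (c n * x) * sn ?X a" for n
      proof -
        have "cmod (?X (adj (c n) * a)) \<le> sn f (c n * x) * sn ?X a"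
          using Cauchy_Schwarz[OF pos_fun_lin[OF pos_fun_conj[OF fp]], of x "c n" a] by (simp add: sX)
        thus ?thesis using c[of n a] norm_triangle_sub[of "?F a" "?X (adj (c n) * a)"] 
          by (simp add: norm_minus_commute)
      qed
      moreover have "(\<lambda>n. inverse (real (Suc n)) * sn ?X a + sn f (c n * x) * sn ?X a) \<longlonglongrightarrow> 0 * sn ?X a + 0 * sn ?X a"
        by (intro tendsto_intros y0 LIMSEQ_inverse_real_of_nat)
      ultimately have "cmod (?F a) \<le> 0 * sn ?X a + 0 * sn ?X a"
        by (intro LIMSEQ_le_const[of _ "0 * sn ?X a + 0 * sn ?X a" "cmod (?F a)"]) auto
      thus ?thesis by simp
    qed
    from this[of "adj x"] show False using x by (simp add: sn_def)
  qed
  ultimately have t1: "t = 1" by simp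
  have "eventually (\<lambda>n. sn f (d n) < e) sequentially" by (rule order_tendstoD(2)[OF d0 e])
  then obtain n where "sn f (d n) < e" by (auto simp: eventually_sequentially)
  thus ?thesis using sn_minus_commute[OF fl, of 1] by (auto simp: d_def t1)
qed

text \<open>By cyclicity there are \<open>b n\<close> with \<open>b n * x\<close> tending to
  \<Omega>. Conjugation by \<open>b n\<close> turns a functional \<open>g\<close> dominated by the
  vector functional into a limit \<open>G\<close> dominated by \<open>f\<close>, hence a multiple of
  \<open>f\<close>. Evaluating \<open>G\<close> at \<open>adj x * c * x\<close> recovers
  \<open>g c\<close>, because \<open>x * b n\<close> tends to 1 in the seminorm of
  \<open>g\<close>.\<close>

lemma pure_vector:
  assumes f: "pure_fun f" and x: "sn f x = 1"
  shows "pure_fun (\<lambda>a. f (adj x * a * x))"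
  unfolding pure_fun_def
proof (intro conjI allI impI)
  note fp = pure_fun_pos[OF f]
  note fl = pos_fun_lin[OF fp]
  let ?X = "\<lambda>a. f (adj x * a * x)"
  show "pos_fun ?X" by (rule pos_fun_conj[OF fp])
  show "f (adj x * 1 * x) = 1" using pos_lin_sn[OF fl, of x] x by simp
  fix g a
  assume "pos_lin g \<and> (\<forall>a. Re (g (adj a * a)) \<le> Re (f (adj x * (adj a * a) * x)))"
  hence g: "pos_lin g" and le: "\<And>a. Re (g (adj a * a)) \<le> Re (?X (adj a * a))" by auto
  have gp: "pos_fun g" by (rule pos_fun_dominated[OF pos_fun_conj[OF fp] g le])
  have sg: "sn g b \<le> sn f (b * x)" for b using le[of b] unfolding sn_conj[symmetric] by (simp add: sn_def)
  have "\<exists>b. sn f (1 - b * x) < inverse (real (Suc n))" for n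
    by (rule pure_cyclic[OF f]) (use x in auto)
  then obtain b where b: "\<And>n. sn f (1 - b n * x) < inverse (real (Suc n))" by metis
  have bC: "sn_Cauchy g b"
  proof (rule sn_CauchyI[OF _ LIMSEQ_inverse_real_of_nat])
    fix m n
    have "sn g (b m - b n) \<le> sn f ((b m * x - 1) - (b n * x - 1))"
      using sg[of "b m - b n"] by (simp add: left_diff_distrib)
    also have "\<dots> \<le> sn f (b m * x - 1) + sn f (b n * x - 1)" by (rule sn_diff_le[OF fl])
    also have "\<dots> \<le> inverse (real (Suc m)) + inverse (real (Suc n))"
      using b[of m] b[of n] by (simp add: sn_minus_commute[OF fl, of _ 1])
    finally show "sn g (b m - b n) \<le> inverse (real (Suc m)) + inverse (real (Suc n))" .
  qed
  obtain G where G: "pos_fun G" "\<And>a. (\<lambda>n. g (adj (b n) * a * b n)) \<longlonglongrightarrow> G a"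
    using conj_limit_exists[OF gp bC] by blast
  have bl: "(\<lambda>n. sn f (b n * x - 1)) \<longlonglongrightarrow> 0"
  proof (rule tendsto_sandwich[OF _ _ tendsto_const LIMSEQ_inverse_real_of_nat])
    show "\<forall>\<^sub>F n in sequentially. 0 \<le> sn f (b n * x - 1)" using fl by simp
    show "\<forall>\<^sub>F n in sequentially. sn f (b n * x - 1) \<le> inverse (real (Suc n))"
      using b by (simp add: sn_minus_commute[OF fl, of _ 1] less_imp_le)
  qed
  have "Re (G (adj c * c)) \<le> Re (f (adj c * c))" for c
  proof (rule LIMSEQ_le)
    show "(\<lambda>n. Re (g (adj (b n) * (adj c * c) * b n))) \<longlonglongrightarrow> Re (G (adj c * c))" by (intro tendsto_intros G)
    have "(\<lambda>n. Re (f (adj (b n * x) * (adj c * c) * (b n * x)))) \<longlonglongrightarrow> Re (f (adj 1 * (adj c * c) * 1))"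
      by (intro tendsto_intros conj_tendsto fp bl)
    thus "(\<lambda>n. Re (f (adj (b n * x) * (adj c * c) * (b n * x)))) \<longlonglongrightarrow> Re (f (adj c * c))" by simp
    have "Re (g (adj (b n) * (adj c * c) * b n)) \<le> Re (f (adj (b n * x) * (adj c * c) * (b n * x)))" for n
      using le[of "c * b n"] by (simp add: adj_mult mult.assoc)
    thus "\<exists>N. \<forall>n\<ge>N. Re (g (adj (b n) * (adj c * c) * b n)) \<le> Re (f (adj (b n * x) * (adj c * c) * (b n * x)))"
      by blast
  qed
  from pure_funD[OF f pos_fun_lin[OF G(1)] this] have Gf: "G c = G 1 * f c" for c .
  have *: "g c = G 1 * f (adj x * c * x)" for c
  proof (rule LIMSEQ_unique)
    show "(\<lambda>n. g (adj (b n) * (adj x * c * x) * b n)) \<longlonglongrightarrow> G 1 * f (adj x * c * x)"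
      using G(2)[of "adj x * c * x"] unfolding Gf[of "adj x * c * x"] .
    have "(\<lambda>n. sn g (x * b n - 1)) \<longlonglongrightarrow> 0"
    proof (rule tendsto_sandwich[OF _ _ tendsto_const tendsto_mult_right_zero[OF bl, of "norm x"]])
      show "\<forall>\<^sub>F n in sequentially. 0 \<le> sn g (x * b n - 1)" using g by simp
      have "sn g (x * b n - 1) \<le> norm x * sn f (b n * x - 1)" for n
        using sg[of "x * b n - 1"] sn_mult[OF fp, of x "b n * x - 1"]
        by (simp add: left_diff_distrib right_diff_distrib mult.assoc)
      thus "\<forall>\<^sub>F n in sequentially. sn g (x * b n - 1) \<le> norm x * sn f (b n * x - 1)" by simp
    qed
    from conj_tendsto[OF gp this, of c]
    show "(\<lambda>n. g (adj (b n) * (adj x * c * x) * b n)) \<longlonglongrightarrow> g c" by (simp add: adj_mult mult.assoc)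
  qed
  have "g 1 = G 1" using *[of 1] pos_lin_sn[OF fl, of x] x by simp
  thus "g a = g 1 * f (adj x * a * x)" using *[of a] by simp
qed

section \<open>Self-adjoint elements applied to the cyclic vector\<close>

lemma selfadj_decomp:
  obtains x y where "x \<in> selfadj" "y \<in> selfadj" "a = x + \<i> *\<^sub>C y"
proof
  let ?x = "(1/2) *\<^sub>R (a + adj a)" and ?y = "(1/2) *\<^sub>R (- (\<i> *\<^sub>C (a - adj a)))"
  show "?x \<in> selfadj" by (simp add: selfadj_def adj_scaleR adj_add add.commute)
  show "?y \<in> selfadj" by (simp add: selfadj_def adj_scaleR cstar_simps)
  have "\<i> *\<^sub>C ?y = (1/2) *\<^sub>R (a - adj a)" by (simp add: scaleC_scaleR scaleC_scaleC scaleR_diff_right)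
  hence "?x + \<i> *\<^sub>C ?y = (1/2) *\<^sub>R ((a + adj a) + (a - adj a))" by (simp only: scaleR_right_distrib)
  also have "\<dots> = a" by (simp flip: scaleR_2)
  finally show "a = ?x + \<i> *\<^sub>C ?y" by simp
qed

text \<open>If \<open>\<eta>\<close> is orthogonal to \<open>i h \<Omega>\<close> for all self-adjoint \<open>h\<close>, then \<open>a \<Omega> \<mapsto> a \<eta>\<close> is a densely defined
  skew-symmetric operator \<open>D\<close> commuting with the algebra. Here \<open>F a = \<langle>\<Omega>, a \<eta>\<rangle>\<close>, \<open>G a = \<langle>\<eta>, a \<eta>\<rangle>\<close>, and
  coupling \<open>f\<close> with \<open>f + G\<close> yields the bounded operator \<open>(1 + D* D)^(-1)\<close>, which is scalar.\<close>
lemma pure_skew_bounded: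
  assumes f: "pure_fun f" and \<eta>: "sn_Cauchy f \<eta>"
    and F: "\<And>a. (\<lambda>n. f (a * \<eta> n)) \<longlonglongrightarrow> F a" and skew: "\<And>a. F (adj a) = - cnj (F a)"
  obtains S where "S > 0" "\<And>a b. cmod (F (adj a * b)) \<le> S * sn f a * sn f b"
proof -
  note fp = pure_fun_pos[OF f]
  note fl = pos_fun_lin[OF fp]
  note l = pos_lin_clin[OF fl]
  have f1: "sn f 1 = 1" by (simp add: sn_def pure_fun_one[OF f])
  obtain G where G: "pos_fun G" "\<And>a. (\<lambda>n. f (adj (\<eta> n) * a * \<eta> n)) \<longlonglongrightarrow> G a"
    using conj_limit_exists[OF fp \<eta>] by blast
  note Gl = pos_fun_lin[OF G(1)]
  note sG = sn_conj_limit[OF fp G(2)]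
  have Fl: "clin F" by (rule clin_limit[OF clin_mult_right[OF l] F])
  have FG: "cmod (F (adj a * b)) \<le> sn f a * sn G b" for a b
    using Cauchy_Schwarz[OF fl, of a "b * \<eta> _"]
    by (intro LIMSEQ_le[OF tendsto_norm[OF F] tendsto_mult_left[OF sG]]) (auto simp: mult.assoc)
  \<comment> \<open>Freezing the left \<open>\<eta> n\<close> at a fixed \<open>\<eta> N\<close>
    approximates \<open>G\<close> by values of \<open>F\<close>, with an error relative to
    \<open>sn G\<close>.\<close>
  have approx: "\<exists>x. \<forall>a. cmod (G a - F (adj x * a)) \<le> e * sn G a" if "e > 0" for e
  proof -
    have "\<exists>N. \<forall>m\<ge>N. \<forall>n\<ge>N. sn f (\<eta> m - \<eta> n) < e"
      using \<eta> that unfolding sn_Cauchy_def by blast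
    then obtain N where N: "\<And>n. n \<ge> N \<Longrightarrow> sn f (\<eta> n - \<eta> N) < e" by blast
    have "cmod (G a - F (adj (\<eta> N) * a)) \<le> e * sn G a" for a
    proof (rule LIMSEQ_le)
      show "(\<lambda>n. cmod (f (adj (\<eta> n) * a * \<eta> n) - f (adj (\<eta> N) * a * \<eta> n))) 
          \<longlonglongrightarrow> cmod (G a - F (adj (\<eta> N) * a))"
        by (intro tendsto_intros G F)
      show "(\<lambda>n. e * sn f (a * \<eta> n)) \<longlonglongrightarrow> e * sn G a" by (intro tendsto_intros sG)
      have "cmod (f (adj (\<eta> n) * a * \<eta> n) - f (adj (\<eta> N) * a * \<eta> n)) \<le> e * sn f (a * \<eta> n)" if "n \<ge> N" for n
      proof -
        have "f (adj (\<eta> n) * a * \<eta> n) - f (adj (\<eta> N) * a * \<eta> n) = f (adj (\<eta> n - \<eta> N) * (a * \<eta> n))"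
          by (simp add: adj_diff left_diff_distrib clin_diff[OF l] mult.assoc)
        thus ?thesis using Cauchy_Schwarz[OF fl, of "\<eta> n - \<eta> N" "a * \<eta> n"] 
            mult_right_mono[OF less_imp_le[OF N[OF that]], of "sn f (a * \<eta> n)"] fl by simp
      qed
      thus "\<exists>M. \<forall>n\<ge>M. cmod (f (adj (\<eta> n) * a * \<eta> n) - f (adj (\<eta> N) * a * \<eta> n)) \<le> e * sn f (a * \<eta> n)"
        by blast
    qed
    thus ?thesis by blast
  qed
  define X where "X a = f a + G a" for a
  have Xl: "pos_lin X"
    using fl Gl by (simp add: X_def pos_lin_def clin_def algebra_simps)
  have X: "pos_fun X"
  proof -
    have "cmod (X a) \<le> (Re (f 1) + Re (G 1)) * norm a" for a
      unfolding X_def distrib_right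
      by (rule order_trans[OF norm_triangle_ineq add_mono[OF pos_fun_bound[OF fp] pos_fun_bound[OF G(1)]]])
    thus ?thesis using Xl by (auto simp: pos_fun_def)
  qed
  have sX: "sn f a \<le> sn X a" "sn G a \<le> sn X a" for a
    using pos_lin_nonneg[OF fl, of a] pos_lin_nonneg[OF Gl, of a] by (simp_all add: sn_def X_def)
  have CS: "cmod (f (adj a * b)) \<le> sn f a * sn X b" for a b
    by (rule order_trans[OF Cauchy_Schwarz[OF fl] mult_left_mono[OF sX(1) sn_nonneg[OF fl]]])
  obtain c t where t0: "t \<ge> 0"
    and c: "\<And>n a. cmod (X (adj (c n) * a) - f a) \<le> inverse (real (Suc n)) * sn X a"
    and cf: "\<And>a. (\<lambda>n. f (a * c n)) \<longlonglongrightarrow> of_real t * f a"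
    and ct: "(\<lambda>n. (sn X (c n))\<^sup>2) \<longlonglongrightarrow> t" and C: "sn_Cauchy X c"
    using pure_coupling[OF f X l CS] by metis
  have cX: "(\<lambda>n. X (adj (c n) * a)) \<longlonglongrightarrow> f a" for a
  proof -
    have "(\<lambda>n. X (adj (c n) * a) - f a) \<longlonglongrightarrow> 0"
      by (rule Lim_null_comparison[OF _ tendsto_mult_left_zero[OF LIMSEQ_inverse_real_of_nat, of "sn X a"]])
         (use c in auto)
    thus ?thesis by (simp add: LIM_zero_iff)
  qed
  have tn: "t \<noteq> 0"
  proof
    assume "t = 0"
    with tendsto_real_sqrt[OF ct] have s0: "(\<lambda>n. sn X (c n)) \<longlonglongrightarrow> 0" using Xl by simp
    have "(\<lambda>n. X (adj (c n) * 1)) \<longlonglongrightarrow> 0"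
      by (rule Lim_null_comparison[OF _ tendsto_mult_left_zero[OF s0, of "sn X 1"]])
         (rule always_eventually, rule allI, rule Cauchy_Schwarz[OF Xl])
    hence "f 1 = 0" using cX[of 1] LIMSEQ_unique by blast
    thus False by (simp add: pure_fun_one[OF f])
  qed
  define d where "d n = c n - of_real t *\<^sub>C 1" for n
  have dC: "sn_Cauchy X d" using C by (simp add: d_def sn_Cauchy_def)
  have d0: "(\<lambda>n. sn f (d n)) \<longlonglongrightarrow> 0"
  proof (rule weakly_null_imp_null[OF fl sn_Cauchy_mono[OF dC sX(1)]])
    fix a
    have "f (a * d n) = f (a * c n) - of_real t * f a" for n
      by (simp add: d_def right_diff_distrib clin_simps[OF l] cstar_simps)
    thus "(\<lambda>n. f (a * d n)) \<longlonglongrightarrow> 0" using cf[of a] by (simp add: LIM_zero)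
  qed
  \<comment> \<open>\<open>FG\<close> alone would measure \<open>d n\<close> by \<open>sn G\<close>;
    skew symmetry moves it to the factor measured by \<open>sn f\<close>, where it is null.\<close>
  have Fd: "(\<lambda>n. F (a * d n)) \<longlonglongrightarrow> 0" for a
  proof (rule Lim_null_comparison[OF _ tendsto_mult_left_zero[OF d0, of "sn G (adj a)"]])
    have "cmod (F (a * d n)) \<le> sn f (d n) * sn G (adj a)" for n
    proof -
      have "F (a * d n) = - cnj (F (adj (d n) * adj a))"
        using skew[of "adj (a * d n)"] by (simp only: adj_adj adj_mult)
      hence "cmod (F (a * d n)) = cmod (F (adj (d n) * adj a))" by (simp only: norm_minus_cancel complex_mod_cnj)
      thus ?thesis using FG[of "d n" "adj a"] by simp
    qed
    thus "\<forall>\<^sub>F n in sequentially. cmod (F (a * d n)) \<le> sn f (d n) * sn G (adj a)" by simp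
  qed
  have Gd: "(\<lambda>n. G (a * d n)) \<longlonglongrightarrow> 0" for a
  proof (rule tendstoI)
    fix e :: real assume e: "e > 0"
    obtain M where M: "M > 0" "\<And>n. sn X (d n) \<le> M" using sn_Cauchy_bounded[OF Xl dC] by blast
    define K where "K = (norm a + 1) * M"
    have K: "K > 0" using M by (simp add: K_def add_nonneg_pos)
    obtain x where x: "\<And>a. cmod (G a - F (adj x * a)) \<le> e / (2 * K) * sn G a"
      using approx[of "e / (2 * K)"] e K by auto
    have "eventually (\<lambda>n. cmod (F ((adj x * a) * d n)) < e / 2) sequentially"
      using tendstoD[OF Fd, of "e / 2" "adj x * a"] e by simp
    thus "\<forall>\<^sub>F n in sequentially. dist (G (a * d n)) 0 < e"
    proof eventually_elim
      case (elim n)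
      have "sn G (a * d n) \<le> norm a * sn G (d n)" by (rule sn_mult[OF G(1)])
      also have "\<dots> \<le> (norm a + 1) * M"
        by (intro mult_mono order_trans[OF sX(2) M(2)] sn_nonneg Gl) auto
      finally have "e / (2 * K) * sn G (a * d n) \<le> e / (2 * K) * K"
        using e K unfolding K_def by (intro mult_left_mono) auto
      also have "\<dots> = e / 2" using K by simp
      finally have "cmod (G (a * d n) - F (adj x * (a * d n))) \<le> e / 2"
        using x[of "a * d n"] by linarith
      thus ?case using elim norm_triangle_sub[of "G (a * d n)" "F (adj x * (a * d n))"]
        by (simp add: mult.assoc)
    qed
  qed
  have Gc: "(\<lambda>n. G (a * c n)) \<longlonglongrightarrow> of_real t * G a" for a
  proof -
    have "G (a * d n) = G (a * c n) - of_real t * G a" for n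
      by (simp add: d_def right_diff_distrib clin_simps[OF pos_lin_clin[OF Gl]] cstar_simps)
    thus ?thesis using Gd[of a] by (simp add: LIM_zero_iff)
  qed
  \<comment> \<open>\<open>X (a * c n)\<close> tends to \<open>f a\<close> because
    \<open>c n\<close> represents \<open>f\<close>, and to t times \<open>f a + G a\<close> because
    \<open>c n\<close> acts like the scalar t in both limits. So G is a multiple of f, which bounds
    D.\<close>
  have "of_real t * f a + of_real t * G a = f a" for a
  proof (rule LIMSEQ_unique)
    have "(\<lambda>n. cnj (X (adj (c n) * adj a))) \<longlonglongrightarrow> cnj (f (adj a))" by (intro tendsto_intros cX)
    thus "(\<lambda>n. X (a * c n)) \<longlonglongrightarrow> f a"
      using pos_lin_herm[OF Xl, of "adj a" "c _"] by (simp add: pos_lin_adj[OF fl])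
    show "(\<lambda>n. X (a * c n)) \<longlonglongrightarrow> of_real t * f a + of_real t * G a"
      unfolding X_def by (intro tendsto_intros cf Gc)
  qed
  hence "Re (of_real t * f (adj a * a) + of_real t * G (adj a * a)) = Re (f (adj a * a))" for a by simp
  hence e: "t * (sn f a)\<^sup>2 + t * (sn G a)\<^sup>2 = (sn f a)\<^sup>2" for a
    by (simp add: sn_power2[OF fl] sn_power2[OF Gl])
  have le: "t * (sn G a)\<^sup>2 \<le> (sn f a)\<^sup>2" for a
    using e[of a] mult_nonneg_nonneg[OF t0 zero_le_power2[of "sn f a"]] by linarith
  have "(sn G a)\<^sup>2 \<le> (1/t) * (sn f a)\<^sup>2" for a
    using le[of a] t0 tn by (simp add: pos_le_divide_eq mult.commute)
  hence "(sn G a)\<^sup>2 \<le> (sqrt (1/t) * sn f a)\<^sup>2" for a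
    using t0 by (simp add: power_mult_distrib)
  hence "sn G a \<le> sqrt (1/t) * sn f a" for a
    by (rule power2_le_imp_le) (use t0 fl in simp)
  hence bd: "sn f a * sn G b \<le> sn f a * (sqrt (1/t) * sn f b)" for a b
    by (intro mult_left_mono sn_nonneg fl)
  show ?thesis
  proof (rule that)
    show "sqrt (1/t) > 0" using t0 tn by simp
    show "cmod (F (adj a * b)) \<le> sqrt (1/t) * sn f a * sn f b" for a b
      using order_trans[OF FG[of a b] bd[of a b]] by (simp add: mult_ac)
  qed
qed

text \<open>Once \<open>D\<close> is known to be bounded, purity makes \<open>i D\<close> scalar too.\<close>
lemma pure_skew_null:
  assumes f: "pure_fun f" and \<eta>: "sn_Cauchy f \<eta>"
    and F: "\<And>a. (\<lambda>n. f (a * \<eta> n)) \<longlonglongrightarrow> F a" and skew: "\<And>a. F (adj a) = - cnj (F a)"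
    and F1: "Im (F 1) = 0"
  shows "(\<lambda>n. sn f (\<eta> n)) \<longlonglongrightarrow> 0"
proof (rule weakly_null_imp_null[OF pos_fun_lin[OF pure_fun_pos[OF f]] \<eta>])
  fix a
  note fl = pos_fun_lin[OF pure_fun_pos[OF f]]
  note l = pos_lin_clin[OF fl]
  obtain S where S: "S > 0" "\<And>a b. cmod (F (adj a * b)) \<le> S * sn f a * sn f b"
    using pure_skew_bounded[OF f \<eta> F skew] by blast
  \<comment> \<open>\<i> F is Hermitian and bounded by \<open>S\<close> relative to
    \<open>f\<close>, so half of \<open>f\<close> plus half of its normalisation lies between 0 and
    \<open>f\<close>.\<close>
  define g where "g a = f a / 2 + of_real (1 / (2 * S)) * (\<i> * F a)" for a
  have Fl: "clin F" by (rule clin_limit[OF clin_mult_right[OF l] F])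
  have gl: "clin g" 
    by (simp add: clin_def g_def clin_simps[OF l] clin_simps[OF Fl] algebra_simps add_divide_distrib)
  have Re0: "Re (F (adj b * b)) = 0" for b
    using skew[of "adj b * b"] by (simp add: adj_mult complex_eq_iff)
  have Imb: "\<bar>Im (F (adj b * b))\<bar> \<le> S * (sn f b)\<^sup>2" for b
    using S(2)[of b b] abs_Im_le_cmod[of "F (adj b * b)"] by (simp add: power2_eq_square mult.assoc)
  have gR: "Re (g (adj b * b)) = (sn f b)\<^sup>2 / 2 - Im (F (adj b * b)) / (2 * S)" 
    and gI: "Im (g (adj b * b)) = 0" for b
    unfolding g_def by (simp_all add: pos_lin_sn[OF fl] Re0 Re_divide_numeral Im_divide_numeral
      del: of_real_divide of_real_mult)
  have q: "\<bar>Im (F (adj b * b)) / (2 * S)\<bar> \<le> (sn f b)\<^sup>2 / 2" for b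
    using Imb[of b] S(1) by (simp add: abs_divide field_simps)
  have "0 \<le> Re (g (adj b * b))" for b using gR[of b] q[of b] by linarith
  hence gp: "pos_lin g" using gl gI unfolding pos_lin_def by blast
  have dom: "Re (g (adj b * b)) \<le> Re (f (adj b * b))" for b
    using q[of b] gR[of b] sn_power2[OF fl, of b] by linarith
  have "g a = g 1 * f a" by (rule pure_funD[OF f gp dom])
  moreover have "Re (F 1) = 0" using Re0[of 1] by simp
  hence "F 1 = 0" using F1 by (simp add: complex_eq_iff)
  ultimately have "of_real (1 / (2 * S)) * (\<i> * F a) = 0"
    by (simp add: g_def pure_fun_one[OF f])
  hence "F a = 0" using S(1) by simp
  thus "(\<lambda>n. f (a * \<eta> n)) \<longlonglongrightarrow> 0" using F[of a] by simp
qed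

text \<open>Approximate projection of \<open>b\<close> onto the real space of self-adjoint vectors
  leaves a residual \<open>\<eta>\<close> whose functional \<open>F\<close> is imaginary on
  self-adjoint elements, that is, skew. \<open>pure_skew_null\<close> removes it up to an imaginary
  scalar, and that scalar is excluded by \<open>Im (f b) = 0\<close>, since \<open>f\<close> is real
  on \<open>selfadj\<close>.\<close>

lemma pure_selfadj_dense:
  assumes f: "pure_fun f" and b: "Im (f b) = 0" and e: "e > 0"
  shows "\<exists>h\<in>selfadj. sn f (b - h) < e"
proof -
  note fp = pure_fun_pos[OF f]
  note fl = pos_fun_lin[OF fp]
  note l = pos_lin_clin[OF fl]
  have f1: "sn f 1 = 1" by (simp add: sn_def pure_fun_one[OF f])
  have sub: "subspace selfadj"
    by (simp add: subspace_def selfadj_add selfadj_scaleR)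
  have "\<exists>h\<in>selfadj. \<forall>x\<in>selfadj. (Re (f (adj h * x)) - Re (f (adj b * x)))\<^sup>2 \<le> (inverse (real (Suc n)))\<^sup>2 * Re (f (adj x * x))" for n
  proof (rule approx_Riesz[OF sub, where K = "(sn f b)\<^sup>2"])
    fix c x :: 'a and s :: real
    show "Re (f (adj (c + s *\<^sub>R x) * (c + s *\<^sub>R x))) =
      Re (f (adj c * c)) + 2 * s * Re (f (adj c * x)) + s\<^sup>2 * Re (f (adj x * x))"
      unfolding pos_lin_expand[OF fl] by (simp add: clin_simps[OF l] adj_scaleR power2_eq_square)
    show "Re (f (adj b * (c + s *\<^sub>R x))) = Re (f (adj b * c)) + s * Re (f (adj b * x))"
      by (simp add: clin_simps[OF l] distrib_left)
    show "0 \<le> Re (f (adj x * x))" by (rule pos_lin_nonneg[OF fl])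
    have "\<bar>Re (f (adj b * x))\<bar> \<le> sn f b * sn f x" 
      using abs_Re_le_cmod[of "f (adj b * x)"] Cauchy_Schwarz[OF fl, of b x] by linarith
    hence "\<bar>Re (f (adj b * x))\<bar>\<^sup>2 \<le> (sn f b * sn f x)\<^sup>2" by (intro power_mono) auto
    thus "(Re (f (adj b * x)))\<^sup>2 \<le> (sn f b)\<^sup>2 * Re (f (adj x * x))" by (simp add: power_mult_distrib sn_power2[OF fl])
  qed auto
  then obtain h where h: "\<And>n. h n \<in> selfadj"
    and hx: "\<And>n x. x \<in> selfadj \<Longrightarrow> (Re (f (adj (h n) * x)) - Re (f (adj b * x)))\<^sup>2 \<le> (inverse (real (Suc n)))\<^sup>2 * Re (f (adj x * x))"
    by metis
  define \<eta> where "\<eta> n = b - h n" for n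
  have \<eta>x: "\<bar>Re (f (adj (\<eta> n) * x))\<bar> \<le> inverse (real (Suc n)) * sn f x" if "x \<in> selfadj" for n x
  proof (rule power2_le_imp_le)
    have "Re (f (adj (\<eta> n) * x)) = - (Re (f (adj (h n) * x)) - Re (f (adj b * x)))"
      by (simp add: \<eta>_def adj_diff left_diff_distrib clin_simps[OF l])
    thus "\<bar>Re (f (adj (\<eta> n) * x))\<bar>\<^sup>2 \<le> (inverse (real (Suc n)) * sn f x)\<^sup>2"
      using hx[OF that, of n] by (simp only: power2_abs power2_minus power_mult_distrib sn_power2[OF fl])
  qed (use fl in simp)
  have C: "sn_Cauchy f \<eta>"
  proof (rule sn_CauchyI[OF _ LIMSEQ_inverse_real_of_nat])
    fix m n
    define d where "d = \<eta> m - \<eta> n"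
    have dS: "d \<in> selfadj" using selfadj_diff[OF h h, of n m] by (simp add: d_def \<eta>_def)
    have "(sn f d)\<^sup>2 = Re (f (adj (\<eta> m) * d)) - Re (f (adj (\<eta> n) * d))"
      unfolding sn_power2[OF fl] by (simp add: d_def adj_diff left_diff_distrib clin_diff[OF l])
    also have "\<dots> \<le> inverse (real (Suc m)) * sn f d + inverse (real (Suc n)) * sn f d"
      using \<eta>x[OF dS, of m] \<eta>x[OF dS, of n] by linarith
    finally have "sn f d * sn f d \<le> (inverse (real (Suc m)) + inverse (real (Suc n))) * sn f d"
      by (simp only: power2_eq_square distrib_right)
    hence "sn f d \<le> inverse (real (Suc m)) + inverse (real (Suc n))"
      using sn_nonneg[OF fl, of d] by (cases "sn f d = 0") (auto simp: mult_le_cancel_right)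
    thus "sn f (\<eta> m - \<eta> n) \<le> inverse (real (Suc m)) + inverse (real (Suc n))" unfolding d_def .
  qed
  have "convergent (\<lambda>n. f (a * \<eta> n))" for a
    using sn_Cauchy_convergent[OF fl C clin_mult_left[OF l], of a "sn f (adj a)"] Cauchy_Schwarz[OF fl, of "adj a"] by simp
  then obtain F where F: "\<And>a. (\<lambda>n. f (a * \<eta> n)) \<longlonglongrightarrow> F a" unfolding convergent_def by metis
  have F0: "Re (F x) = 0" if "x \<in> selfadj" for x
  proof (rule LIMSEQ_unique)
    show "(\<lambda>n. Re (f (x * \<eta> n))) \<longlonglongrightarrow> Re (F x)" by (intro tendsto_intros F)
    have "Re (f (x * \<eta> n)) = Re (f (adj (\<eta> n) * x))" for n
      using pos_lin_herm[OF fl, of x "\<eta> n"] that by (simp add: selfadj_def)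
    thus "(\<lambda>n. Re (f (x * \<eta> n))) \<longlonglongrightarrow> 0"
      by (intro Lim_null_comparison[OF _ tendsto_mult_left_zero[OF LIMSEQ_inverse_real_of_nat, of "sn f x"]])
         (use \<eta>x[OF that] in auto)
  qed
  have Fl: "clin F" by (rule clin_limit[OF clin_mult_right[OF l] F])
  have skew: "F (adj a) = - cnj (F a)" for a
  proof -
    obtain x y where xy: "x \<in> selfadj" "y \<in> selfadj" "a = x + \<i> *\<^sub>C y" by (rule selfadj_decomp)
    have "adj a = x + (- \<i>) *\<^sub>C y" using xy by (simp add: selfadj_def cstar_simps)
    hence "F (adj a) = F x - \<i> * F y" by (simp add: clin_simps[OF Fl])
    moreover have "F a = F x + \<i> * F y" using xy by (simp add: clin_simps[OF Fl])
    ultimately show ?thesis using F0[OF xy(1)] F0[OF xy(2)] by (simp add: complex_eq_iff)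
  qed
  have "Im (F 1) = 0"
  proof (rule LIMSEQ_unique)
    show "(\<lambda>n. Im (f (1 * \<eta> n))) \<longlonglongrightarrow> Im (F 1)" by (intro tendsto_intros F)
    have "Im (f (h n)) = 0" for n 
      using pos_lin_adj[OF fl, of "h n"] h[of n] by (simp add: selfadj_def complex_eq_iff)
    thus "(\<lambda>n. Im (f (1 * \<eta> n))) \<longlonglongrightarrow> 0" by (simp add: \<eta>_def clin_diff[OF l] b)
  qed
  from pure_skew_null[OF f C F skew this] have "(\<lambda>n. sn f (\<eta> n)) \<longlonglongrightarrow> 0" .
  hence "eventually (\<lambda>n. sn f (\<eta> n) < e) sequentially" by (rule order_tendstoD(2)[OF _ e])
  then obtain n where "sn f (\<eta> n) < e" by (auto simp: eventually_sequentially)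
  thus ?thesis using h[of n] by (auto simp: \<eta>_def)
qed

section \<open>Transitivity of the unitary group on vectors\<close>

text \<open>The Cayley transform u of h satisfies u (1 - \<i> h) = 1 + \<i> h. Writing x = p - \<i>
  z and y = p + \<i> z, it maps x to y as soon as h p = z. A self-adjoint h can do this only if
  \<langle>p, z\<rangle> is real, which holds because x and y have equal length. At p = 0 the
  unitary -1 serves.\<close>

lemma unitary_transitive_approx:
  assumes f: "pure_fun f" and x: "sn f x = 1" and y: "sn f y = 1" and e: "e > 0"
  shows "\<exists>u\<in>unitaries. sn f (u * x - y) < e"
proof -
  note fp = pure_fun_pos[OF f]
  note fl = pos_fun_lin[OF fp]
  note l = pos_lin_clin[OF fl]
  define p where "p = (1/2) *\<^sub>R (x + y)"
  define z where "z = - ((1/2) *\<^sub>R (\<i> *\<^sub>C (y - x)))"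
  define r where "r = sn f p"
  have iz: "\<i> *\<^sub>C z = (1/2) *\<^sub>R (y - x)"
    by (simp add: z_def scaleC_scaleR scaleC_scaleC scaleR_diff_right)
  have half: "(1/2) *\<^sub>R (a + a) = a" for a :: 'a by (simp flip: scaleR_2)
  have yp: "y = p + \<i> *\<^sub>C z" and xp: "x = p - \<i> *\<^sub>C z"
    unfolding iz p_def scaleR_right_distrib[symmetric] scaleR_diff_right[symmetric]
    by (simp_all add: half)
  have r0: "r \<ge> 0" using fl by (simp add: r_def)
  show ?thesis
  proof (cases "r = 0")
    case True
    have "- 1 \<in> unitaries" by (simp add: unitaries_def)
    moreover have "- 1 * x - y = (- 2) *\<^sub>R p" by (simp add: p_def)
    hence "sn f (- 1 * x - y) = 0" using True by (simp only: sn_scaleR[OF fl] r_def)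
    ultimately show ?thesis using e by (metis order_less_le_trans order_refl)
  next
    case False
    hence rp: "r > 0" using r0 by simp
    define q where "q = (1/r) *\<^sub>R p"
    have q1: "sn f q = 1" using rp by (simp add: q_def sn_scaleR[OF fl] r_def)
    have pq: "p = r *\<^sub>R q" using rp by (simp add: q_def)
    let ?X = "\<lambda>a. f (adj q * a * q)"
    have X: "pure_fun ?X" by (rule pure_vector[OF f q1])
    define \<delta> where "\<delta> = e / 8"
    have \<delta>: "\<delta> > 0" using e by (simp add: \<delta>_def)
    have nz: "norm z + 1 > 0" by (simp add: add_nonneg_pos)
    have "\<exists>a. sn f (1 - a * q) < \<delta> / (norm z + 1)"
      by (rule pure_cyclic[OF f]) (use q1 \<delta> nz in auto)
    then obtain a where a: "sn f (1 - a * q) < \<delta> / (norm z + 1)" by blast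
    \<comment> \<open>\<open>a\<close> carries \<open>q\<close> nearly to the cyclic vector, so
      \<open>d\<close> carries \<open>p\<close> nearly to \<open>z\<close>; the tolerance for
      \<open>a\<close> absorbs \<open>norm z\<close>.\<close>
    define d where "d = (1/r) *\<^sub>R (z * a)"
    have dz: "sn f (d * p - z) \<le> \<delta>"
    proof -
      have "d * p - z = - (z * (1 - a * q))" using rp by (simp add: d_def pq algebra_simps)
      hence "sn f (d * p - z) = sn f (z * (1 - a * q))" using sn_minus[OF fl] by simp
      also have "\<dots> \<le> norm z * sn f (1 - a * q)" by (rule sn_mult[OF fp])
      also have "\<dots> \<le> (norm z + 1) * (\<delta> / (norm z + 1))" using a fl by (intro mult_mono) auto
      also have "\<dots> = \<delta>" using nz by simp
      finally show ?thesis .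
    qed
    have pz: "Im (f (adj p * z)) = 0"
    proof -
      have yx: "f (adj y * x) = cnj (f (adj x * y))" by (rule pos_lin_herm[OF fl])
      have "f (adj x * x) = 1" "f (adj y * y) = 1" using x y by (simp_all add: pos_lin_sn[OF fl])
      hence "f (adj (x + y) * (y - x)) = f (adj x * y) - cnj (f (adj x * y))"
        unfolding yx[symmetric] by (simp add: adj_add algebra_simps clin_simps[OF l])
      moreover have "f (adj p * z) = - (of_real (1/4) * (\<i> * f (adj (x + y) * (y - x))))"
        by (simp add: p_def z_def adj_scaleR clin_simps[OF l] mult_scaleC_right)
      ultimately show ?thesis by (simp add: Im_divide_numeral)
    qed
    \<comment> \<open>\<open>d\<close> meets the reality condition of
      \<open>pure_selfadj_dense\<close> only approximately; subtracting an imaginary scalar restores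
      it exactly and costs at most \<open>\<delta>\<close> on \<open>p\<close>.\<close>
    define c where "c = Im (?X d)"
    have Xd: "?X d = of_real (1/r\<^sup>2) * f (adj p * (d * p))"
      by (simp add: q_def adj_scaleR clin_simps[OF l] mult.assoc power2_eq_square)
    have c: "\<bar>c\<bar> * r \<le> \<delta>"
    proof -
      have "c = (1/r\<^sup>2) * Im (f (adj p * (d * p - z)))"
        unfolding c_def Xd by (simp only: Im_complex_of_real Re_complex_of_real times_complex.simps)
          (simp add: pz right_diff_distrib clin_simps[OF l])
      hence "\<bar>c\<bar> = (1/r\<^sup>2) * \<bar>Im (f (adj p * (d * p - z)))\<bar>" by (simp add: abs_mult)
      also have "\<dots> \<le> (1/r\<^sup>2) * (r * \<delta>)"
      proof (rule mult_left_mono)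
        have "\<bar>Im (f (adj p * (d * p - z)))\<bar> \<le> sn f p * sn f (d * p - z)"
          by (rule order_trans[OF abs_Im_le_cmod Cauchy_Schwarz[OF fl]])
        also have "\<dots> \<le> r * \<delta>" unfolding r_def by (rule mult_left_mono[OF dz sn_nonneg[OF fl]])
        finally show "\<bar>Im (f (adj p * (d * p - z)))\<bar> \<le> r * \<delta>" .
      qed simp
      finally show ?thesis using rp by (simp add: power2_eq_square field_simps)
    qed
    define d' where "d' = d - (\<i> * of_real c) *\<^sub>C 1"
    have "Im (?X d') = 0"
    proof -
      have "?X d' = ?X d - \<i> * of_real c * f (adj q * q)"
        by (simp add: d'_def algebra_simps clin_simps[OF l] mult_scaleC_left mult_scaleC_right)
      thus ?thesis using q1 by (simp add: pos_lin_sn[OF fl] c_def)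
    qed
    then obtain h where h: "h \<in> selfadj" "sn ?X (d' - h) < \<delta> / r"
      using pure_selfadj_dense[OF X, of d' "\<delta> / r"] \<delta> rp by auto
    have h1: "sn f ((d' - h) * p) \<le> \<delta>"
    proof -
      have "sn f ((d' - h) * p) = r * sn ?X (d' - h)"
        using rp unfolding sn_conj by (simp add: pq sn_scaleR[OF fl])
      thus ?thesis using h(2) rp by (simp add: pos_less_divide_eq mult.commute)
    qed
    have hz: "sn f (h * p - z) \<le> 3 * \<delta>"
    proof -
      have "h * p - z = (d * p - z) - ((d' - h) * p + (\<i> * of_real c) *\<^sub>C p)"
        by (simp add: d'_def algebra_simps mult_scaleC_left)
      also have "sn f \<dots> \<le> sn f (d * p - z) + (sn f ((d' - h) * p) + sn f ((\<i> * of_real c) *\<^sub>C p))"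
        by (rule order_trans[OF sn_diff_le[OF fl] add_left_mono[OF sn_triangle[OF fl]]])
      also have "sn f ((\<i> * of_real c) *\<^sub>C p) = \<bar>c\<bar> * r"
        by (simp add: sn_scaleC[OF fl] norm_mult r_def)
      finally show ?thesis using dz h1 c by linarith
    qed
    define u where "u = cayley h"
    have u: "u \<in> unitaries" unfolding u_def by (rule cayley_unitary[OF h(1)])
    have cm: "u * (1 - \<i> *\<^sub>C h) = 1 + \<i> *\<^sub>C h" unfolding u_def by (rule cayley_mult[OF h(1)])
    have "u * x - y = u * (\<i> *\<^sub>C (h * p - z)) + \<i> *\<^sub>C (h * p - z)"
    proof -
      have "u * ((1 - \<i> *\<^sub>C h) * p) = (1 + \<i> *\<^sub>C h) * p" by (simp only: cm mult.assoc[symmetric])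
      hence "u * p = u * (\<i> *\<^sub>C (h * p)) + p + \<i> *\<^sub>C (h * p)"
        by (simp add: algebra_simps mult_scaleC_left)
      thus ?thesis by (subst xp, subst yp) (simp add: algebra_simps scaleC_diff_right)
    qed
    also have "sn f \<dots> \<le> sn f (u * (\<i> *\<^sub>C (h * p - z))) + sn f (\<i> *\<^sub>C (h * p - z))"
      by (rule sn_triangle[OF fl])
    also have "\<dots> \<le> 6 * \<delta>" using hz by (simp add: sn_unitary[OF fl u] sn_scaleC[OF fl])
    also have "\<dots> < e" using e by (simp add: \<delta>_def)
    finally show ?thesis using u by blast
  qed
qed

text \<open>Let \<open>v\<close> and \<open>w\<close> map \<open>x\<close> approximately to \<open>y\<close> and to \<open>(x + i y) / sqrt 2\<close>. If the claim fails for both,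
  then on the span of \<open>x, y\<close> they act nearly as \<open>(0, -1; 1, 0)\<close> and \<open>(1, -i; i, -1) / sqrt 2\<close>,
  and the claim holds for \<open>v w\<close>.\<close>
lemma pure_offdiagonal:
  assumes f: "pure_fun f" and x: "sn f x = 1" and y: "sn f y = 1" and xy: "f (adj x * y) = 0"
  shows "\<exists>z\<in>unitaries. 1 / 50 \<le> cmod (f (adj x * (z * y)) + f (adj y * (z * x)))"
proof (rule ccontr)
  assume neg: "\<not> ?thesis"
  note fp = pure_fun_pos[OF f]
  note fl = pos_fun_lin[OF fp]
  note l = pos_lin_clin[OF fl]
  note CS = Cauchy_Schwarz[OF fl]
  define g where "g z = f (adj x * (z * y)) + f (adj y * (z * x))" for z
  have small: "cmod (g z) < 1 / 50" if "z \<in> unitaries" for z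
    using neg that unfolding g_def by (meson not_le)
  define k where "k = 1 / sqrt 2"
  have k2: "k * k = 1 / 2" by (simp add: k_def)
  have k: "7 / 10 \<le> k" "k \<le> 1" "0 < k"
  proof -
    have "sqrt 2 \<le> (10/7 :: real)" by (rule real_le_lsqrt) (auto simp: power2_eq_square)
    thus "7 / 10 \<le> k" by (simp add: k_def field_simps)
  qed (simp_all add: k_def)
  have fx: "f (adj x * x) = 1" "f (adj y * y) = 1" using x y by (simp_all add: pos_lin_sn[OF fl])
  have yx: "f (adj y * x) = 0" using pos_lin_herm[OF fl, of y x] xy by simp
  define s where "s = k *\<^sub>R (x + \<i> *\<^sub>C y)"
  have s1: "sn f s = 1"
  proof -
    have "(sn f s)\<^sup>2 = k * k * 2" unfolding sn_power2[OF fl]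
      by (simp add: s_def cstar_simps adj_scaleR clin_simps[OF l] algebra_simps fx yx xy)
    hence "(sn f s)\<^sup>2 = 1\<^sup>2" by (simp add: k2)
    thus ?thesis by (rule power2_eq_imp_eq) (use fl in simp_all)
  qed
  obtain v where v: "v \<in> unitaries" "sn f (v * x - y) < 1/100"
    using unitary_transitive_approx[OF f x y, of "1/100"] by auto
  obtain w where w: "w \<in> unitaries" "sn f (w * x - s) < 1/100"
    using unitary_transitive_approx[OF f x s1, of "1/100"] by auto
  have near: "cmod (f (adj a * b) - f (adj a * c)) \<le> sn f a * sn f (b - c)" for a b c
    using CS[of a "b - c"] by (simp add: right_diff_distrib clin_diff[OF l])
  have v21: "cmod (f (adj y * (v * x)) - 1) \<le> 1/100"
    using near[of y "v * x" y] v(2) by (simp add: y fx)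
  have v12: "cmod (f (adj x * (v * y)) + 1) \<le> 3/100"
  proof -
    have "f (adj x * (v * y)) + 1 = g v - (f (adj y * (v * x)) - 1)" by (simp add: g_def)
    also have "cmod \<dots> \<le> cmod (g v) + cmod (f (adj y * (v * x)) - 1)" by (rule norm_triangle_ineq4)
    finally show ?thesis using small[OF v(1)] v21 by simp
  qed
  \<comment> \<open>A unit vector whose inner product with -x is nearly 1 is nearly -x; 6/100 is
    just below the square of 1/4.\<close>
  have vy: "sn f (v * y + x) \<le> 1/4"
  proof (rule power2_le_imp_le)
    have "Re (f (adj (v * y) * x)) = Re (f (adj x * (v * y)))" 
      using pos_lin_herm[OF fl, of "v * y" x] by simp
    hence "(sn f (v * y + x))\<^sup>2 = 2 + 2 * Re (f (adj x * (v * y)))"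
      unfolding sn_power2[OF fl] pos_lin_expand[OF fl]
      using sn_unitary[OF fl v(1), of y] sn_power2[OF fl, of "v * y"] by (simp add: fx y)
    also have "Re (f (adj x * (v * y))) + 1 \<le> 3/100"
      using v12 abs_Re_le_cmod[of "f (adj x * (v * y)) + 1"] by simp
    hence "2 + 2 * Re (f (adj x * (v * y))) \<le> (1/4)\<^sup>2" by (simp add: power2_eq_square)
    finally show "(sn f (v * y + x))\<^sup>2 \<le> (1/4)\<^sup>2" .
  qed simp
  have fys: "f (adj y * s) = of_real k * \<i>"
    by (simp add: s_def clin_simps[OF l] distrib_left mult_scaleC_right fx yx)
  have w21: "cmod (f (adj y * (w * x)) - of_real k * \<i>) \<le> 1/100"
    using near[of y "w * x" s] w(2) by (simp add: y fys)
  have w12: "cmod (f (adj x * (w * y)) + of_real k * \<i>) \<le> 3/100"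
  proof -
    have "f (adj x * (w * y)) + of_real k * \<i> = g w - (f (adj y * (w * x)) - of_real k * \<i>)" by (simp add: g_def)
    also have "cmod \<dots> \<le> cmod (g w) + cmod (f (adj y * (w * x)) - of_real k * \<i>)" by (rule norm_triangle_ineq4)
    finally show ?thesis using small[OF w(1)] w21 by simp
  qed
  have wy: "sn f (w * y) = 1" by (simp add: sn_unitary[OF fl w(1)] y)
  \<comment> \<open>\<open>w\<close> preserves orthogonality, so \<open>w * y\<close> is nearly
    orthogonal to \<open>s\<close>; this ties its \<open>y\<close> coordinate to the
    \<open>x\<close> coordinate estimated in \<open>w12\<close>.\<close>
  have w22: "cmod (f (adj x * (w * y)) - \<i> * f (adj y * (w * y))) \<le> 2/100"
  proof -
    have "f (adj (w * x) * (w * y)) = 0"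
      using w(1) xy by (simp add: adj_mult mult.assoc unitary_cancel)
    hence "f (adj (s - w * x) * (w * y)) = f (adj s * (w * y))" 
      by (simp add: adj_diff left_diff_distrib clin_diff[OF l])
    also have "\<dots> = of_real k * (f (adj x * (w * y)) - \<i> * f (adj y * (w * y)))"
      by (simp add: s_def cstar_simps adj_scaleR clin_simps[OF l] algebra_simps)
    finally have "k * cmod (f (adj x * (w * y)) - \<i> * f (adj y * (w * y))) = cmod (f (adj (s - w * x) * (w * y)))"
      using k by (simp add: norm_mult)
    also have "\<dots> \<le> sn f (s - w * x) * sn f (w * y)" by (rule CS)
    also have "\<dots> \<le> 1/100" using w(2) by (simp add: wy sn_minus_commute[OF fl, of s])
    finally have *: "k * cmod (f (adj x * (w * y)) - \<i> * f (adj y * (w * y))) \<le> 1/100" .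
    have "7/10 * cmod (f (adj x * (w * y)) - \<i> * f (adj y * (w * y))) \<le> k * cmod (f (adj x * (w * y)) - \<i> * f (adj y * (w * y)))"
      by (intro mult_right_mono k) auto
    thus ?thesis using * by linarith
  qed
  have w22': "cmod (f (adj y * (w * y)) + of_real k) \<le> 5/100"
  proof -
    have "\<i> * (f (adj y * (w * y)) + of_real k) = 
      (f (adj x * (w * y)) + of_real k * \<i>) - (f (adj x * (w * y)) - \<i> * f (adj y * (w * y)))"
      by (simp add: algebra_simps)
    hence "cmod (f (adj y * (w * y)) + of_real k) = cmod ((f (adj x * (w * y)) + of_real k * \<i>) - (f (adj x * (w * y)) - \<i> * f (adj y * (w * y))))"
      by (metis norm_mult norm_ii mult_1)
    also have "\<dots> \<le> cmod (f (adj x * (w * y)) + of_real k * \<i>) + cmod (f (adj x * (w * y)) - \<i> * f (adj y * (w * y)))"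
      by (rule norm_triangle_ineq4)
    finally show ?thesis using w12 w22 by linarith
  qed
  define T1 where "T1 = f (adj x * (v * w * y))"
  define T2 where "T2 = f (adj y * (v * w * x))"
  have T1: "cmod (T1 - of_real k) \<le> 1/4 + 5/100"
  proof -
    have "adj (adj v * x) * (w * y) = adj x * (v * w * y)" by (simp add: adj_mult mult.assoc)
    hence "T1 - of_real k = f (adj (adj v * x + y) * (w * y)) - (f (adj y * (w * y)) + of_real k)"
      unfolding T1_def by (simp add: adj_add distrib_right clin_simps[OF l])
    also have "cmod \<dots> \<le> cmod (f (adj (adj v * x + y) * (w * y))) + cmod (f (adj y * (w * y)) + of_real k)"
      by (rule norm_triangle_ineq4)
    also have "cmod (f (adj (adj v * x + y) * (w * y))) \<le> sn f (adj v * x + y) * sn f (w * y)" by (rule CS)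
    also have "sn f (adj v * x + y) = sn f (v * (adj v * x + y))" by (rule sn_unitary[OF fl v(1), symmetric])
    also have "v * (adj v * x + y) = v * y + x" using v(1) by (simp add: distrib_left unitary_cancel)
    finally show ?thesis using vy w22' by (simp add: wy)
  qed
  have T2: "cmod (T2 - of_real k) \<le> 1/4 + 2/100"
  proof -
    have a: "cmod (T2 - f (adj y * (v * s))) \<le> 1/100"
    proof -
      have "cmod (T2 - f (adj y * (v * s))) \<le> sn f y * sn f (v * (w * x) - v * s)"
        unfolding T2_def mult.assoc[of v] by (rule near)
      also have "\<dots> = sn f (w * x - s)" using sn_unitary[OF fl v(1), of "w * x - s"] by (simp add: y right_diff_distrib)
      finally show ?thesis using w(2) by simp
    qed
    have b: "cmod (f (adj y * (v * y))) \<le> 1/4"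
      using near[of y "v * y" "- x"] vy by (simp add: y clin_simps[OF l] yx)
    have "f (adj y * (v * s)) - of_real k = of_real k * ((f (adj y * (v * x)) - 1) + \<i> * f (adj y * (v * y)))"
      by (simp add: s_def clin_simps[OF l] distrib_left mult_scaleC_right algebra_simps)
    hence "cmod (f (adj y * (v * s)) - of_real k) = k * cmod ((f (adj y * (v * x)) - 1) + \<i> * f (adj y * (v * y)))"
      using k by (simp add: norm_mult)
    also have "\<dots> \<le> 1 * (1/100 + 1/4)"
    proof (intro mult_mono k)
      show "cmod ((f (adj y * (v * x)) - 1) + \<i> * f (adj y * (v * y))) \<le> 1/100 + 1/4"
        by (rule order_trans[OF norm_triangle_ineq]) (use v21 b in \<open>simp add: norm_mult\<close>)
    qed auto
    finally have c: "cmod (f (adj y * (v * s)) - of_real k) \<le> 1/100 + 1/4" by simp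
    have "T2 - of_real k = (T2 - f (adj y * (v * s))) + (f (adj y * (v * s)) - of_real k)" by simp
    also have "cmod \<dots> \<le> cmod (T2 - f (adj y * (v * s))) + cmod (f (adj y * (v * s)) - of_real k)"
      by (rule norm_triangle_ineq)
    finally show ?thesis using a c by simp
  qed
  \<comment> \<open>Both off-diagonal entries of \<open>v * w\<close> are near \<open>k\<close>. The
    bounds for \<open>g (v * w)\<close> and for the two deviations add up to less than 3/5, whereas
    2 k is at least 7/5.\<close>
  have "of_real (2 * k) = g (v * w) - (T1 - of_real k) - (T2 - of_real k)"
    by (simp add: g_def T1_def T2_def)
  hence "2 * k \<le> cmod (g (v * w)) + cmod (T1 - of_real k) + cmod (T2 - of_real k)"
    using k norm_triangle_ineq4[of "g (v * w) - (T1 - of_real k)" "T2 - of_real k"]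
      norm_triangle_ineq4[of "g (v * w)" "T1 - of_real k"] norm_of_real[of "2 * k", where 'a = complex]
    by simp
  thus False using T1 T2 small[OF unitaries_mult[OF v(1) w(1)]] k(1) by linarith
qed

text \<open>The phase condition makes \<open>s = x + y\<close> and \<open>m = x - y\<close>
  orthogonal, and the off-diagonal form of z on this pair is twice the difference of the two states
  at z. A unitary z from \<open>pure_offdiagonal\<close> then gives the bound, with 100 = 2 * 50;
  normalising \<open>s\<close> does no harm because its length is at least 1.\<close>

lemma vector_dist_le_state_dist:
  assumes f: "pure_fun f" and x: "sn f x = 1" and y: "sn f y = 1"
    and xy: "Im (f (adj x * y)) = 0" "0 \<le> Re (f (adj x * y))"
    and D: "\<And>z. cmod (f (adj x * z * x) - f (adj y * z * y)) \<le> D * norm z"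
  shows "sn f (x - y) \<le> 100 * D"
proof -
  note fp = pure_fun_pos[OF f]
  note fl = pos_fun_lin[OF fp]
  note l = pos_lin_clin[OF fl]
  define s where "s = x + y"
  define m where "m = x - y"
  have fx: "f (adj x * x) = 1" "f (adj y * y) = 1" using x y by (simp_all add: pos_lin_sn[OF fl])
  have yx: "f (adj y * x) = f (adj x * y)"
    using pos_lin_herm[OF fl, of y x] xy(1) by (simp add: complex_eq_iff)
  have sm: "f (adj s * m) = 0"
    by (simp add: s_def m_def adj_add algebra_simps clin_simps[OF l] fx yx)
  have "1 \<le> (sn f s)\<^sup>2" 
    unfolding sn_power2[OF fl] s_def pos_lin_expand[OF fl] using xy(2) by (simp add: fx)
  hence s1: "1 \<le> sn f s" using sn_nonneg[OF fl, of s] by (metis power2_le_imp_le one_power2)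
  have D0: "0 \<le> D" using order_trans[OF norm_ge_zero D[of 1]] by simp
  show ?thesis
  proof (cases "sn f m = 0")
    case True thus ?thesis using D0 by (simp add: m_def)
  next
    case False
    hence mp: "sn f m > 0" using sn_nonneg[OF fl, of m] by linarith
    define a where "a = 1 / sn f s"
    define b where "b = 1 / sn f m"
    have ab: "a > 0" "b > 0" using s1 mp by (simp_all add: a_def b_def)
    have "\<exists>z\<in>unitaries. 1 / 50 \<le> cmod (f (adj (a *\<^sub>R s) * (z * (b *\<^sub>R m))) + f (adj (b *\<^sub>R m) * (z * (a *\<^sub>R s))))"
      by (rule pure_offdiagonal[OF f])
         (use s1 mp in \<open>simp_all add: sn_scaleR[OF fl] a_def b_def adj_scaleR clin_simps[OF l] sm\<close>)
    then obtain z where z: "z \<in> unitaries" 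
      "1 / 50 \<le> cmod (f (adj (a *\<^sub>R s) * (z * (b *\<^sub>R m))) + f (adj (b *\<^sub>R m) * (z * (a *\<^sub>R s))))" by blast
    have "f (adj (a *\<^sub>R s) * (z * (b *\<^sub>R m))) + f (adj (b *\<^sub>R m) * (z * (a *\<^sub>R s))) =
      of_real (a * b * 2) * (f (adj x * z * x) - f (adj y * z * y))"
      by (simp add: adj_scaleR clin_simps[OF l] s_def m_def adj_add adj_diff algebra_simps)
    hence "1 / 50 \<le> (a * b * 2) * cmod (f (adj x * z * x) - f (adj y * z * y))"
      using z(2) ab by (simp add: norm_mult)
    also have "\<dots> \<le> (a * b * 2) * D"
      using D[of z] ab norm_unitary[OF z(1)] by (intro mult_left_mono) auto
    finally have "sn f s * sn f m \<le> 100 * D" using s1 mp by (simp add: a_def b_def field_simps)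
    moreover have "1 * sn f m \<le> sn f s * sn f m" using s1 mp by (intro mult_right_mono) auto
    ultimately show ?thesis by (simp add: m_def)
  qed
qed

section \<open>Norm control\<close>

text \<open>The off-diagonal bound for \<Omega> and the unit vector \<open>y\<close> along
  \<open>b\<close> provides, after a phase and taking the self-adjoint part, an element of norm at
  most 2 whose overlap with \<open>y\<close> is at least 1/100. A short move in its direction
  shortens \<open>b\<close> by a fixed proportion.\<close>

lemma greedy_step:
  assumes f: "pure_fun f" and b: "f b = 0"
  shows "\<exists>h\<in>selfadj. f h = 0 \<and> norm h \<le> sn f b \<and> sn f (b - h) \<le> (1 - 1/80000) * sn f b"
proof (cases "sn f b = 0")
  case True
  thus ?thesis using clin_zero[OF pos_lin_clin[OF pos_fun_lin[OF pure_fun_pos[OF f]]]]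
    by (intro bexI[of _ 0]) auto
next
  case False
  note fp = pure_fun_pos[OF f]
  note fl = pos_fun_lin[OF fp]
  note l = pos_lin_clin[OF fl]
  have f1: "f 1 = 1" "sn f 1 = 1" by (simp_all add: sn_def pure_fun_one[OF f])
  have bp: "sn f b > 0" using False sn_nonneg[OF fl, of b] by linarith
  define y where "y = (1 / sn f b) *\<^sub>R b"
  have y1: "sn f y = 1" using bp by (simp add: y_def sn_scaleR[OF fl])
  have fy: "f y = 0" by (simp add: y_def clin_simps[OF l] b)
  have fy': "f (adj y) = 0" using pos_lin_adj[OF fl, of y] fy by simp
  obtain z where z: "z \<in> unitaries" "1 / 50 \<le> cmod (f (z * y) + f (adj y * z))"
    using pure_offdiagonal[OF f f1(2) y1] fy by auto
  define g where "g = f (z * y) + f (adj y * z)"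
  obtain \<theta> where t1: "cmod \<theta> = 1" and t2: "\<theta> * g = of_real (cmod g)"
    using phase_exists by blast
  define c where "c = \<theta> *\<^sub>C z"
  have c: "norm c = 1" using norm_unitary[OF z(1)] by (simp add: c_def norm_scaleC t1)
  define h0 where "h0 = (1/2) *\<^sub>R (c + adj c)"
  have h0: "h0 \<in> selfadj" by (simp add: selfadj_def h0_def adj_scaleR adj_add add.commute)
  have nh0: "norm h0 \<le> 1" using norm_triangle_ineq[of c "adj c"] c by (simp add: h0_def)
  have gc: "f (c * y) + f (adj y * c) = of_real (cmod g)"
    using t2 by (simp add: c_def g_def clin_simps[OF l] cstar_simps distrib_left)
  have "f (adj y * adj c) = cnj (f (c * y))" using pos_lin_adj[OF fl, of "c * y"] by (simp add: adj_mult)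
  hence "Re (f (adj y * h0)) = Re (f (c * y) + f (adj y * c)) / 2"
    by (simp add: h0_def clin_simps[OF l] distrib_left)
  hence r0: "Re (f (adj y * h0)) \<ge> 1/100" using z(2) by (simp add: gc g_def)
  \<comment> \<open>Removing the expectation keeps the residual orthogonal to \<Omega>. It costs at
    most 1 in norm and, as \<open>f (adj y) = 0\<close>, leaves the overlap with \<open>y\<close>
    unchanged.\<close>
  define h1 where "h1 = h0 - Re (f h0) *\<^sub>R 1"
  have h1: "h1 \<in> selfadj" unfolding h1_def by (intro selfadj_diff h0 selfadj_scaleR) simp
  have "Im (f h0) = 0" using pos_lin_adj[OF fl, of h0] h0 by (simp add: selfadj_def complex_eq_iff)
  hence fh1: "f h1 = 0" by (simp add: h1_def clin_simps[OF l] f1 complex_eq_iff)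
  have "\<bar>Re (f h0)\<bar> \<le> 1"
    using abs_Re_le_cmod[of "f h0"] pos_fun_bound[OF fp, of h0] nh0 by (simp add: f1)
  hence nh1: "norm h1 \<le> 2"
    using norm_triangle_ineq4[of h0 "Re (f h0) *\<^sub>R 1"] nh0 by (simp add: h1_def)
  hence sh1: "sn f h1 \<le> 2" using sn_le_norm[OF fp, of h1] by (simp add: f1)
  have r1: "Re (f (adj y * h1)) \<ge> 1/100"
    using r0 by (simp add: h1_def right_diff_distrib clin_simps[OF l] fy')
  \<comment> \<open>The minimiser of 1 - t/50 + 4 t^2. The minimum 1 - 1/40000 lies below the square
    of 1 - 1/80000.\<close>
  define t :: real where "t = 1/400"
  have st: "sn f (y - t *\<^sub>R h1) \<le> 1 - 1/80000"
  proof (rule power2_le_imp_le)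
    have "(sn f (y - t *\<^sub>R h1))\<^sup>2 = 1 - 2 * t * Re (f (adj y * h1)) + t\<^sup>2 * (sn f h1)\<^sup>2"
      unfolding sn_diff_Re[OF fl] by (simp add: y1 sn_scaleR[OF fl] power_mult_distrib clin_simps[OF l])
    also have "\<dots> \<le> 1 - 2 * t * (1/100) + t\<^sup>2 * 2\<^sup>2"
      by (intro add_mono diff_mono mult_left_mono power_mono r1 sh1 sn_nonneg fl) (auto simp: t_def)
    also have "\<dots> \<le> (1 - 1/80000)\<^sup>2" by (simp add: t_def power2_eq_square)
    finally show "(sn f (y - t *\<^sub>R h1))\<^sup>2 \<le> (1 - 1/80000)\<^sup>2" .
  qed simp
  show ?thesis
  proof (intro bexI[of _ "(sn f b * t) *\<^sub>R h1"] conjI selfadj_scaleR h1)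
    show "f ((sn f b * t) *\<^sub>R h1) = 0" by (simp add: clin_simps[OF l] fh1)
    have "norm h1 * t \<le> 1" using nh1 by (simp add: t_def)
    from mult_left_mono[OF this, of "sn f b"] show "norm ((sn f b * t) *\<^sub>R h1) \<le> sn f b"
      using bp by (simp add: t_def mult_ac)
    have "b - (sn f b * t) *\<^sub>R h1 = sn f b *\<^sub>R (y - t *\<^sub>R h1)"
      using bp by (simp add: y_def scaleR_diff_right)
    thus "sn f (b - (sn f b * t) *\<^sub>R h1) \<le> (1 - 1/80000) * sn f b"
      using mult_left_mono[OF st, of "sn f b"] bp by (simp add: sn_scaleR[OF fl] mult.commute)
  qed
qed

text \<open>Each greedy correction has norm at most the current residual, and the residuals decay
  geometrically with ratio \<rho> = 1 - 1/80000, so all corrections together cost at most 1 / (1 -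
  \<rho>) = 80000 times the length of \<open>b\<close>. The induction carries the partial geometric
  sum.\<close>

lemma selfadj_norm_control:
  assumes f: "pure_fun f" and b: "f b = 0" and e: "e > 0"
  shows "\<exists>h\<in>selfadj. f h = 0 \<and> norm h \<le> 80000 * sn f b \<and> sn f (b - h) \<le> e * sn f b"
proof -
  note fl = pos_fun_lin[OF pure_fun_pos[OF f]]
  note l = pos_lin_clin[OF fl]
  define \<rho> :: real where "\<rho> = 1 - 1/80000"
  have *: "\<exists>h\<in>selfadj. f h = 0 \<and> norm h \<le> 80000 * (1 - \<rho> ^ n) * sn f b \<and> sn f (b - h) \<le> \<rho> ^ n * sn f b" for n
  proof (induction n)
    case 0
    show ?case by (intro bexI[of _ 0]) (auto simp: clin_zero[OF l])
  next
    case (Suc n)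
    then obtain h where h: "h \<in> selfadj" "f h = 0" "norm h \<le> 80000 * (1 - \<rho> ^ n) * sn f b"
      "sn f (b - h) \<le> \<rho> ^ n * sn f b" by blast
    have "f (b - h) = 0" by (simp add: clin_diff[OF l] b h)
    then obtain k where k: "k \<in> selfadj" "f k = 0" "norm k \<le> sn f (b - h)" 
        "sn f (b - h - k) \<le> \<rho> * sn f (b - h)"
      using greedy_step[OF f, of "b - h"] unfolding \<rho>_def by blast
    show ?case
    proof (intro bexI[of _ "h + k"] conjI selfadj_add h k)
      show "f (h + k) = 0" by (simp add: clin_add[OF l] h k)
      have "norm (h + k) \<le> 80000 * (1 - \<rho> ^ n) * sn f b + \<rho> ^ n * sn f b"
        using norm_triangle_ineq[of h k] h k by linarith
      also have "\<dots> = 80000 * (1 - \<rho> ^ Suc n) * sn f b"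
        by (simp add: \<rho>_def algebra_simps)
      finally show "norm (h + k) \<le> 80000 * (1 - \<rho> ^ Suc n) * sn f b" .
      have "\<rho> * sn f (b - h) \<le> \<rho> * (\<rho> ^ n * sn f b)" by (rule mult_left_mono[OF h(4)]) (simp add: \<rho>_def)
      thus "sn f (b - (h + k)) \<le> \<rho> ^ Suc n * sn f b" using k(4) by (simp add: diff_diff_eq mult.assoc)
    qed
  qed
  obtain n where n: "\<rho> ^ n < e" using real_arch_pow_inv[OF e, of \<rho>] by (auto simp: \<rho>_def)
  obtain h where h: "h \<in> selfadj" "f h = 0" "norm h \<le> 80000 * (1 - \<rho> ^ n) * sn f b"
      "sn f (b - h) \<le> \<rho> ^ n * sn f b" using *[of n] by blast
  have "80000 * (1 - \<rho> ^ n) * sn f b \<le> 80000 * 1 * sn f b"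
    using fl by (intro mult_right_mono mult_left_mono) (auto simp: \<rho>_def)
  moreover have "\<rho> ^ n * sn f b \<le> e * sn f b" using n fl by (intro mult_right_mono) auto
  ultimately show ?thesis using h by (intro bexI[of _ h]) auto
qed

section \<open>Continuous approximate selections\<close>

text \<open>For a well-ordered family of tent functions \<open>\<phi> y\<close> the increments \<open>w y\<close> of the running suprema \<open>m y\<close> are
  equicontinuous and telescope transfinitely to \<open>1\<close>. This partition of unity need not be locally finite, but
  convergence of a bounded series weighted by it is still locally uniform up to any given error.\<close>

locale tent_partition =
  fixes S :: "'b::metric_space set" and \<rho> :: real and r :: "('b \<times> 'b) set"
  assumes \<rho>: "\<rho> > 0"
    and wf: "wf r" and tr: "trans r" and tot: "total r"
begin

definition \<phi> :: "'b \<Rightarrow> 'b \<Rightarrow> real" where "\<phi> y x = max 0 (1 - dist y x / \<rho>)"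
definition m :: "'b \<Rightarrow> 'b \<Rightarrow> real" where "m y x = Sup (insert 0 ((\<lambda>z. \<phi> z x) ` {z\<in>S. (z, y) \<in> r}))"
definition w :: "'b \<Rightarrow> 'b \<Rightarrow> real" where "w y x = max (m y x) (\<phi> y x) - m y x"

lemma \<phi>_range: "0 \<le> \<phi> y x" "\<phi> y x \<le> 1"
  using \<rho> by (auto simp: \<phi>_def)

lemma \<phi>_lip: "\<phi> y x \<le> \<phi> y x' + dist x x' / \<rho>"
proof -
  have "dist y x' \<le> dist y x + dist x x'" by (rule dist_triangle)
  hence "dist y x' / \<rho> \<le> dist y x / \<rho> + dist x x' / \<rho>"
    using \<rho> by (simp add: divide_right_mono flip: add_divide_distrib)
  moreover have "dist x x' / \<rho> \<ge> 0" using \<rho> by simp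
  ultimately show ?thesis unfolding \<phi>_def by linarith
qed

lemma m_bdd: "bdd_above (insert 0 ((\<lambda>z. \<phi> z x) ` {z\<in>S. (z, y) \<in> r}))"
  by (rule bdd_aboveI[of _ 1]) (auto simp: \<phi>_range)

lemma m_range: "0 \<le> m y x" "m y x \<le> 1"
  unfolding m_def by (auto intro!: cSup_upper cSup_least m_bdd simp: \<phi>_range)

lemma m_upper: "z \<in> S \<Longrightarrow> (z, y) \<in> r \<Longrightarrow> \<phi> z x \<le> m y x"
  unfolding m_def by (rule cSup_upper[OF _ m_bdd]) auto

lemma m_mono: "(z, y) \<in> r \<Longrightarrow> m z x \<le> m y x"
  unfolding m_def by (rule cSup_subset_mono[OF _ m_bdd]) (auto intro: transD[OF tr])

lemma m_lip: "m y x \<le> m y x' + dist x x' / \<rho>"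
proof -
  have d: "dist x x' / \<rho> \<ge> 0" using \<rho> by simp
  have "a \<le> m y x' + dist x x' / \<rho>" if "a \<in> insert 0 ((\<lambda>z. \<phi> z x) ` {z\<in>S. (z, y) \<in> r})" for a
    using that m_range[of y x'] d \<phi>_lip[of _ x x'] m_upper[of _ y x'] by (auto intro: add_increasing2) (smt (verit))
  thus ?thesis unfolding m_def[of y x] by (intro cSup_least) auto
qed

lemma continuous_\<phi>: "continuous_on A (\<phi> y)"
  unfolding \<phi>_def using \<rho> by (intro continuous_intros) auto

lemma continuous_m: "continuous_on A (m y)"
proof (rule lipschitz_on_continuous_on[where L = "1 / \<rho>"], rule lipschitz_onI)
  fix x x'
  show "dist (m y x) (m y x') \<le> 1 / \<rho> * dist x x'"
    using m_lip[of y x x'] m_lip[of y x' x] by (simp add: dist_real_def dist_commute abs_le_iff)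
qed (use \<rho> in simp)

lemma continuous_w: "continuous_on A (w y)"
  unfolding w_def by (intro continuous_intros continuous_m continuous_\<phi>)

lemma w_nonneg: "0 \<le> w y x"
  by (simp add: w_def)

lemma w_support: "w y x > 0 \<Longrightarrow> dist y x < \<rho>"
proof -
  assume "w y x > 0"
  hence "\<phi> y x > 0" using m_range(1)[of y x] by (auto simp: w_def max_def split: if_splits)
  thus ?thesis using \<rho> by (auto simp: \<phi>_def max_def field_simps split: if_splits)
qed

lemma greatest:
  assumes "finite F" "F \<noteq> {}" shows "\<exists>y\<in>F. \<forall>z\<in>F. z \<noteq> y \<longrightarrow> (z, y) \<in> r"
  using assms
proof (induction rule: finite_ne_induct)
  case (insert a F)
  then obtain y where y: "y \<in> F" "\<And>z. z \<in> F \<Longrightarrow> z \<noteq> y \<Longrightarrow> (z, y) \<in> r" by blast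
  have "a \<noteq> y" using insert y by blast
  hence "(a, y) \<in> r \<or> (y, a) \<in> r" using tot by (auto simp: total_on_def)
  thus ?case
  proof
    assume "(a, y) \<in> r" thus ?thesis using y by (intro bexI[of _ y]) auto
  next
    assume a: "(y, a) \<in> r"
    have "(z, a) \<in> r" if "z \<in> F" for z
      using y(2)[OF that] a transD[OF tr] by (cases "z = y") blast+
    thus ?thesis by blast
  qed
qed auto

text \<open>Telescoping from the top: with u greatest in F, the remaining weights are bounded by
  \<open>m u x\<close> through well-founded induction, and \<open>w u x + m u x\<close> is the
  running supremum just after u.\<close>

lemma sum_le_m:
  assumes "finite F" "F \<subseteq> {z\<in>S. (z, y) \<in> r}" shows "(\<Sum>z\<in>F. w z x) \<le> m y x"
  using wf assms
proof (induction y arbitrary: F rule: wf_induct_rule)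
  case (less y)
  show ?case
  proof (cases "F = {}")
    case False
    then obtain u where u: "u \<in> F" "\<And>z. z \<in> F \<Longrightarrow> z \<noteq> u \<Longrightarrow> (z, u) \<in> r"
      using greatest[OF less.prems(1)] by blast
    have uy: "(u, y) \<in> r" "u \<in> S" using u less.prems by auto
    have "(\<Sum>z\<in>F. w z x) = w u x + (\<Sum>z\<in>F - {u}. w z x)"
      by (rule sum.remove[OF less.prems(1) u(1)])
    also have "(\<Sum>z\<in>F - {u}. w z x) \<le> m u x"
      by (rule less.IH[OF uy(1)]) (use u less.prems in auto)
    also have "w u x + m u x = max (m u x) (\<phi> u x)" by (simp add: w_def)
    also have "\<dots> \<le> m y x" using m_mono[OF uy(1)] m_upper[OF uy(2,1)] by simp
    finally show ?thesis by simp
  qed (simp add: m_range)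
qed

lemma sum_le_1:
  assumes "finite F" "F \<subseteq> S" shows "(\<Sum>z\<in>F. w z x) \<le> 1"
proof (cases "F = {}")
  case False
  then obtain u where u: "u \<in> F" "\<And>z. z \<in> F \<Longrightarrow> z \<noteq> u \<Longrightarrow> (z, u) \<in> r"
    using greatest[OF assms(1)] by blast
  have "(\<Sum>z\<in>F. w z x) = w u x + (\<Sum>z\<in>F - {u}. w z x)"
    by (rule sum.remove[OF assms(1) u(1)])
  also have "(\<Sum>z\<in>F - {u}. w z x) \<le> m u x"
    by (rule sum_le_m) (use u assms in auto)
  also have "w u x + m u x = max (m u x) (\<phi> u x)" by (simp add: w_def)
  also have "\<dots> \<le> 1" using m_range \<phi>_range by simp
  finally show ?thesis by simp
qed simp

text \<open>Choose u below y whose tent nearly attains the supremum. The weights before u reach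
  \<open>m u x\<close> up to \<open>e / 2\<close> by induction, and \<open>w u x\<close> fills the
  gap from \<open>m u x\<close> to \<open>\<phi> u x\<close>. Descending to a near-maximal index
  avoids summing over limit stages of the well-order.\<close>

lemma sum_ge_m:
  assumes "e > 0" shows "\<exists>F. finite F \<and> F \<subseteq> {z\<in>S. (z, y) \<in> r} \<and> m y x - e < (\<Sum>z\<in>F. w z x)"
  using wf assms
proof (induction y arbitrary: e rule: wf_induct_rule)
  case (less y)
  show ?case
  proof (cases "m y x < e")
    case True thus ?thesis by (intro exI[of _ "{}"]) auto
  next
    case False
    have "m y x - e / 2 < Sup (insert 0 ((\<lambda>z. \<phi> z x) ` {z\<in>S. (z, y) \<in> r}))" 
      using less.prems by (simp add: m_def)
    then obtain a where a: "a \<in> insert 0 ((\<lambda>z. \<phi> z x) ` {z\<in>S. (z, y) \<in> r})" "m y x - e / 2 < a"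
      by (rule less_cSupE) auto
    have "a \<noteq> 0" using a False less.prems by auto
    then obtain u where u: "u \<in> S" "(u, y) \<in> r" "m y x - e / 2 < \<phi> u x" using a by auto
    obtain F where F: "finite F" "F \<subseteq> {z\<in>S. (z, u) \<in> r}" "m u x - e / 2 < (\<Sum>z\<in>F. w z x)"
      using less.IH[OF u(2), of "e / 2"] less.prems by auto
    have "u \<notin> F" using F(2) wf by (auto simp: wf_not_refl)
    hence "(\<Sum>z\<in>insert u F. w z x) = w u x + (\<Sum>z\<in>F. w z x)" using F(1) by simp
    moreover have "w u x \<ge> \<phi> u x - m u x" by (simp add: w_def)
    ultimately have "m y x - e < (\<Sum>z\<in>insert u F. w z x)" using F(3) u(3) by linarith
    moreover have "insert u F \<subseteq> {z\<in>S. (z, y) \<in> r}" using F(2) u by (auto intro: transD[OF tr])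
    ultimately show ?thesis using F(1) by (intro exI[of _ "insert u F"]) auto
  qed
qed

text \<open>The index x itself has \<open>\<phi> x x = 1\<close>, so the running supremum is full
  just after it.\<close>

lemma sum_ge_1:
  assumes "e > 0" "x \<in> S" shows "\<exists>F. finite F \<and> F \<subseteq> S \<and> 1 - e < (\<Sum>z\<in>F. w z x)"
proof -
  obtain F where F: "finite F" "F \<subseteq> {z\<in>S. (z, x) \<in> r}" "m x x - e < (\<Sum>z\<in>F. w z x)"
    using sum_ge_m[OF assms(1), of x x] by blast
  have "x \<notin> F" using F(2) wf by (auto simp: wf_not_refl)
  hence "(\<Sum>z\<in>insert x F. w z x) = w x x + (\<Sum>z\<in>F. w z x)" using F(1) by simp
  moreover have "w x x \<ge> 1 - m x x" by (simp add: w_def \<phi>_def)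
  ultimately show ?thesis using F assms(2) by (intro exI[of _ "insert x F"]) auto
qed

end

text \<open>\<open>f\<close> is the unordered sum of the \<open>k y\<close> weighted by
  \<open>w y x\<close>. Its tail outside a finite F is at most
  \<open>R * (1 - \<sigma> F x)\<close>, which is continuous in x, so a set F that is good at one
  point stays good nearby. The closure is taken because infinitely many weights may be positive at
  x.\<close>

lemma continuous_convex_selection:
  fixes k :: "'b::metric_space \<Rightarrow> 'v::banach"
  assumes \<rho>: "\<rho> > 0" and R: "\<And>x. x \<in> S \<Longrightarrow> norm (k x) \<le> R"
  shows "\<exists>f. continuous_on S f \<and>
    (\<forall>x\<in>S. f x \<in> closure (convex hull (k ` {y\<in>S. dist y x < \<rho>})))"
proof -
  obtain r0 :: "'b rel" where r0: "well_order_on UNIV r0" using well_order_on by blast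
  have "trans (r0 - Id)" and "total (r0 - Id)" and "wf (r0 - Id)"
    using r0 by (auto simp: well_order_on_def linear_order_on_def partial_order_on_def preorder_on_def
        intro: trans_diff_Id)
  then interpret tent_partition S \<rho> "r0 - Id" by unfold_locales (use \<rho> in auto)
  have wsum: "(\<lambda>y. w y x) summable_on A" "infsum (\<lambda>y. w y x) A \<le> 1 - (\<Sum>y\<in>F. w y x)" 
    if "finite F" "F \<subseteq> S" "A \<subseteq> S - F" for F A x
  proof -
    have b: "(\<Sum>y\<in>H. w y x) \<le> 1 - (\<Sum>y\<in>F. w y x)" if H: "finite H" "H \<subseteq> A" for H
    proof -
      have "(\<Sum>y\<in>H. w y x) + (\<Sum>y\<in>F. w y x) = (\<Sum>y\<in>H \<union> F. w y x)"
        using H \<open>A \<subseteq> S - F\<close> \<open>finite F\<close> by (intro sum.union_disjoint[symmetric]) auto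
      also have "\<dots> \<le> 1" using H that \<open>A \<subseteq> S - F\<close> \<open>finite F\<close> \<open>F \<subseteq> S\<close> by (intro sum_le_1) auto
      finally show ?thesis by simp
    qed
    show s: "(\<lambda>y. w y x) summable_on A"
      by (rule nonneg_bdd_above_summable_on)
         (use b in \<open>auto simp: w_nonneg intro!: bdd_aboveI[of _ "1 - (\<Sum>y\<in>F. w y x)"]\<close>)
    show "infsum (\<lambda>y. w y x) A \<le> 1 - (\<Sum>y\<in>F. w y x)"
      by (rule infsum_le_finite_sums[OF s]) (use b in auto)
  qed
  have abs: "(\<lambda>y. w y x *\<^sub>R k y) abs_summable_on A" if "A \<subseteq> S" for x A
  proof (rule Infinite_Sum.abs_summable_on_comparison_test')
    show "(\<lambda>y. R * w y x) summable_on A" by (intro summable_on_cmult_right wsum(1)[of "{}"]) (use that in auto)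
    show "norm (w y x *\<^sub>R k y) \<le> R * w y x" if "y \<in> A" for y
      using mult_left_mono[OF R[of y] w_nonneg[of y x]] that \<open>A \<subseteq> S\<close> by (auto simp: w_nonneg mult.commute)
  qed
  define f where "f x = infsum (\<lambda>y. w y x *\<^sub>R k y) S" for x
  define P where "P F x = (\<Sum>y\<in>F. w y x *\<^sub>R k y)" for F x
  define \<sigma> where "\<sigma> F x = (\<Sum>y\<in>F. w y x)" for F x
  have est: "norm (f x - P F x) \<le> R * (1 - \<sigma> F x)" if F: "finite F" "F \<subseteq> S" and x: "x \<in> S" for F x
  proof -
    have R0: "0 \<le> R" using R[OF x] norm_ge_zero order_trans by blast
    have "f x = infsum (\<lambda>y. w y x *\<^sub>R k y) (F \<union> (S - F))" using F by (simp add: f_def Un_absorb1)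
    also have "\<dots> = infsum (\<lambda>y. w y x *\<^sub>R k y) F + infsum (\<lambda>y. w y x *\<^sub>R k y) (S - F)"
      by (rule infsum_Un_disjoint; (rule abs_summable_summable, rule abs)?) (use F in auto)
    also have "infsum (\<lambda>y. w y x *\<^sub>R k y) F = P F x" using F(1) by (simp add: P_def)
    finally have "norm (f x - P F x) = norm (infsum (\<lambda>y. w y x *\<^sub>R k y) (S - F))" by simp
    also have "\<dots> \<le> infsum (\<lambda>y. norm (w y x *\<^sub>R k y)) (S - F)"
      by (rule norm_infsum_bound) (use abs in auto)
    also have "\<dots> \<le> infsum (\<lambda>y. R * w y x) (S - F)"
    proof (rule infsum_mono)
      show "(\<lambda>y. norm (w y x *\<^sub>R k y)) summable_on S - F" using abs by auto
      show "(\<lambda>y. R * w y x) summable_on S - F" by (intro summable_on_cmult_right wsum(1)[of F]) (use F in auto)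
      show "norm (w y x *\<^sub>R k y) \<le> R * w y x" if "y \<in> S - F" for y
        using mult_left_mono[OF R[of y] w_nonneg[of y x]] that by (auto simp: w_nonneg mult.commute)
    qed
    also have "\<dots> = R * infsum (\<lambda>y. w y x) (S - F)" by (rule infsum_cmult_right') 
    also have "\<dots> \<le> R * (1 - \<sigma> F x)" unfolding \<sigma>_def by (intro mult_left_mono wsum(2) R0) (use F in auto)
    finally show ?thesis .
  qed
  have \<sigma>1: "\<sigma> F x \<le> 1" if "finite F" "F \<subseteq> S" for F x using sum_le_1[OF that] by (simp add: \<sigma>_def)
  have cont: "continuous_on S f"
    unfolding continuous_on_def
  proof (intro ballI tendstoI)
    fix x0 and e :: real assume x0: "x0 \<in> S" and e: "e > 0"
    define K where "K = \<bar>R\<bar> + 1"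
    have K: "K > 0" "R \<le> K" by (auto simp: K_def)
    define c where "c = e / (4 * K)"
    have c: "c > 0" using e K by (simp add: c_def)
    obtain F where F: "finite F" "F \<subseteq> S" "1 - c < \<sigma> F x0"
      using sum_ge_1[OF c x0] by (auto simp: \<sigma>_def)
    have R0: "0 \<le> R" using R[OF x0] norm_ge_zero order_trans by blast
    have Rc: "R * c \<le> e / 4"
    proof -
      have "R * c \<le> K * c" using c K by (intro mult_right_mono) auto
      also have "\<dots> = e / 4" using K by (simp add: c_def)
      finally show ?thesis .
    qed
    have "continuous_on S (\<lambda>x. R * (1 - \<sigma> F x) + norm (P F x - P F x0) + R * (1 - \<sigma> F x0))"
      unfolding \<sigma>_def P_def by (intro continuous_intros continuous_w)
    hence "((\<lambda>x. R * (1 - \<sigma> F x) + norm (P F x - P F x0) + R * (1 - \<sigma> F x0)) \<longlongrightarrow> 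
        R * (1 - \<sigma> F x0) + norm (P F x0 - P F x0) + R * (1 - \<sigma> F x0)) (at x0 within S)"
      using x0 unfolding continuous_on_def by blast
    moreover have "R * (1 - \<sigma> F x0) \<le> R * c" using F(3) R0 by (intro mult_left_mono) auto
    hence "R * (1 - \<sigma> F x0) + norm (P F x0 - P F x0) + R * (1 - \<sigma> F x0) < e" using Rc e by simp
    ultimately have "\<forall>\<^sub>F x in at x0 within S. R * (1 - \<sigma> F x) + norm (P F x - P F x0) + R * (1 - \<sigma> F x0) < e"
      by (rule order_tendstoD(2))
    moreover have "\<forall>\<^sub>F x in at x0 within S. x \<in> S" by (simp add: eventually_at_filter)
    ultimately show "\<forall>\<^sub>F x in at x0 within S. dist (f x) (f x0) < e"
    proof eventually_elim
      case (elim x)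
      have "f x - f x0 = (f x - P F x) + (P F x - P F x0) + (P F x0 - f x0)" by simp
      also have "norm \<dots> \<le> norm (f x - P F x) + norm (P F x - P F x0) + norm (P F x0 - f x0)"
        by (rule order_trans[OF norm_triangle_ineq add_right_mono[OF norm_triangle_ineq]])
      finally show ?case using est[OF F(1,2) elim(2)] est[OF F(1,2) x0] elim(1)
        by (simp add: dist_norm norm_minus_commute)
    qed
  qed
  have mem: "f x \<in> closure (convex hull (k ` {y\<in>S. dist y x < \<rho>}))" if x: "x \<in> S" for x
    unfolding closure_approachable
  proof (intro allI impI)
    fix e :: real assume e: "e > 0"
    define K where "K = \<bar>R\<bar> + 1"
    have K: "K > 0" "R < K" by (auto simp: K_def)
    define c where "c = min (1/2) (e / (2 * K))"
    have c: "c > 0" "c \<le> 1/2" using e K by (auto simp: c_def)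
    have R0: "0 \<le> R" using R[OF x] norm_ge_zero order_trans by blast
    have Rc: "R * (2 * c) < e"
    proof -
      have "R * (2 * c) < K * (2 * c)" using c K by (intro mult_strict_right_mono) auto
      also have "\<dots> \<le> K * (2 * (e / (2 * K)))" using K by (intro mult_left_mono) (auto simp: c_def)
      also have "\<dots> = e" using K by simp
      finally show ?thesis .
    qed
    obtain F0 where F0: "finite F0" "F0 \<subseteq> S" "1 - c < \<sigma> F0 x"
      using sum_ge_1[OF c(1) x] by (auto simp: \<sigma>_def)
    define F where "F = {y\<in>F0. w y x > 0}"
    have F: "finite F" "F \<subseteq> S" using F0 by (auto simp: F_def)
    have "\<sigma> F x = \<sigma> F0 x" unfolding \<sigma>_def F_def
      using F0(1) w_nonneg[of _ x] by (intro sum.mono_neutral_left) (auto simp: not_less order_antisym)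
    hence s: "1 - c < \<sigma> F x" using F0 by simp
    hence sp: "\<sigma> F x > 0" using c by linarith
    \<comment> \<open>A finite partial sum has total weight below or equal to 1; rescaling makes it
      a true convex combination. \<open>F\<close> keeps only positive weights, so its indices lie
      within \<open>\<rho>\<close> of x.\<close>
    define q where "q = (1 / \<sigma> F x) *\<^sub>R P F x"
    have "q = (\<Sum>y\<in>F. (w y x / \<sigma> F x) *\<^sub>R k y)"
      unfolding q_def P_def by (simp add: scaleR_sum_right)
    also have "\<dots> \<in> convex hull (k ` {y\<in>S. dist y x < \<rho>})"
    proof (rule convex_sum[OF F(1) convex_convex_hull])
      show "(\<Sum>y\<in>F. w y x / \<sigma> F x) = 1"
        unfolding sum_divide_distrib[symmetric] using sp by (simp add: \<sigma>_def)
      show "w y x / \<sigma> F x \<ge> 0" if "y \<in> F" for y using sp w_nonneg by simp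
      show "k y \<in> convex hull (k ` {y\<in>S. dist y x < \<rho>})" if "y \<in> F" for y
        using that F(2) w_support[of y x] by (intro hull_inc) (auto simp: F_def)
    qed
    finally have q: "q \<in> convex hull (k ` {y\<in>S. dist y x < \<rho>})" .
    have "norm (P F x) \<le> (\<Sum>y\<in>F. R * w y x)" unfolding P_def
    proof (rule sum_norm_le)
      show "norm (w y x *\<^sub>R k y) \<le> R * w y x" if "y \<in> F" for y
        using mult_left_mono[OF R[of y] w_nonneg[of y x]] that F(2) by (auto simp: w_nonneg mult.commute)
    qed
    also have "\<dots> = R * \<sigma> F x" by (simp add: \<sigma>_def sum_distrib_left)
    finally have nP: "norm (P F x) \<le> R * \<sigma> F x" .
    have "q - P F x = (1 / \<sigma> F x - 1) *\<^sub>R P F x" by (simp add: q_def scaleR_diff_left)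
    hence "norm (q - P F x) = (1 / \<sigma> F x - 1) * norm (P F x)"
      using sp \<sigma>1[OF F, of x] by simp
    also have "\<dots> \<le> (1 / \<sigma> F x - 1) * (R * \<sigma> F x)"
      using sp \<sigma>1[OF F, of x] by (intro mult_left_mono nP) simp
    also have "\<dots> = R * (1 - \<sigma> F x)" using sp by (simp add: field_simps)
    finally have "norm (q - P F x) \<le> R * (1 - \<sigma> F x)" .
    hence "dist q (f x) \<le> R * (1 - \<sigma> F x) + R * (1 - \<sigma> F x)"
      using est[OF F x] norm_triangle_ineq4[of "q - P F x" "f x - P F x"] by (simp add: dist_norm)
    also have "\<dots> = R * (2 * (1 - \<sigma> F x))" by simp
    also have "\<dots> \<le> R * (2 * c)" using s R0 by (intro mult_left_mono) auto
    finally show "\<exists>q\<in>convex hull (k ` {y\<in>S. dist y x < \<rho>}). dist q (f x) < e" using q Rc by (intro bexI[of _ q]) auto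
  qed
  show ?thesis using cont mem by blast
qed

section \<open>The action of the unitary group on functionals\<close>

lemma unitary_act_mult: "unitary_act (u * v) \<phi> = unitary_act u (unitary_act v \<phi>)"
  by (rule blinfun_eqI) (simp add: unitary_act.rep_eq adj_mult mult.assoc)

lemma unitary_act_one [simp]: "unitary_act 1 \<phi> = \<phi>"
  by (rule blinfun_eqI) (simp add: unitary_act.rep_eq)

lemma unitary_act_diff: "unitary_act u (\<phi> - \<psi>) = unitary_act u \<phi> - unitary_act u \<psi>"
  by (rule blinfun_eqI) (simp add: unitary_act.rep_eq blinfun.diff_left)

lemma unitary_act_add: "unitary_act u (\<phi> + \<psi>) = unitary_act u \<phi> + unitary_act u \<psi>"
  by (rule blinfun_eqI) (simp add: unitary_act.rep_eq blinfun.add_left)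

lemma unitary_act_scaleR: "unitary_act u (r *\<^sub>R \<phi>) = r *\<^sub>R unitary_act u \<phi>"
  by (rule blinfun_eqI) (simp add: unitary_act.rep_eq blinfun.scaleR_left)

lemma unitary_act_cancel:
  assumes "u \<in> unitaries"
  shows "unitary_act (adj u) (unitary_act u \<phi>) = \<phi>" "unitary_act u (unitary_act (adj u) \<phi>) = \<phi>"
  using assms by (simp_all add: unitary_act_mult[symmetric] unitaries_def)

lemma norm_unitary_act_le:
  assumes "u \<in> unitaries" shows "norm (unitary_act u \<phi>) \<le> norm \<phi>"
proof (rule norm_blinfun_bound)
  fix a
  have "norm (adj u * a * u) \<le> norm (adj u) * norm a * norm u"
    by (rule order_trans[OF norm_mult_ineq mult_right_mono[OF norm_mult_ineq]]) simp
  hence "norm (adj u * a * u) \<le> norm a" using norm_unitary[OF assms] by simp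
  thus "norm (unitary_act u \<phi> a) \<le> norm \<phi> * norm a"
    unfolding unitary_act.rep_eq by (intro order_trans[OF norm_blinfun mult_left_mono]) auto
qed simp

lemma norm_unitary_act_diff:
  assumes u: "u \<in> unitaries" and v: "v \<in> unitaries"
  shows "norm (unitary_act u \<phi> - unitary_act v \<phi>) \<le> 2 * norm \<phi> * norm (u - v)"
proof (rule norm_blinfun_bound)
  fix a
  have e: "adj u * a * u - adj v * a * v = adj u * a * (u - v) + adj (u - v) * a * v"
    by (simp add: algebra_simps adj_diff)
  have m: "norm (x * a * y) \<le> norm x * norm a * norm y" for x y
    by (rule order_trans[OF norm_mult_ineq mult_right_mono[OF norm_mult_ineq]]) simp
  have "norm (adj u * a * u - adj v * a * v) \<le> norm (adj u * a * (u - v)) + norm (adj (u - v) * a * v)"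
    unfolding e by (rule norm_triangle_ineq)
  also have "\<dots> \<le> norm a * norm (u - v) + norm (u - v) * norm a"
    using m[of "adj u" "u - v"] m[of "adj (u - v)" v]
    unfolding norm_adj norm_unitary[OF u] norm_unitary[OF v] mult_1_left mult_1_right by (rule add_mono)
  finally have "norm \<phi> * norm (adj u * a * u - adj v * a * v) \<le> norm \<phi> * (norm a * norm (u - v) + norm (u - v) * norm a)"
    by (intro mult_left_mono) auto
  moreover have "(unitary_act u \<phi> - unitary_act v \<phi>) a = \<phi> (adj u * a * u - adj v * a * v)"
    by (simp add: unitary_act.rep_eq blinfun.diff_left blinfun.diff_right)
  ultimately show "norm ((unitary_act u \<phi> - unitary_act v \<phi>) a) \<le> 2 * norm \<phi> * norm (u - v) * norm a"
    using norm_blinfun[of \<phi> "adj u * a * u - adj v * a * v"] by (simp add: algebra_simps)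
qed simp

lemma continuous_on_unitary_act [continuous_intros]:
  assumes f: "continuous_on S f" and g: "continuous_on S g" and u: "\<And>x. x \<in> S \<Longrightarrow> f x \<in> unitaries"
  shows "continuous_on S (\<lambda>x. unitary_act (f x) (g x))"
  unfolding continuous_on_def
proof
  fix x0 assume x0: "x0 \<in> S"
  have ft: "(f \<longlongrightarrow> f x0) (at x0 within S)" and gt: "(g \<longlongrightarrow> g x0) (at x0 within S)"
    using f g x0 by (auto simp: continuous_on_def)
  have "((\<lambda>x. norm (g x - g x0) + 2 * norm (g x0) * norm (f x - f x0)) \<longlongrightarrow> 
      norm (g x0 - g x0) + 2 * norm (g x0) * norm (f x0 - f x0)) (at x0 within S)"
    by (intro tendsto_intros ft gt)
  hence lim: "((\<lambda>x. norm (g x - g x0) + 2 * norm (g x0) * norm (f x - f x0)) \<longlongrightarrow> 0) (at x0 within S)" by simp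
  have "\<forall>\<^sub>F x in at x0 within S. norm (unitary_act (f x) (g x) - unitary_act (f x0) (g x0)) \<le> 
      norm (g x - g x0) + 2 * norm (g x0) * norm (f x - f x0)"
    unfolding eventually_at_filter
  proof (intro always_eventually allI impI)
    fix x assume x: "x \<in> S"
    have "unitary_act (f x) (g x) - unitary_act (f x0) (g x0) = 
      unitary_act (f x) (g x - g x0) + (unitary_act (f x) (g x0) - unitary_act (f x0) (g x0))"
      by (simp add: unitary_act_diff)
    also have "norm \<dots> \<le> norm (unitary_act (f x) (g x - g x0)) + norm (unitary_act (f x) (g x0) - unitary_act (f x0) (g x0))"
      by (rule norm_triangle_ineq)
    also have "\<dots> \<le> norm (g x - g x0) + 2 * norm (g x0) * norm (f x - f x0)"
      by (intro add_mono norm_unitary_act_le norm_unitary_act_diff u x x0)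
    finally show "norm (unitary_act (f x) (g x) - unitary_act (f x0) (g x0)) \<le> 
      norm (g x - g x0) + 2 * norm (g x0) * norm (f x - f x0)" .
  qed
  hence "((\<lambda>x. unitary_act (f x) (g x) - unitary_act (f x0) (g x0)) \<longlongrightarrow> 0) (at x0 within S)"
    by (rule Lim_null_comparison[OF _ lim])
  thus "((\<lambda>x. unitary_act (f x) (g x)) \<longlongrightarrow> unitary_act (f x0) (g x0)) (at x0 within S)"
    by (simp add: LIM_zero_iff)
qed

lemma unitary_act_tendsto:
  assumes "X \<longlonglongrightarrow> u" "\<And>n. X n \<in> unitaries" "u \<in> unitaries"
  shows "(\<lambda>n. unitary_act (X n) \<phi>) \<longlonglongrightarrow> unitary_act u \<phi>"
proof -
  have "continuous_on unitaries (\<lambda>v. unitary_act v \<phi>)" by (intro continuous_intros) auto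
  thus ?thesis using assms by (auto simp: continuous_on_sequentially o_def)
qed

section \<open>Orbits of states and the phase of representatives\<close>

definition unitary_orbit :: "('a::unital_cstar_algebra \<Rightarrow>\<^sub>L complex) \<Rightarrow> ('a \<Rightarrow>\<^sub>L complex) set" where
  "unitary_orbit \<omega> = {unitary_act u \<omega> | u. u \<in> unitaries}"

lemma unitary_orbit_self [simp]: "\<omega> \<in> unitary_orbit \<omega>"
  unfolding unitary_orbit_def by (metis (mono_tags, lifting) mem_Collect_eq unitaries_one unitary_act_one)

lemma unitary_orbitI: "u \<in> unitaries \<Longrightarrow> unitary_act u \<omega> \<in> unitary_orbit \<omega>"
  by (auto simp: unitary_orbit_def)

lemma unitary_orbit_act:
  assumes "\<psi> \<in> unitary_orbit \<omega>" "u \<in> unitaries" shows "unitary_act u \<psi> \<in> unitary_orbit \<omega>"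
  using assms unfolding unitary_orbit_def by (auto simp: unitary_act_mult[symmetric] intro: unitaries_mult)

lemma unitary_orbit_trans:
  assumes "\<psi> \<in> unitary_orbit \<omega>" "\<xi> \<in> unitary_orbit \<omega>" shows "\<xi> \<in> unitary_orbit \<psi>"
proof -
  obtain u v where uv: "u \<in> unitaries" "\<psi> = unitary_act u \<omega>" "v \<in> unitaries" "\<xi> = unitary_act v \<omega>"
    using assms by (auto simp: unitary_orbit_def)
  have "\<xi> = unitary_act (v * adj u) \<psi>" by (simp add: uv unitary_act_mult unitary_act_cancel)
  thus ?thesis using unitary_orbitI[OF unitaries_mult[OF uv(3) unitaries_adj[OF uv(1)]]] by simp
qed

lemma sn_one_unitary:
  assumes "pure_fun f" "u \<in> unitaries" shows "sn f u = 1"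
  using sn_unitary[OF pos_fun_lin[OF pure_fun_pos[OF assms(1)]] assms(2), of 1]
  by (simp add: sn_def pure_fun_one[OF assms(1)])

lemma pure_fun_unitary_orbit:
  assumes f: "pure_fun (blinfun_apply \<omega>)" and "\<psi> \<in> unitary_orbit \<omega>"
  shows "pure_fun (blinfun_apply \<psi>)"
proof -
  obtain u where u: "u \<in> unitaries" "\<psi> = unitary_act u \<omega>" using assms by (auto simp: unitary_orbit_def)
  have "blinfun_apply \<psi> = (\<lambda>a. \<omega> (adj u * a * u))" by (rule ext) (simp add: u unitary_act.rep_eq)
  thus ?thesis using pure_vector[OF f sn_one_unitary[OF f u(1)]] by simp
qed

text \<open>The states depend only on the vectors \<open>u\<close> \<Omega> and \<open>v\<close>
  \<Omega>, so the GNS seminorm of the difference controls them; this lets seminorm errors enter the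
  Newton estimate.\<close>

lemma norm_unitary_act_diff_sn:
  assumes f: "pure_fun (blinfun_apply \<omega>)" and u: "u \<in> unitaries" and v: "v \<in> unitaries"
  shows "norm (unitary_act u \<omega> - unitary_act v \<omega>) \<le> 2 * sn \<omega> (u - v)"
proof (rule norm_blinfun_bound)
  fix a
  show "norm ((unitary_act u \<omega> - unitary_act v \<omega>) a) \<le> 2 * sn \<omega> (u - v) * norm a"
    using conj_diff[OF pure_fun_pos[OF f], of u a v]
    by (simp add: unitary_act.rep_eq blinfun.diff_left sn_one_unitary[OF f] u v mult_ac)
qed (use pos_fun_lin[OF pure_fun_pos[OF f]] in simp)

lemma unitary_act_phase:
  assumes f: "pure_fun (blinfun_apply \<omega>)" and c: "cmod c = 1"
  shows "unitary_act (c *\<^sub>C u) \<omega> = unitary_act u \<omega>"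
proof (rule blinfun_eqI)
  fix a
  note l = pos_lin_clin[OF pos_fun_lin[OF pure_fun_pos[OF f]]]
  have "cnj c * c = 1" using c by (metis complex_norm_square mult.commute of_real_1 one_power2)
  thus "unitary_act (c *\<^sub>C u) \<omega> a = unitary_act u \<omega> a"
    by (simp add: unitary_act.rep_eq cstar_simps clin_simps[OF l] mult.assoc[symmetric] mult.commute[of c])
qed

text \<open>A phase does not change the state, so it can be spent on the positivity condition of
  \<open>vector_dist_le_state_dist\<close> relative to \<Omega>.\<close>

lemma unitary_orbit_representative:
  assumes f: "pure_fun (blinfun_apply \<omega>)" and "\<psi> \<in> unitary_orbit \<omega>"
  shows "\<exists>u\<in>unitaries. unitary_act u \<omega> = \<psi> \<and> Im (\<omega> u) = 0 \<and> 0 \<le> Re (\<omega> u)"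
proof -
  note l = pos_lin_clin[OF pos_fun_lin[OF pure_fun_pos[OF f]]]
  obtain v where v: "v \<in> unitaries" "\<psi> = unitary_act v \<omega>" using assms by (auto simp: unitary_orbit_def)
  obtain c where c: "cmod c = 1" "c * \<omega> v = of_real (cmod (\<omega> v))" using phase_exists by blast
  show ?thesis
    by (rule bexI[OF _ unitaries_scaleC[OF v(1) c(1)]])
       (simp add: v(2) unitary_act_phase[OF f c(1)] clin_simps[OF l] c(2))
qed

lemma continuous_on_sn: "continuous_on A (\<lambda>a. sn (blinfun_apply \<phi>) a)"
  unfolding sn_def by (intro continuous_intros)

section \<open>Local sections of the orbit map\<close>

text \<open>The averaged generators \<open>k\<close> are only first-order correct, which leaves an error quadratic in \<open>d\<close>.\<close>
lemma local_approx_section: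
  fixes \<omega> :: "'a::unital_cstar_algebra \<Rightarrow>\<^sub>L complex"
  assumes f: "pure_fun (blinfun_apply \<omega>)" and d: "0 < d" "d \<le> 1/100"
  defines "S \<equiv> {\<psi> \<in> unitary_orbit \<omega>. norm (\<psi> - \<omega>) \<le> d}" and "K \<equiv> 2 * 10 ^ 14 :: real"
  shows "\<exists>s. continuous_on S s \<and> (\<forall>\<psi>\<in>S. s \<psi> \<in> unitaries \<and> norm (s \<psi> - 1) \<le> K * d \<and>
    norm (unitary_act (adj (s \<psi>)) \<psi> - \<omega>) \<le> K * d\<^sup>2)"
proof -
  note fp = pure_fun_pos[OF f]
  note fl = pos_fun_lin[OF fp]
  note l = pos_lin_clin[OF fl]
  have f1: "\<omega> 1 = 1" "sn \<omega> 1 = 1" by (simp_all add: sn_def pure_fun_one[OF f])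
  have d2: "d\<^sup>2 \<le> d / 100" "0 < d\<^sup>2" using d mult_left_mono[OF d(2), of d] by (simp_all add: power2_eq_square)
  have "\<forall>\<psi>. \<exists>u. \<psi> \<in> S \<longrightarrow> u \<in> unitaries \<and> unitary_act u \<omega> = \<psi> \<and> Im (\<omega> u) = 0 \<and> 0 \<le> Re (\<omega> u)"
    using unitary_orbit_representative[OF f] unfolding S_def by blast
  then obtain u where u: "\<And>\<psi>. \<psi> \<in> S \<Longrightarrow> u \<psi> \<in> unitaries" "\<And>\<psi>. \<psi> \<in> S \<Longrightarrow> unitary_act (u \<psi>) \<omega> = \<psi>"
    "\<And>\<psi>. \<psi> \<in> S \<Longrightarrow> Im (\<omega> (u \<psi>)) = 0" "\<And>\<psi>. \<psi> \<in> S \<Longrightarrow> 0 \<le> Re (\<omega> (u \<psi>))" by metis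
  define q where "q \<psi> = Re (\<omega> (u \<psi>))" for \<psi>
  have q: "\<omega> (u \<psi>) = of_real (q \<psi>)" if "\<psi> \<in> S" for \<psi> using u(3)[OF that] by (auto simp: q_def intro: complex_eqI)
  have apply_u: "\<omega> (adj (u \<psi>) * z * u \<psi>) = \<psi> z" if "\<psi> \<in> S" for \<psi> z
    using u(2)[OF that] by (metis unitary_act.rep_eq)
  have su: "sn \<omega> (u \<psi>) = 1" if "\<psi> \<in> S" for \<psi> by (rule sn_one_unitary[OF f u(1)[OF that]])
  have near1: "sn \<omega> (u \<psi> - 1) \<le> 100 * d" if \<psi>: "\<psi> \<in> S" for \<psi>
  proof -
    have "sn \<omega> (1 - u \<psi>) \<le> 100 * d"
    proof (rule vector_dist_le_state_dist[OF f f1(2) su[OF \<psi>]])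
      fix z
      have "norm ((\<psi> - \<omega>) z) \<le> d * norm z"
        using \<psi> by (intro order_trans[OF norm_blinfun mult_right_mono]) (auto simp: S_def)
      thus "cmod (\<omega> (adj 1 * z * 1) - \<omega> (adj (u \<psi>) * z * u \<psi>)) \<le> d * norm z"
        unfolding apply_u[OF \<psi>] by (simp add: blinfun.diff_left norm_minus_commute)
    qed (use u(3,4)[OF \<psi>] in auto)
    thus ?thesis by (simp add: sn_minus_commute[OF fl, of _ 1])
  qed
  \<comment> \<open>1 - q is half the squared distance of two unit vectors with real inner product,
    hence quadratic in \<open>d\<close>; 5000 is 100^2 / 2.\<close>
  have q1: "0 \<le> 1 - q \<psi>" "1 - q \<psi> \<le> 5000 * d\<^sup>2" if \<psi>: "\<psi> \<in> S" for \<psi>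
  proof -
    have "(sn \<omega> (u \<psi> - 1))\<^sup>2 = 2 - 2 * q \<psi>"
      unfolding sn_diff_Re[OF fl] by (simp add: su[OF \<psi>] f1 pos_lin_adj[OF fl] q_def)
    moreover have "(sn \<omega> (u \<psi> - 1))\<^sup>2 \<le> (100 * d)\<^sup>2" by (intro power_mono near1 \<psi> sn_nonneg fl)
    moreover have "(100 * d)\<^sup>2 = 10000 * d\<^sup>2" by (simp add: power_mult_distrib)
    ultimately show "1 - q \<psi> \<le> 5000 * d\<^sup>2" "0 \<le> 1 - q \<psi>"
      using zero_le_power2[of "sn \<omega> (u \<psi> - 1)"] by linarith+
  qed
  have qhalf: "1/2 \<le> q \<psi>" if \<psi>: "\<psi> \<in> S" for \<psi> using q1(2)[OF \<psi>] d2 d by linarith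
  \<comment> \<open>The component of \<open>u \<psi>\<close> orthogonal to \<Omega>, as required by
    \<open>selfadj_norm_control\<close>.\<close>
  define b where "b \<psi> = u \<psi> - of_real (q \<psi>) *\<^sub>C 1" for \<psi>
  have b0: "\<omega> (b \<psi>) = 0" if "\<psi> \<in> S" for \<psi> using q[OF that] by (simp add: b_def clin_simps[OF l] f1)
  have sb: "sn \<omega> (b \<psi>) \<le> 150 * d" if \<psi>: "\<psi> \<in> S" for \<psi>
  proof -
    have "b \<psi> = (u \<psi> - 1) + of_real (1 - q \<psi>) *\<^sub>C 1" by (simp add: b_def scaleC_diff_left)
    also have "sn \<omega> \<dots> \<le> sn \<omega> (u \<psi> - 1) + sn \<omega> (of_real (1 - q \<psi>) *\<^sub>C 1)" by (rule sn_triangle[OF fl])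
    also have "sn \<omega> (of_real (1 - q \<psi>) *\<^sub>C 1) = \<bar>1 - q \<psi>\<bar>"
      unfolding sn_scaleC[OF fl] norm_of_real by (simp add: f1)
    finally show ?thesis using near1[OF \<psi>] q1[OF \<psi>] d2 by linarith
  qed
  \<comment> \<open>Relative accuracy \<open>d\<close> makes the error quadratic. The bound 6000000
    is 80000 * 75, since half of \<open>b \<psi>\<close> has length at most
    \<open>75 * d\<close>.\<close>
  have "\<forall>\<psi>. \<exists>k. \<psi> \<in> S \<longrightarrow> k \<in> selfadj \<and> norm k \<le> 6000000 * d \<and> sn \<omega> (2 *\<^sub>R (\<i> *\<^sub>C k) - b \<psi>) \<le> 150 * d\<^sup>2"
  proof (intro allI)
    fix \<psi>
    show "\<exists>k. \<psi> \<in> S \<longrightarrow> k \<in> selfadj \<and> norm k \<le> 6000000 * d \<and> sn \<omega> (2 *\<^sub>R (\<i> *\<^sub>C k) - b \<psi>) \<le> 150 * d\<^sup>2"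
    proof (cases "\<psi> \<in> S")
      case True
      define c where "c = (1/2) *\<^sub>R (- (\<i> *\<^sub>C b \<psi>))"
      have "\<omega> c = 0" by (simp add: c_def clin_simps[OF l] b0[OF True])
      then obtain k where k: "k \<in> selfadj" "norm k \<le> 80000 * sn \<omega> c" "sn \<omega> (c - k) \<le> d * sn \<omega> c"
        using selfadj_norm_control[OF f _ d(1)] by blast
      have "sn \<omega> c = sn \<omega> (b \<psi>) / 2" by (simp add: c_def sn_scaleR[OF fl] sn_scaleC[OF fl] sn_minus[OF fl])
      hence sc: "sn \<omega> c \<le> 75 * d" using sb[OF True] by simp
      have "2 *\<^sub>R (\<i> *\<^sub>C k) - b \<psi> = - (2 *\<^sub>R (\<i> *\<^sub>C (c - k)))"
        by (simp add: c_def scaleC_diff_right scaleC_scaleR scaleC_scaleC scaleR_diff_right)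
      hence "sn \<omega> (2 *\<^sub>R (\<i> *\<^sub>C k) - b \<psi>) = 2 * sn \<omega> (c - k)" by (simp add: sn_minus[OF fl] sn_scaleR[OF fl] sn_scaleC[OF fl])
      also have "\<dots> \<le> 2 * (d * (75 * d))" using mult_left_mono[OF sc, of d] k(3) d by linarith
      also have "\<dots> = 150 * d\<^sup>2" by (simp add: power2_eq_square)
      finally show ?thesis using k sc by (intro exI[of _ k]) auto
    qed simp
  qed
  then obtain k where k: "\<And>\<psi>. \<psi> \<in> S \<Longrightarrow> k \<psi> \<in> selfadj" "\<And>\<psi>. \<psi> \<in> S \<Longrightarrow> norm (k \<psi>) \<le> 6000000 * d"
    "\<And>\<psi>. \<psi> \<in> S \<Longrightarrow> sn \<omega> (2 *\<^sub>R (\<i> *\<^sub>C k \<psi>) - b \<psi>) \<le> 150 * d\<^sup>2" by metis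
  \<comment> \<open>The \<open>u \<psi>\<close> are arbitrary choices, so neighbouring ones are
    comparable only after aligning them by a phase \<open>\<theta>\<close>. Their overlaps with
    \<Omega> are real, at least 1/2 and nearly matched by \<open>\<theta>\<close>, which forces
    \<open>\<theta>\<close> close to 1.\<close>
  have bb: "sn \<omega> (b \<xi> - b \<psi>) \<le> 1000 * d\<^sup>2" if \<xi>: "\<xi> \<in> S" and \<psi>: "\<psi> \<in> S" and dist: "dist \<xi> \<psi> < d\<^sup>2" for \<xi> \<psi>
  proof -
    obtain \<theta> where \<theta>: "cmod \<theta> = 1" "\<theta> * \<omega> (adj (u \<xi>) * u \<psi>) = of_real (cmod (\<omega> (adj (u \<xi>) * u \<psi>)))"
      using phase_exists by blast
    have ul: "\<theta> *\<^sub>C u \<psi> \<in> unitaries" by (rule unitaries_scaleC[OF u(1)[OF \<psi>] \<theta>(1)])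
    have al: "\<omega> (adj (\<theta> *\<^sub>C u \<psi>) * z * (\<theta> *\<^sub>C u \<psi>)) = \<psi> z" for z
      using unitary_act_phase[OF f \<theta>(1), of "u \<psi>"] u(2)[OF \<psi>] by (metis unitary_act.rep_eq)
    have e1: "sn \<omega> (u \<xi> - \<theta> *\<^sub>C u \<psi>) \<le> 100 * d\<^sup>2"
    proof (rule vector_dist_le_state_dist[OF f su[OF \<xi>] sn_one_unitary[OF f ul]])
      show "Im (\<omega> (adj (u \<xi>) * \<theta> *\<^sub>C u \<psi>)) = 0" "0 \<le> Re (\<omega> (adj (u \<xi>) * \<theta> *\<^sub>C u \<psi>))"
        by (simp_all add: mult_scaleC_right clin_simps[OF l] \<theta>(2))
      fix z
      have "norm ((\<xi> - \<psi>) z) \<le> d\<^sup>2 * norm z"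
        using dist by (intro order_trans[OF norm_blinfun mult_right_mono]) (auto simp: dist_norm)
      thus "cmod (\<omega> (adj (u \<xi>) * z * u \<xi>) - \<omega> (adj (\<theta> *\<^sub>C u \<psi>) * z * (\<theta> *\<^sub>C u \<psi>))) \<le> d\<^sup>2 * norm z"
        unfolding apply_u[OF \<xi>] al by (simp add: blinfun.diff_left)
    qed
    have e2: "cmod (of_real (q \<xi>) - \<theta> * of_real (q \<psi>)) \<le> 100 * d\<^sup>2"
    proof -
      have "of_real (q \<xi>) - \<theta> * of_real (q \<psi>) = \<omega> (u \<xi> - \<theta> *\<^sub>C u \<psi>)" by (simp add: clin_simps[OF l] q \<xi> \<psi>)
      thus ?thesis using Cauchy_Schwarz1[OF fl, of "u \<xi> - \<theta> *\<^sub>C u \<psi>"] e1 by (simp add: f1)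
    qed
    have e3: "\<bar>q \<xi> - q \<psi>\<bar> \<le> 100 * d\<^sup>2"
    proof -
      have "\<bar>cmod (of_real (q \<xi>)) - cmod (\<theta> * of_real (q \<psi>))\<bar> \<le> cmod (of_real (q \<xi>) - \<theta> * of_real (q \<psi>))"
        by (rule norm_triangle_ineq3)
      moreover have "cmod (of_real (q \<xi>)) = q \<xi>" "cmod (\<theta> * of_real (q \<psi>)) = q \<psi>"
        using qhalf[OF \<xi>] qhalf[OF \<psi>] \<theta>(1) by (simp_all add: norm_mult)
      ultimately show ?thesis using e2 by simp
    qed
    have "cmod (\<theta> - 1) * q \<psi> = cmod ((\<theta> - 1) * of_real (q \<psi>))" using qhalf[OF \<psi>] by (simp add: norm_mult)
    also have "(\<theta> - 1) * of_real (q \<psi>) = of_real (q \<xi> - q \<psi>) - (of_real (q \<xi>) - \<theta> * of_real (q \<psi>))"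
      by (simp add: algebra_simps)
    also have "cmod \<dots> \<le> cmod (of_real (q \<xi> - q \<psi>)) + cmod (of_real (q \<xi>) - \<theta> * of_real (q \<psi>))"
      by (rule norm_triangle_ineq4)
    also have "\<dots> \<le> 200 * d\<^sup>2" using e2 e3 unfolding norm_of_real by linarith
    finally have "cmod (\<theta> - 1) * q \<psi> \<le> 200 * d\<^sup>2" .
    moreover have "cmod (\<theta> - 1) * (1/2) \<le> cmod (\<theta> - 1) * q \<psi>" by (intro mult_left_mono qhalf \<psi>) simp
    ultimately have e4: "cmod (\<theta> - 1) \<le> 400 * d\<^sup>2" by linarith
    have "b \<xi> - b \<psi> = (u \<xi> - \<theta> *\<^sub>C u \<psi>) + ((\<theta> - 1) *\<^sub>C u \<psi> - of_real (q \<xi> - q \<psi>) *\<^sub>C 1)"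
      by (simp add: b_def scaleC_diff_left)
    also have "sn \<omega> \<dots> \<le> sn \<omega> (u \<xi> - \<theta> *\<^sub>C u \<psi>) + (sn \<omega> ((\<theta> - 1) *\<^sub>C u \<psi>) + sn \<omega> (of_real (q \<xi> - q \<psi>) *\<^sub>C 1))"
      by (rule order_trans[OF sn_triangle[OF fl] add_left_mono[OF sn_diff_le[OF fl]]])
    also have "\<dots> \<le> 100 * d\<^sup>2 + (400 * d\<^sup>2 + 100 * d\<^sup>2)"
      using e1 e3 e4 unfolding sn_scaleC[OF fl] norm_of_real by (simp add: su[OF \<psi>] f1)
    finally show ?thesis using d2 by linarith
  qed
  \<comment> \<open>Averaging over radius \<open>d\<^sup>2\<close> keeps its error at the order of
    the Cayley remainder.\<close>
  have "\<exists>\<kappa>. continuous_on S \<kappa> \<and>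
      (\<forall>\<psi>\<in>S. \<kappa> \<psi> \<in> closure (convex hull (k ` {\<xi>\<in>S. dist \<xi> \<psi> < d\<^sup>2})))"
    by (rule continuous_convex_selection[OF d2(2) k(2)])
  then obtain \<kappa> where \<kappa>: "continuous_on S \<kappa>"
    "\<And>\<psi>. \<psi> \<in> S \<Longrightarrow> \<kappa> \<psi> \<in> closure (convex hull (k ` {\<xi>\<in>S. dist \<xi> \<psi> < d\<^sup>2}))"
    by blast
  \<comment> \<open>Self-adjointness, the norm bound and the seminorm estimate are closed convex
    conditions, so the average inherits each from the nearby values of \<open>k\<close>.\<close>
  have \<kappa>_in: "\<kappa> \<psi> \<in> H" if "\<psi> \<in> S" "closed H" "convex H" "\<And>\<xi>. \<xi> \<in> S \<Longrightarrow> dist \<xi> \<psi> < d\<^sup>2 \<Longrightarrow> k \<xi> \<in> H" for H \<psi>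
  proof -
    have "closure (convex hull (k ` {\<xi>\<in>S. dist \<xi> \<psi> < d\<^sup>2})) \<subseteq> H"
      using that by (intro closure_minimal hull_minimal) auto
    thus ?thesis using \<kappa>(2)[OF that(1)] by blast
  qed
  have \<kappa>s: "\<kappa> \<psi> \<in> selfadj" if "\<psi> \<in> S" for \<psi>
    by (rule \<kappa>_in[OF that closed_selfadj convex_selfadj]) (rule k(1))
  have \<kappa>n: "norm (\<kappa> \<psi>) \<le> 6000000 * d" if "\<psi> \<in> S" for \<psi>
    using \<kappa>_in[OF that closed_cball[of 0 "6000000 * d"] convex_cball] k(2) by simp
  have \<kappa>b: "sn \<omega> (2 *\<^sub>R (\<i> *\<^sub>C \<kappa> \<psi>) - b \<psi>) \<le> 1150 * d\<^sup>2" if \<psi>: "\<psi> \<in> S" for \<psi>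
  proof -
    define H where "H = {a. sn \<omega> (2 *\<^sub>R (\<i> *\<^sub>C a) - b \<psi>) \<le> 1150 * d\<^sup>2}"
    have cl: "closed H" unfolding H_def
      by (intro closed_Collect_le continuous_on_compose2[OF continuous_on_sn[of UNIV]] continuous_intros) auto
    have cv: "convex H"
    proof (rule convexI)
      fix x y and s t :: real assume h: "x \<in> H" "y \<in> H" "0 \<le> s" "0 \<le> t" "s + t = 1"
      have "b \<psi> = s *\<^sub>R b \<psi> + t *\<^sub>R b \<psi>" using h(5) by (simp flip: scaleR_left_distrib)
      hence "2 *\<^sub>R (\<i> *\<^sub>C (s *\<^sub>R x + t *\<^sub>R y)) - b \<psi> = s *\<^sub>R (2 *\<^sub>R (\<i> *\<^sub>C x) - b \<psi>) + t *\<^sub>R (2 *\<^sub>R (\<i> *\<^sub>C y) - b \<psi>)"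
        by (simp add: scaleC_add_right scaleC_scaleR algebra_simps)
      hence "sn \<omega> (2 *\<^sub>R (\<i> *\<^sub>C (s *\<^sub>R x + t *\<^sub>R y)) - b \<psi>) \<le> 
          s * sn \<omega> (2 *\<^sub>R (\<i> *\<^sub>C x) - b \<psi>) + t * sn \<omega> (2 *\<^sub>R (\<i> *\<^sub>C y) - b \<psi>)"
        using sn_triangle[OF fl, of "s *\<^sub>R (2 *\<^sub>R (\<i> *\<^sub>C x) - b \<psi>)" "t *\<^sub>R (2 *\<^sub>R (\<i> *\<^sub>C y) - b \<psi>)"] h
        by (simp add: sn_scaleR[OF fl])
      also have "\<dots> \<le> s * (1150 * d\<^sup>2) + t * (1150 * d\<^sup>2)"
        using h by (intro add_mono mult_left_mono) (auto simp: H_def)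
      also have "\<dots> = 1150 * d\<^sup>2" using h(5) by (simp flip: distrib_right)
      finally show "s *\<^sub>R x + t *\<^sub>R y \<in> H" by (simp add: H_def)
    qed
    have "\<kappa> \<psi> \<in> H"
    proof (rule \<kappa>_in[OF \<psi> cl cv])
      fix \<xi> assume \<xi>: "\<xi> \<in> S" "dist \<xi> \<psi> < d\<^sup>2"
      have "sn \<omega> (2 *\<^sub>R (\<i> *\<^sub>C k \<xi>) - b \<psi>) \<le> sn \<omega> (2 *\<^sub>R (\<i> *\<^sub>C k \<xi>) - b \<xi>) + sn \<omega> (b \<xi> - b \<psi>)"
        by (rule sn_triangle_diff[OF fl])
      thus "k \<xi> \<in> H" using k(3)[OF \<xi>(1)] bb[OF \<xi>(1) \<psi> \<xi>(2)] unfolding H_def by simp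
    qed
    thus ?thesis by (simp add: H_def)
  qed
  define s where "s \<psi> = cayley (\<kappa> \<psi>)" for \<psi>
  have sU: "s \<psi> \<in> unitaries" if "\<psi> \<in> S" for \<psi> unfolding s_def by (rule cayley_unitary[OF \<kappa>s[OF that]])
  have sc: "continuous_on S s"
  proof -
    have "continuous_on selfadj (cayley :: 'a \<Rightarrow> 'a)"
    proof (rule lipschitz_on_continuous_on[where L = 2], rule lipschitz_onI)
      fix x y :: 'a assume "x \<in> selfadj" "y \<in> selfadj"
      thus "dist (cayley x) (cayley y) \<le> 2 * dist x y" using norm_cayley_diff by (simp add: dist_norm)
    qed simp
    thus ?thesis unfolding s_def using \<kappa>s by (intro continuous_on_compose2[OF _ \<kappa>(1)]) auto
  qed
  have "norm (s \<psi> - 1) \<le> K * d" if \<psi>: "\<psi> \<in> S" for \<psi>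
  proof -
    have "norm (s \<psi> - 1) \<le> 2 * norm (\<kappa> \<psi>)" unfolding s_def by (rule norm_cayley_minus_one[OF \<kappa>s[OF \<psi>]])
    thus ?thesis using \<kappa>n[OF \<psi>] d by (simp add: K_def)
  qed
  moreover have "norm (unitary_act (adj (s \<psi>)) \<psi> - \<omega>) \<le> K * d\<^sup>2" if \<psi>: "\<psi> \<in> S" for \<psi>
  proof -
    have "norm (s \<psi> - 1 - 2 *\<^sub>R (\<i> *\<^sub>C \<kappa> \<psi>)) \<le> 2 * (norm (\<kappa> \<psi>))\<^sup>2"
      unfolding s_def by (rule norm_cayley_expand[OF \<kappa>s[OF \<psi>]])
    also have "\<dots> \<le> 2 * (6000000 * d)\<^sup>2" by (intro mult_left_mono power_mono \<kappa>n \<psi>) auto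
    also have "\<dots> = 72000000000000 * d\<^sup>2" by (simp add: power_mult_distrib)
    finally have n1: "sn \<omega> (s \<psi> - 1 - 2 *\<^sub>R (\<i> *\<^sub>C \<kappa> \<psi>)) \<le> 72000000000000 * d\<^sup>2"
      using sn_le_norm[OF fp, of "s \<psi> - 1 - 2 *\<^sub>R (\<i> *\<^sub>C \<kappa> \<psi>)"] by (simp add: f1)
    have "s \<psi> - u \<psi> = (s \<psi> - 1 - 2 *\<^sub>R (\<i> *\<^sub>C \<kappa> \<psi>)) + ((2 *\<^sub>R (\<i> *\<^sub>C \<kappa> \<psi>) - b \<psi>) + of_real (1 - q \<psi>) *\<^sub>C 1)"
      by (simp add: b_def scaleC_diff_left)
    also have "sn \<omega> \<dots> \<le> sn \<omega> (s \<psi> - 1 - 2 *\<^sub>R (\<i> *\<^sub>C \<kappa> \<psi>)) + (sn \<omega> (2 *\<^sub>R (\<i> *\<^sub>C \<kappa> \<psi>) - b \<psi>) + sn \<omega> (of_real (1 - q \<psi>) *\<^sub>C 1))"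
      by (rule order_trans[OF sn_triangle[OF fl] add_left_mono[OF sn_triangle[OF fl]]])
    also have "sn \<omega> (of_real (1 - q \<psi>) *\<^sub>C 1) = \<bar>1 - q \<psi>\<bar>"
      unfolding sn_scaleC[OF fl] norm_of_real by (simp add: f1)
    \<comment> \<open>The Cayley remainder 7.2 * 10^13 dominates and 10^14 absorbs the remaining
      quadratic errors; the factor 2 of \<open>norm_unitary_act_diff_sn\<close> makes it
      \<open>K\<close>.\<close>
    finally have su: "sn \<omega> (s \<psi> - u \<psi>) \<le> 10 ^ 14 * d\<^sup>2"
      using n1 \<kappa>b[OF \<psi>] q1[OF \<psi>] d2(2) by (simp add: abs_of_nonneg)
    have "unitary_act (adj (s \<psi>)) \<psi> - \<omega> = unitary_act (adj (s \<psi>) * u \<psi>) \<omega> - unitary_act 1 \<omega>"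
      by (simp add: unitary_act_mult u(2)[OF \<psi>])
    also have "norm \<dots> \<le> 2 * sn \<omega> (adj (s \<psi>) * u \<psi> - 1)"
      by (intro norm_unitary_act_diff_sn f unitaries_mult unitaries_adj sU u \<psi>) simp
    also have "sn \<omega> (adj (s \<psi>) * u \<psi> - 1) = sn \<omega> (s \<psi> * (adj (s \<psi>) * u \<psi> - 1))"
      by (rule sn_unitary[OF fl sU[OF \<psi>], symmetric])
    also have "s \<psi> * (adj (s \<psi>) * u \<psi> - 1) = u \<psi> - s \<psi>"
      by (simp add: right_diff_distrib unitary_cancel sU[OF \<psi>])
    finally show ?thesis using su by (simp add: K_def sn_minus_commute[OF fl, of "u \<psi>"])
  qed
  ultimately show ?thesis using sc sU by blast
qed

text \<open>The hypothesis on \<open>d\<close> says 2 K d \<le> 1, and so K D^2 \<le> D / 2: every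
  correction halves the distance to \<open>\<omega>\<close>. The correcting unitaries differ from 1
  by at most K d / 2^n, with sum 2 K d = 4 * 10^14 d, so their product converges uniformly in
  norm.\<close>

lemma local_section:
  fixes \<omega> :: "'a::unital_cstar_algebra \<Rightarrow>\<^sub>L complex"
  assumes f: "pure_fun (blinfun_apply \<omega>)" and d: "0 < d" "4 * 10 ^ 14 * d \<le> 1"
  shows "\<exists>s. continuous_on {\<psi> \<in> unitary_orbit \<omega>. norm (\<psi> - \<omega>) \<le> d} s \<and>
    (\<forall>\<psi>\<in>{\<psi> \<in> unitary_orbit \<omega>. norm (\<psi> - \<omega>) \<le> d}.
      s \<psi> \<in> unitaries \<and> unitary_act (s \<psi>) \<omega> = \<psi> \<and> norm (s \<psi> - 1) \<le> 4 * 10 ^ 14 * d)"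
proof -
  define K :: real where "K = 2 * 10 ^ 14"
  define D where "D n = d / 2 ^ n" for n :: nat
  define S where "S n = {\<psi> \<in> unitary_orbit \<omega>. norm (\<psi> - \<omega>) \<le> D n}" for n
  have D: "0 < D n" "D n \<le> d" "D (Suc n) = D n / 2" for n
    using d by (simp_all add: D_def divide_le_eq mult_le_cancel_left1)
  have Kd: "2 * K * D n \<le> 1" for n
    using d(2) D(2)[of n] by (simp add: K_def)
  have D100: "D n \<le> 1/100" for n
  proof -
    have "400000000000000 * D n \<le> 1" using Kd[of n] by (simp add: K_def)
    thus ?thesis using D(1)[of n] by linarith
  qed
  have "\<forall>n. \<exists>s. continuous_on (S n) s \<and> (\<forall>\<psi>\<in>S n. s \<psi> \<in> unitaries \<and> norm (s \<psi> - 1) \<le> K * D n \<and>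
    norm (unitary_act (adj (s \<psi>)) \<psi> - \<omega>) \<le> K * (D n)\<^sup>2)"
    unfolding S_def K_def
    by (intro allI local_approx_section f D D100)
  then obtain s where s: "\<And>n. continuous_on (S n) (s n)" "\<And>n \<psi>. \<psi> \<in> S n \<Longrightarrow> s n \<psi> \<in> unitaries"
    "\<And>n \<psi>. \<psi> \<in> S n \<Longrightarrow> norm (s n \<psi> - 1) \<le> K * D n"
    "\<And>n \<psi>. \<psi> \<in> S n \<Longrightarrow> norm (unitary_act (adj (s n \<psi>)) \<psi> - \<omega>) \<le> K * (D n)\<^sup>2" by metis
  have next_S: "unitary_act (adj (s n \<psi>)) \<psi> \<in> S (Suc n)" if "\<psi> \<in> S n" for n \<psi>
  proof -
    have "K * (D n)\<^sup>2 \<le> D (Suc n)"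
      using mult_right_mono[OF Kd[of n], of "D n"] D(1)[of n] by (simp add: D(3) power2_eq_square)
    thus ?thesis using s(4)[OF that] that unitary_orbit_act[OF _ unitaries_adj[OF s(2)[OF that]]]
      by (simp add: S_def)
  qed
  \<comment> \<open>\<open>\<Psi> n \<psi>\<close> is the state left after n corrections and
    \<open>T n \<psi>\<close> the product of these corrections, which carries
    \<open>\<Psi> n \<psi>\<close> back to \<open>\<psi>\<close>.\<close>
  define \<Psi> where "\<Psi> = rec_nat (\<lambda>\<psi>. \<psi>) (\<lambda>n P \<psi>. unitary_act (adj (s n (P \<psi>))) (P \<psi>))"
  have \<Psi>0: "\<Psi> 0 \<psi> = \<psi>" and \<Psi>S: "\<Psi> (Suc n) \<psi> = unitary_act (adj (s n (\<Psi> n \<psi>))) (\<Psi> n \<psi>)" for n \<psi>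
    by (simp_all add: \<Psi>_def)
  define T where "T = rec_nat (\<lambda>\<psi>. 1) (\<lambda>n P \<psi>. P \<psi> * s n (\<Psi> n \<psi>))"
  have T0: "T 0 \<psi> = 1" and TS: "T (Suc n) \<psi> = T n \<psi> * s n (\<Psi> n \<psi>)" for n \<psi>
    by (simp_all add: T_def)
  have \<Psi>in: "\<Psi> n \<psi> \<in> S n" if "\<psi> \<in> S 0" for n \<psi>
    by (induction n) (simp_all add: \<Psi>0 \<Psi>S next_S that)
  have TU: "T n \<psi> \<in> unitaries" if "\<psi> \<in> S 0" for n \<psi>
    by (induction n) (simp_all add: T0 TS unitaries_mult s(2) \<Psi>in that)
  have \<Psi>c: "continuous_on (S 0) (\<Psi> n)" for n
  proof (induction n)
    case (Suc n)
    have "continuous_on (S 0) (\<lambda>\<psi>. s n (\<Psi> n \<psi>))"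
      by (rule continuous_on_compose2[OF s(1) Suc]) (use \<Psi>in in auto)
    thus ?case unfolding \<Psi>S
      by (intro continuous_intros Suc unitaries_adj s(2) \<Psi>in)
  qed (simp add: \<Psi>0)
  have sc: "continuous_on (S 0) (\<lambda>\<psi>. s n (\<Psi> n \<psi>))" for n
    by (rule continuous_on_compose2[OF s(1) \<Psi>c]) (use \<Psi>in in auto)
  have Tc: "continuous_on (S 0) (T n)" for n
    by (induction n) (simp_all add: T0 TS continuous_on_mult sc)
  have T\<Psi>: "unitary_act (T n \<psi>) (\<Psi> n \<psi>) = \<psi>" if "\<psi> \<in> S 0" for n \<psi>
  proof (induction n)
    case (Suc n)
    thus ?case unfolding TS \<Psi>S unitary_act_mult
      by (simp add: unitary_act_cancel s(2) \<Psi>in that)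
  qed (simp add: T0 \<Psi>0)
  define \<delta> where "\<delta> n \<psi> = T (Suc n) \<psi> - T n \<psi>" for n \<psi>
  have \<delta>le: "norm (\<delta> n \<psi>) \<le> K * d * (1/2) ^ n" if "\<psi> \<in> S 0" for n \<psi>
  proof -
    have "\<delta> n \<psi> = T n \<psi> * (s n (\<Psi> n \<psi>) - 1)" by (simp add: \<delta>_def TS right_diff_distrib)
    hence "norm (\<delta> n \<psi>) \<le> norm (T n \<psi>) * norm (s n (\<Psi> n \<psi>) - 1)" by (simp add: norm_mult_ineq)
    also have "\<dots> \<le> K * D n" using s(3)[OF \<Psi>in[OF that]] norm_unitary[OF TU[OF that]] by simp
    finally show ?thesis by (simp add: D_def power_one_over)
  qed
  have summ: "summable (\<lambda>n. K * d * (1/2) ^ n)" by (intro summable_mult summable_geometric) simp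
  have "suminf (\<lambda>n. K * d * (1/2) ^ n) = K * d * suminf (\<lambda>n. (1/2) ^ n)"
    by (intro suminf_mult summable_geometric) simp
  hence total: "suminf (\<lambda>n. K * d * (1/2) ^ n) = 4 * 10 ^ 14 * d"
    using suminf_geometric[of "1/2 :: real"] by (simp add: K_def)
  define \<sigma> where "\<sigma> \<psi> = 1 + (\<Sum>n. \<delta> n \<psi>)" for \<psi>
  have tel: "(\<Sum>i<n. \<delta> i \<psi>) = T n \<psi> - 1" for n \<psi>
    by (induction n) (simp_all add: \<delta>_def T0)
  have unif: "uniform_limit (S 0) (\<lambda>n \<psi>. \<Sum>i<n. \<delta> i \<psi>) (\<lambda>\<psi>. \<Sum>i. \<delta> i \<psi>) sequentially"
    by (rule Weierstrass_m_test[OF _ summ]) (rule \<delta>le)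
  have "continuous_on (S 0) (\<lambda>\<psi>. \<Sum>i. \<delta> i \<psi>)"
  proof (rule uniform_limit_theorem[OF _ unif])
    show "\<forall>\<^sub>F n in sequentially. continuous_on (S 0) (\<lambda>\<psi>. \<Sum>i<n. \<delta> i \<psi>)"
      unfolding tel by (intro always_eventually allI continuous_intros Tc)
  qed simp
  hence \<sigma>c: "continuous_on (S 0) \<sigma>" unfolding \<sigma>_def by (intro continuous_intros)
  have main: "\<sigma> \<psi> \<in> unitaries \<and> unitary_act (\<sigma> \<psi>) \<omega> = \<psi> \<and> norm (\<sigma> \<psi> - 1) \<le> 4 * 10 ^ 14 * d" if \<psi>: "\<psi> \<in> S 0" for \<psi>
  proof -
    have "(\<lambda>n. \<Sum>i<n. \<delta> i \<psi>) \<longlonglongrightarrow> (\<Sum>i. \<delta> i \<psi>)" by (rule tendsto_uniform_limitI[OF unif \<psi>])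
    hence "(\<lambda>n. 1 + (T n \<psi> - 1)) \<longlonglongrightarrow> \<sigma> \<psi>" unfolding \<sigma>_def tel by (intro tendsto_intros)
    hence Tl: "(\<lambda>n. T n \<psi>) \<longlonglongrightarrow> \<sigma> \<psi>" by simp
    have \<sigma>U: "\<sigma> \<psi> \<in> unitaries"
      by (rule closed_sequentially[OF closed_unitaries _ Tl]) (rule TU[OF \<psi>])
    have "(\<lambda>n. unitary_act (T n \<psi>) \<omega>) \<longlonglongrightarrow> \<psi>"
    proof -
      have "(\<lambda>n. d * (1/2) ^ n) \<longlonglongrightarrow> d * 0" by (intro tendsto_intros LIMSEQ_realpow_zero) auto
      hence lim: "(\<lambda>n. D n) \<longlonglongrightarrow> 0" by (simp add: D_def power_one_over)
      have "norm (unitary_act (T n \<psi>) \<omega> - \<psi>) \<le> D n" for n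
      proof -
        have "unitary_act (T n \<psi>) \<omega> - \<psi> = unitary_act (T n \<psi>) (\<omega> - \<Psi> n \<psi>)"
          by (simp add: unitary_act_diff T\<Psi>[OF \<psi>])
        also have "norm \<dots> \<le> norm (\<omega> - \<Psi> n \<psi>)" by (rule norm_unitary_act_le[OF TU[OF \<psi>]])
        finally show ?thesis using \<Psi>in[OF \<psi>, of n] by (simp add: S_def norm_minus_commute)
      qed
      hence "(\<lambda>n. unitary_act (T n \<psi>) \<omega> - \<psi>) \<longlonglongrightarrow> 0"
        by (intro Lim_null_comparison[OF _ lim]) auto
      thus ?thesis by (simp add: LIM_zero_iff)
    qed
    moreover have "(\<lambda>n. unitary_act (T n \<psi>) \<omega>) \<longlonglongrightarrow> unitary_act (\<sigma> \<psi>) \<omega>"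
      by (rule unitary_act_tendsto[OF Tl TU[OF \<psi>] \<sigma>U])
    ultimately have "unitary_act (\<sigma> \<psi>) \<omega> = \<psi>" using LIMSEQ_unique by blast
    moreover have "norm (\<sigma> \<psi> - 1) \<le> suminf (\<lambda>n. K * d * (1/2) ^ n)"
      unfolding \<sigma>_def using norm_suminf_le[OF \<delta>le[OF \<psi>] summ] by simp
    ultimately show ?thesis using \<sigma>U total by simp
  qed
  have "S 0 = {\<psi> \<in> unitary_orbit \<omega>. norm (\<psi> - \<omega>) \<le> d}" by (simp add: S_def D_def)
  thus ?thesis using \<sigma>c main by metis
qed

text \<open>The radius and the norm bound of \<open>local_section\<close> are the same at every
  point of the orbit. A subsequence with steps of length at most \<open>D n\<close> therefore lifts
  to unitaries \<open>W n\<close> whose consecutive differences are at most K D n = (1/2)^n, and the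
  limit of the lift represents the limit state.\<close>

lemma closed_unitary_orbit:
  assumes f: "pure_fun (blinfun_apply \<omega>)"
  shows "closed (unitary_orbit \<omega>)"
  unfolding closed_sequential_limits
proof (intro allI impI)
  fix X \<psi> assume "(\<forall>n. X n \<in> unitary_orbit \<omega>) \<and> X \<longlonglongrightarrow> \<psi>"
  hence X: "\<And>n. X n \<in> unitary_orbit \<omega>" "X \<longlonglongrightarrow> \<psi>" by auto
  define K :: real where "K = 4 * 10 ^ 14"
  define D :: "nat \<Rightarrow> real" where "D n = (1 / K) * (1/2) ^ n" for n
  have K: "K > 0" by (simp add: K_def)
  have D: "D n > 0" "K * D n = (1/2) ^ n" for n by (simp_all add: D_def K_def)
  have "\<exists>m. norm (X m - \<psi>) \<le> D n / 4" for n
    using tendstoD[OF X(2), of "D n / 4"] D(1)[of n] 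
    by (auto simp: eventually_sequentially dist_norm intro: less_imp_le)
  then obtain m where m: "\<And>n. norm (X (m n) - \<psi>) \<le> D n / 4" by metis
  define \<xi> where "\<xi> n = X (m n)" for n
  have \<xi>: "\<xi> n \<in> unitary_orbit \<omega>" "norm (\<xi> n - \<psi>) \<le> D n / 4" for n using X(1) m by (auto simp: \<xi>_def)
  have step: "norm (\<xi> (Suc n) - \<xi> n) \<le> D n" for n
  proof -
    have "D (Suc n) = D n / 2" by (simp add: D_def)
    thus ?thesis using norm_triangle_ineq4[of "\<xi> (Suc n) - \<psi>" "\<xi> n - \<psi>"] \<xi>(2)[of n] \<xi>(2)[of "Suc n"] D(1)[of n]
      by simp
  qed
  have "\<exists>v. v \<in> unitaries \<and> unitary_act v (\<xi> n) = \<xi> (Suc n) \<and> norm (v - 1) \<le> (1/2) ^ n" for n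
  proof -
    have p: "pure_fun (blinfun_apply (\<xi> n))" by (rule pure_fun_unitary_orbit[OF f \<xi>(1)])
    have "4 * 10 ^ 14 * D n \<le> 1" using D(2)[of n] by (simp add: K_def power_le_one)
    from local_section[OF p D(1) this]
    obtain s where s: "\<forall>\<psi>\<in>{\<psi> \<in> unitary_orbit (\<xi> n). norm (\<psi> - \<xi> n) \<le> D n}.
      s \<psi> \<in> unitaries \<and> unitary_act (s \<psi>) (\<xi> n) = \<psi> \<and> norm (s \<psi> - 1) \<le> 4 * 10 ^ 14 * D n" by blast
    have "\<xi> (Suc n) \<in> {\<psi> \<in> unitary_orbit (\<xi> n). norm (\<psi> - \<xi> n) \<le> D n}"
      using step unitary_orbit_trans[OF \<xi>(1) \<xi>(1)] by simp
    from bspec[OF s this] show ?thesis using D(2)[of n] unfolding K_def by (intro exI[of _ "s (\<xi> (Suc n))"]) simp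
  qed
  then obtain v where v: "\<And>n. v n \<in> unitaries" "\<And>n. unitary_act (v n) (\<xi> n) = \<xi> (Suc n)"
    "\<And>n. norm (v n - 1) \<le> (1/2) ^ n" by metis
  obtain u where u: "u \<in> unitaries" "\<xi> 0 = unitary_act u \<omega>" using \<xi>(1)[of 0] by (auto simp: unitary_orbit_def)
  define W where "W = rec_nat u (\<lambda>n w. v n * w)"
  have W0: "W 0 = u" and WS: "W (Suc n) = v n * W n" for n by (simp_all add: W_def)
  have WU: "W n \<in> unitaries" for n by (induction n) (simp_all add: W0 WS u unitaries_mult v)
  have W\<omega>: "unitary_act (W n) \<omega> = \<xi> n" for n
    by (induction n) (simp_all add: W0 WS u unitary_act_mult v)
  have "norm (W (Suc n) - W n) \<le> (1/2) ^ n" for n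
  proof -
    have "W (Suc n) - W n = (v n - 1) * W n" by (simp add: WS left_diff_distrib)
    hence "norm (W (Suc n) - W n) \<le> norm (v n - 1) * norm (W n)" by (simp add: norm_mult_ineq)
    thus ?thesis using v(3)[of n] norm_unitary[OF WU[of n]] by simp
  qed
  hence "summable (\<lambda>n. W (Suc n) - W n)"
    by (intro summable_comparison_test'[OF summable_geometric[of "1/2 :: real"]]) auto
  hence "convergent (\<lambda>n. (\<Sum>i<n. W (Suc i) - W i))" by (simp add: summable_iff_convergent)
  hence "convergent (\<lambda>n. W n - W 0)" by (simp add: sum_lessThan_telescope)
  then obtain L where "(\<lambda>n. W n - W 0) \<longlonglongrightarrow> L" by (auto simp: convergent_def)
  hence "(\<lambda>n. (W n - W 0) + W 0) \<longlonglongrightarrow> L + W 0" by (intro tendsto_intros)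
  hence Wl: "W \<longlonglongrightarrow> L + W 0" by simp
  have LU: "L + W 0 \<in> unitaries" by (rule closed_sequentially[OF closed_unitaries WU Wl])
  have "(\<lambda>n. unitary_act (W n) \<omega>) \<longlonglongrightarrow> unitary_act (L + W 0) \<omega>"
    by (rule unitary_act_tendsto[OF Wl WU LU])
  hence "\<xi> \<longlonglongrightarrow> unitary_act (L + W 0) \<omega>" by (simp add: W\<omega>)
  moreover have "\<xi> \<longlonglongrightarrow> \<psi>"
  proof -
    have "(\<lambda>n. (1/K) * (1/2) ^ n) \<longlonglongrightarrow> (1/K) * 0" by (intro tendsto_intros LIMSEQ_realpow_zero) auto
    hence lim: "D \<longlonglongrightarrow> 0" by (simp add: D_def[abs_def])
    have "norm (\<xi> n - \<psi>) \<le> D n" for n using \<xi>(2)[of n] D(1)[of n] by simp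
    hence "(\<lambda>n. \<xi> n - \<psi>) \<longlonglongrightarrow> 0" by (intro Lim_null_comparison[OF _ lim]) auto
    thus ?thesis by (simp add: LIM_zero_iff)
  qed
  ultimately have "\<psi> = unitary_act (L + W 0) \<omega>" using LIMSEQ_unique by blast
  thus "\<psi> \<in> unitary_orbit \<omega>" using unitary_orbitI[OF LU] by simp
qed

lemma vector_state_in_orbit_closure:
  assumes f: "pure_fun (blinfun_apply \<omega>)" and x: "sn \<omega> x = 1" and e: "e > 0"
  shows "\<exists>\<psi>\<in>unitary_orbit \<omega>. \<forall>a. cmod (\<psi> a - \<omega> (adj x * a * x)) \<le> e * norm a"
proof -
  note fp = pure_fun_pos[OF f]
  have "sn \<omega> 1 = 1" by (simp add: sn_def pure_fun_one[OF f])
  then obtain u where u: "u \<in> unitaries" "sn \<omega> (u * 1 - x) < e / 2"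
    using unitary_transitive_approx[OF f _ x, of 1 "e/2"] e by auto
  have "cmod (unitary_act u \<omega> a - \<omega> (adj x * a * x)) \<le> e * norm a" for a
  proof -
    have "cmod (unitary_act u \<omega> a - \<omega> (adj x * a * x)) \<le> norm a * (sn \<omega> u + sn \<omega> x) * sn \<omega> (u - x)"
      unfolding unitary_act.rep_eq by (rule conj_diff[OF fp])
    also have "\<dots> \<le> norm a * 2 * (e / 2)"
      using u by (intro mult_mono) (auto simp: sn_one_unitary[OF f] x sn_nonneg[OF pos_fun_lin[OF fp]])
    finally show ?thesis by (simp add: mult.commute)
  qed
  thus ?thesis using unitary_orbitI[OF u(1)] by blast
qed

section \<open>The superselection sector is a unitary orbit\<close>

lemma gns_seminorm_eq: "gns_seminorm \<omega> = sn (blinfun_apply \<omega>)"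
  by (rule ext) (simp add: gns_seminorm_def sn_def)

lemma gns_Cauchy_iff: "X \<in> gns_Cauchy \<omega> \<longleftrightarrow> sn_Cauchy (blinfun_apply \<omega>) X"
  by (simp add: gns_Cauchy_def sn_Cauchy_def gns_seminorm_eq)

definition gns_class :: "('a::unital_cstar_algebra \<Rightarrow>\<^sub>L complex) \<Rightarrow> (nat \<Rightarrow> 'a) \<Rightarrow> (nat \<Rightarrow> 'a) set" where
  "gns_class \<omega> X = gns_rel \<omega> `` {X}"

lemma hcarrier_gns: "hcarrier (gns \<omega>) = gns_class \<omega> ` gns_Cauchy \<omega>"
  by (auto simp: gns_def gns_class_def quotient_def)

context
  fixes \<omega> :: "'a::unital_cstar_algebra \<Rightarrow>\<^sub>L complex"
  assumes f: "pos_fun (blinfun_apply \<omega>)"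
begin

private lemma fl: "pos_lin (blinfun_apply \<omega>)" by (rule pos_fun_lin[OF f])

lemma gns_rel_iff:
  "(X, Y) \<in> gns_rel \<omega> \<longleftrightarrow> X \<in> gns_Cauchy \<omega> \<and> Y \<in> gns_Cauchy \<omega> \<and> (\<lambda>n. sn \<omega> (X n - Y n)) \<longlonglongrightarrow> 0"
  by (simp add: gns_rel_def gns_seminorm_eq)

lemma equiv_gns_rel: "equiv (gns_Cauchy \<omega>) (gns_rel \<omega>)"
proof (rule equivI)
  show "gns_rel \<omega> \<subseteq> gns_Cauchy \<omega> \<times> gns_Cauchy \<omega>" by (auto simp: gns_rel_iff)
  show "refl_on (gns_Cauchy \<omega>) (gns_rel \<omega>)" by (auto simp: refl_on_def gns_rel_iff fl)
  show "sym (gns_rel \<omega>)" by (auto simp: sym_def gns_rel_iff sn_minus_commute[OF fl])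
  show "trans (gns_rel \<omega>)"
  proof (rule transI)
    fix X Y Z assume "(X, Y) \<in> gns_rel \<omega>" "(Y, Z) \<in> gns_rel \<omega>"
    hence XYZ: "X \<in> gns_Cauchy \<omega>" "Z \<in> gns_Cauchy \<omega>" "(\<lambda>n. sn \<omega> (X n - Y n)) \<longlonglongrightarrow> 0" "(\<lambda>n. sn \<omega> (Y n - Z n)) \<longlonglongrightarrow> 0"
      by (auto simp: gns_rel_iff)
    from tendsto_add[OF XYZ(3,4)] have l: "(\<lambda>n. sn \<omega> (X n - Y n) + sn \<omega> (Y n - Z n)) \<longlonglongrightarrow> 0" by simp
    have "(\<lambda>n. sn \<omega> (X n - Z n)) \<longlonglongrightarrow> 0"
      by (rule Lim_null_comparison[OF _ l]) (auto intro: always_eventually sn_triangle_diff[OF fl] simp: fl)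
    thus "(X, Z) \<in> gns_rel \<omega>" using XYZ by (simp add: gns_rel_iff)
  qed
qed

lemma gns_class_eq: "(X, Y) \<in> gns_rel \<omega> \<Longrightarrow> gns_class \<omega> X = gns_class \<omega> Y"
  unfolding gns_class_def by (rule equiv_class_eq[OF equiv_gns_rel])

lemma gns_class_self: "X \<in> gns_Cauchy \<omega> \<Longrightarrow> X \<in> gns_class \<omega> X"
  unfolding gns_class_def by (rule equiv_class_self[OF equiv_gns_rel])

lemma gns_class_relD: "Y \<in> gns_class \<omega> X \<Longrightarrow> (X, Y) \<in> gns_rel \<omega>"
  by (simp add: gns_class_def)

lemma gns_Cauchy_mult: "X \<in> gns_Cauchy \<omega> \<Longrightarrow> (\<lambda>n. a * X n) \<in> gns_Cauchy \<omega>"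
  unfolding gns_Cauchy_iff sn_Cauchy_def
proof (intro allI impI)
  fix e :: real assume X: "\<forall>e>0. \<exists>N. \<forall>m\<ge>N. \<forall>n\<ge>N. sn \<omega> (X m - X n) < e" and e: "e > 0"
  have na: "norm a + 1 > 0" by (simp add: add_nonneg_pos)
  then obtain N where N: "\<And>m n. m \<ge> N \<Longrightarrow> n \<ge> N \<Longrightarrow> sn \<omega> (X m - X n) < e / (norm a + 1)"
    using X e by (meson divide_pos_pos)
  have "sn \<omega> (a * X m - a * X n) < e" if "m \<ge> N" "n \<ge> N" for m n
  proof -
    have "sn \<omega> (a * X m - a * X n) \<le> norm a * sn \<omega> (X m - X n)"
      using sn_mult[OF f, of a "X m - X n"] by (simp add: right_diff_distrib)
    also have "\<dots> \<le> (norm a + 1) * sn \<omega> (X m - X n)" by (intro mult_right_mono) (auto simp: fl)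
    also have "\<dots> < e" using N[OF that] na by (simp add: pos_less_divide_eq mult.commute)
    finally show ?thesis .
  qed
  thus "\<exists>N. \<forall>m\<ge>N. \<forall>n\<ge>N. sn \<omega> (a * X m - a * X n) < e" by blast
qed

lemma gns_Cauchy_scaleC: "X \<in> gns_Cauchy \<omega> \<Longrightarrow> (\<lambda>n. c *\<^sub>C X n) \<in> gns_Cauchy \<omega>"
  using gns_Cauchy_mult[of X "c *\<^sub>C 1"] by (simp add: mult_scaleC_left)

lemma gns_Cauchy_add: 
  assumes "X \<in> gns_Cauchy \<omega>" "Y \<in> gns_Cauchy \<omega>" shows "(\<lambda>n. X n + Y n) \<in> gns_Cauchy \<omega>"
  unfolding gns_Cauchy_iff sn_Cauchy_def
proof (intro allI impI)
  fix e :: real assume e: "e > 0"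
  obtain N M where N: "\<And>m n. m \<ge> N \<Longrightarrow> n \<ge> N \<Longrightarrow> sn \<omega> (X m - X n) < e / 2"
    and M: "\<And>m n. m \<ge> M \<Longrightarrow> n \<ge> M \<Longrightarrow> sn \<omega> (Y m - Y n) < e / 2"
    using assms e unfolding gns_Cauchy_iff sn_Cauchy_def by (meson half_gt_zero)
  have "sn \<omega> (X m + Y m - (X n + Y n)) < e" if "m \<ge> max N M" "n \<ge> max N M" for m n
    using sn_triangle[OF fl, of "X m - X n" "Y m - Y n"] N[of m n] M[of m n] that
    by (simp add: add_diff_add)
  thus "\<exists>N. \<forall>m\<ge>N. \<forall>n\<ge>N. sn \<omega> (X m + Y m - (X n + Y n)) < e" by blast
qed

lemma gns_Cauchy_const: "(\<lambda>n. a) \<in> gns_Cauchy \<omega>"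
  by (simp add: gns_Cauchy_iff sn_Cauchy_def fl)

lemma gns_rel_mult:
  assumes "(X, Y) \<in> gns_rel \<omega>" shows "(\<lambda>n. a * X n, \<lambda>n. a * Y n) \<in> gns_rel \<omega>"
proof -
  have XY: "X \<in> gns_Cauchy \<omega>" "Y \<in> gns_Cauchy \<omega>" "(\<lambda>n. sn \<omega> (X n - Y n)) \<longlonglongrightarrow> 0"
    using assms by (auto simp: gns_rel_iff)
  have "(\<lambda>n. sn \<omega> (a * X n - a * Y n)) \<longlonglongrightarrow> 0"
  proof (rule Lim_null_comparison[OF _ tendsto_mult_right_zero[OF XY(3), of "norm a"]])
    show "\<forall>\<^sub>F n in sequentially. norm (sn \<omega> (a * X n - a * Y n)) \<le> norm a * sn \<omega> (X n - Y n)"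
      using sn_mult[OF f, of a] by (simp add: fl right_diff_distrib[symmetric])
  qed
  thus ?thesis using XY by (simp add: gns_rel_iff gns_Cauchy_mult)
qed

lemma gns_rel_add:
  assumes "(X, Y) \<in> gns_rel \<omega>" "(X', Y') \<in> gns_rel \<omega>"
  shows "(\<lambda>n. X n + X' n, \<lambda>n. Y n + Y' n) \<in> gns_rel \<omega>"
proof -
  have XY: "X \<in> gns_Cauchy \<omega>" "Y \<in> gns_Cauchy \<omega>" "(\<lambda>n. sn \<omega> (X n - Y n)) \<longlonglongrightarrow> 0"
    "X' \<in> gns_Cauchy \<omega>" "Y' \<in> gns_Cauchy \<omega>" "(\<lambda>n. sn \<omega> (X' n - Y' n)) \<longlonglongrightarrow> 0"
    using assms by (auto simp: gns_rel_iff)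
  from tendsto_add[OF XY(3,6)] have l: "(\<lambda>n. sn \<omega> (X n - Y n) + sn \<omega> (X' n - Y' n)) \<longlonglongrightarrow> 0" by simp
  have "(\<lambda>n. sn \<omega> (X n + X' n - (Y n + Y' n))) \<longlonglongrightarrow> 0"
  proof (rule Lim_null_comparison[OF _ l])
    show "\<forall>\<^sub>F n in sequentially. norm (sn \<omega> (X n + X' n - (Y n + Y' n))) \<le> sn \<omega> (X n - Y n) + sn \<omega> (X' n - Y' n)"
      using sn_triangle[OF fl, of "X _ - Y _" "X' _ - Y' _"] by (simp add: fl add_diff_add)
  qed
  thus ?thesis using XY by (simp add: gns_rel_iff gns_Cauchy_add)
qed

text \<open>The record collects the products over all representatives of the class. Their classes
  coincide, so the union is a single class.\<close>

lemma hact_gns: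
  assumes X: "X \<in> gns_Cauchy \<omega>"
  shows "hact (gns \<omega>) a (gns_class \<omega> X) = gns_class \<omega> (\<lambda>n. a * X n)"
proof -
  have "gns_class \<omega> (\<lambda>n. a * Y n) = gns_class \<omega> (\<lambda>n. a * X n)" if "Y \<in> gns_class \<omega> X" for Y
    by (rule gns_class_eq[OF gns_rel_mult, symmetric]) (rule gns_class_relD[OF that])
  hence "(\<Union>Y\<in>gns_class \<omega> X. gns_class \<omega> (\<lambda>n. a * Y n)) = gns_class \<omega> (\<lambda>n. a * X n)"
    using gns_class_self[OF X] by blast
  moreover have "hact (gns \<omega>) a (gns_class \<omega> X) = (\<Union>Y\<in>gns_class \<omega> X. gns_class \<omega> (\<lambda>n. a * Y n))"
    by (auto simp: gns_def gns_class_def)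
  ultimately show ?thesis by simp
qed

lemma hscale_gns:
  assumes X: "X \<in> gns_Cauchy \<omega>"
  shows "hscale (gns \<omega>) c (gns_class \<omega> X) = gns_class \<omega> (\<lambda>n. c *\<^sub>C X n)"
proof -
  have "hscale (gns \<omega>) c = hact (gns \<omega>) (c *\<^sub>C 1)" by (simp add: gns_def mult_scaleC_left)
  thus ?thesis using hact_gns[OF X, of "c *\<^sub>C 1"] by (simp add: mult_scaleC_left)
qed

lemma hadd_gns:
  assumes X: "X \<in> gns_Cauchy \<omega>" and Y: "Y \<in> gns_Cauchy \<omega>"
  shows "hadd (gns \<omega>) (gns_class \<omega> X) (gns_class \<omega> Y) = gns_class \<omega> (\<lambda>n. X n + Y n)"
proof -
  have "gns_class \<omega> (\<lambda>n. X' n + Y' n) = gns_class \<omega> (\<lambda>n. X n + Y n)" 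
    if "X' \<in> gns_class \<omega> X" "Y' \<in> gns_class \<omega> Y" for X' Y'
    by (rule gns_class_eq[OF gns_rel_add, symmetric]) (use gns_class_relD that in auto)
  hence "(\<Union>X'\<in>gns_class \<omega> X. \<Union>Y'\<in>gns_class \<omega> Y. gns_class \<omega> (\<lambda>n. X' n + Y' n)) = gns_class \<omega> (\<lambda>n. X n + Y n)"
    using gns_class_self[OF X] gns_class_self[OF Y] by blast
  moreover have "hadd (gns \<omega>) (gns_class \<omega> X) (gns_class \<omega> Y) = 
      (\<Union>X'\<in>gns_class \<omega> X. \<Union>Y'\<in>gns_class \<omega> Y. gns_class \<omega> (\<lambda>n. X' n + Y' n))"
    by (auto simp: gns_def gns_class_def)
  ultimately show ?thesis by simp
qed

lemma gns_inner_diff_tendsto: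
  assumes "(X, X') \<in> gns_rel \<omega>" "(Y, Y') \<in> gns_rel \<omega>"
  shows "(\<lambda>n. \<omega> (adj (X n) * Y n) - \<omega> (adj (X' n) * Y' n)) \<longlonglongrightarrow> 0"
proof -
  have XY: "X' \<in> gns_Cauchy \<omega>" "Y \<in> gns_Cauchy \<omega>" 
     "(\<lambda>n. sn \<omega> (X n - X' n)) \<longlonglongrightarrow> 0" "(\<lambda>n. sn \<omega> (Y n - Y' n)) \<longlonglongrightarrow> 0"
    using assms by (auto simp: gns_rel_iff)
  obtain M1 where M1: "\<And>n. sn \<omega> (X' n) \<le> M1" 
    using sn_Cauchy_bounded[OF fl XY(1)[unfolded gns_Cauchy_iff]] by blast
  obtain M2 where M2: "\<And>n. sn \<omega> (Y n) \<le> M2" 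
    using sn_Cauchy_bounded[OF fl XY(2)[unfolded gns_Cauchy_iff]] by blast
  have "(\<lambda>n. sn \<omega> (X n - X' n) * M2 + M1 * sn \<omega> (Y n - Y' n)) \<longlonglongrightarrow> 0 * M2 + M1 * 0"
    by (intro tendsto_intros XY)
  hence lim: "(\<lambda>n. sn \<omega> (X n - X' n) * M2 + M1 * sn \<omega> (Y n - Y' n)) \<longlonglongrightarrow> 0" by simp
  have "cmod (\<omega> (adj (X n) * Y n) - \<omega> (adj (X' n) * Y' n)) \<le> sn \<omega> (X n - X' n) * M2 + M1 * sn \<omega> (Y n - Y' n)" for n
  proof -
    have "cmod (\<omega> (adj (X n) * Y n) - \<omega> (adj (X' n) * Y' n)) \<le> 
        sn \<omega> (X n - X' n) * sn \<omega> (Y n) + sn \<omega> (X' n) * sn \<omega> (Y n - Y' n)" by (rule inner_diff[OF fl])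
    also have "\<dots> \<le> sn \<omega> (X n - X' n) * M2 + M1 * sn \<omega> (Y n - Y' n)"
      by (intro add_mono mult_left_mono mult_right_mono M1 M2) (auto simp: fl)
    finally show ?thesis .
  qed
  thus ?thesis by (intro Lim_null_comparison[OF _ lim]) auto
qed

lemma hinner_gns:
  assumes X: "X \<in> gns_Cauchy \<omega>" and Y: "Y \<in> gns_Cauchy \<omega>"
    and z: "(\<lambda>n. \<omega> (adj (X n) * Y n)) \<longlonglongrightarrow> z"
  shows "hinner (gns \<omega>) (gns_class \<omega> X) (gns_class \<omega> Y) = z"
proof -
  have "(THE z. \<forall>X'\<in>gns_class \<omega> X. \<forall>Y'\<in>gns_class \<omega> Y. (\<lambda>n. \<omega> (adj (X' n) * Y' n)) \<longlonglongrightarrow> z) = z"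
  proof (rule the_equality)
    show "\<forall>X'\<in>gns_class \<omega> X. \<forall>Y'\<in>gns_class \<omega> Y. (\<lambda>n. \<omega> (adj (X' n) * Y' n)) \<longlonglongrightarrow> z"
    proof (intro ballI)
      fix X' Y' assume "X' \<in> gns_class \<omega> X" "Y' \<in> gns_class \<omega> Y"
      hence "(\<lambda>n. \<omega> (adj (X n) * Y n) - \<omega> (adj (X' n) * Y' n)) \<longlonglongrightarrow> 0"
        by (intro gns_inner_diff_tendsto gns_class_relD)
      from tendsto_diff[OF z this] show "(\<lambda>n. \<omega> (adj (X' n) * Y' n)) \<longlonglongrightarrow> z" by simp
    qed
    show "z' = z" if "\<forall>X'\<in>gns_class \<omega> X. \<forall>Y'\<in>gns_class \<omega> Y. (\<lambda>n. \<omega> (adj (X' n) * Y' n)) \<longlonglongrightarrow> z'" for z'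
      using that gns_class_self[OF X] gns_class_self[OF Y] LIMSEQ_unique[OF _ z] by blast
  qed
  thus ?thesis by (simp add: gns_def)
qed

lemma gns_inner_convergent:
  assumes X: "X \<in> gns_Cauchy \<omega>" and Y: "Y \<in> gns_Cauchy \<omega>"
  shows "\<exists>z. (\<lambda>n. \<omega> (adj (X n) * Y n)) \<longlonglongrightarrow> z"
proof -
  have XC: "sn_Cauchy \<omega> X" and YC: "sn_Cauchy \<omega> Y" using X Y by (simp_all add: gns_Cauchy_iff)
  obtain M1 where M1: "M1 > 0" "\<And>n. sn \<omega> (X n) \<le> M1" using sn_Cauchy_bounded[OF fl XC] by blast
  obtain M2 where M2: "M2 > 0" "\<And>n. sn \<omega> (Y n) \<le> M2" using sn_Cauchy_bounded[OF fl YC] by blast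
  have "Cauchy (\<lambda>n. \<omega> (adj (X n) * Y n))"
    unfolding Cauchy_def
  proof (intro allI impI)
    fix e :: real assume e: "e > 0"
    obtain N where N: "\<And>m n. m \<ge> N \<Longrightarrow> n \<ge> N \<Longrightarrow> sn \<omega> (X m - X n) < e / (2 * M2)"
      using XC e M2(1) unfolding sn_Cauchy_def by (meson divide_pos_pos mult_pos_pos zero_less_numeral)
    obtain M where M: "\<And>m n. m \<ge> M \<Longrightarrow> n \<ge> M \<Longrightarrow> sn \<omega> (Y m - Y n) < e / (2 * M1)"
      using YC e M1(1) unfolding sn_Cauchy_def by (meson divide_pos_pos mult_pos_pos zero_less_numeral)
    have "dist (\<omega> (adj (X m) * Y m)) (\<omega> (adj (X n) * Y n)) < e" if "m \<ge> max N M" "n \<ge> max N M" for m n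
    proof -
      have "cmod (\<omega> (adj (X m) * Y m) - \<omega> (adj (X n) * Y n)) \<le> 
          sn \<omega> (X m - X n) * sn \<omega> (Y m) + sn \<omega> (X n) * sn \<omega> (Y m - Y n)" by (rule inner_diff[OF fl])
      also have "\<dots> \<le> sn \<omega> (X m - X n) * M2 + M1 * sn \<omega> (Y m - Y n)"
        by (intro add_mono mult_left_mono mult_right_mono M1 M2) (auto simp: fl)
      also have "\<dots> < e / 2 + e / 2"
        using N[of m n] M[of m n] that M1(1) M2(1) by (intro add_strict_mono) (auto simp: field_simps)
      finally show ?thesis by (simp add: dist_norm)
    qed
    thus "\<exists>N. \<forall>m\<ge>N. \<forall>n\<ge>N. dist (\<omega> (adj (X m) * Y m)) (\<omega> (adj (X n) * Y n)) < e" by blast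
  qed
  thus ?thesis by (simp add: Cauchy_convergent_iff convergent_def)
qed

end

text \<open>A unitary intertwiner sends the cyclic vector of \<open>\<psi>\<close> to the class of
  some Cauchy sequence \<open>X\<close>, which exhibits \<open>\<psi>\<close> as the limit of the
  vector functionals of the \<open>X n\<close>. Each normalised vector state lies in the closure of
  the orbit, and the orbit is closed.\<close>

lemma superselection_sector_subset_orbit:
  assumes f: "pure_fun (blinfun_apply \<omega>)" and \<psi>: "\<psi> \<in> superselection_sector \<omega>"
  shows "\<psi> \<in> unitary_orbit \<omega>"
proof -
  note fp = pure_fun_pos[OF f]
  note fl = pos_fun_lin[OF fp]
  have "pure_fun (blinfun_apply \<psi>)" using \<psi> by (auto simp: superselection_sector_def intro: pure_state_pure_fun)
  hence gp: "pos_fun (blinfun_apply \<psi>)" and \<psi>1: "\<psi> 1 = 1" by (auto simp: pure_fun_pos pure_fun_one)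
  obtain V where V: "bij_betw V (hcarrier (gns \<psi>)) (hcarrier (gns \<omega>))"
    "\<And>x y. x \<in> hcarrier (gns \<psi>) \<Longrightarrow> y \<in> hcarrier (gns \<psi>) \<Longrightarrow> hinner (gns \<omega>) (V x) (V y) = hinner (gns \<psi>) x y"
    "\<And>a x. x \<in> hcarrier (gns \<psi>) \<Longrightarrow> V (hact (gns \<psi>) a x) = hact (gns \<omega>) a (V x)"
    using \<psi> unfolding superselection_sector_def unitarily_equivalent_def by blast
  note one = gns_Cauchy_const[OF gp, of 1]
  have xc: "gns_class \<psi> (\<lambda>n. a) \<in> hcarrier (gns \<psi>)" for a
    using gns_Cauchy_const[OF gp, of a] by (simp add: hcarrier_gns)
  have "V (gns_class \<psi> (\<lambda>n. 1)) \<in> hcarrier (gns \<omega>)" using V(1) xc by (auto simp: bij_betw_def)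
  then obtain X where X: "X \<in> gns_Cauchy \<omega>" "V (gns_class \<psi> (\<lambda>n. 1)) = gns_class \<omega> X"
    by (auto simp: hcarrier_gns)
  have lim: "(\<lambda>n. \<omega> (adj (X n) * a * X n)) \<longlonglongrightarrow> \<psi> a" for a
  proof -
    have ac: "hact (gns \<psi>) a (gns_class \<psi> (\<lambda>n. 1)) = gns_class \<psi> (\<lambda>n. a)"
      using hact_gns[OF gp one, of a] by simp
    have Va: "V (gns_class \<psi> (\<lambda>n. a)) = gns_class \<omega> (\<lambda>n. a * X n)"
      using V(3)[OF xc, of a 1] unfolding ac X(2) hact_gns[OF fp X(1)] .
    have aX: "(\<lambda>n. a * X n) \<in> gns_Cauchy \<omega>" by (rule gns_Cauchy_mult[OF fp X(1)])
    obtain z where z: "(\<lambda>n. \<omega> (adj (X n) * (a * X n))) \<longlonglongrightarrow> z"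
      using gns_inner_convergent[OF fp X(1) aX] by blast
    have "hinner (gns \<psi>) (gns_class \<psi> (\<lambda>n. 1)) (gns_class \<psi> (\<lambda>n. a)) = \<psi> a"
      by (rule hinner_gns[OF gp one gns_Cauchy_const[OF gp]]) simp
    moreover have "hinner (gns \<omega>) (gns_class \<omega> X) (gns_class \<omega> (\<lambda>n. a * X n)) = z"
      by (rule hinner_gns[OF fp X(1) aX z])
    ultimately have "z = \<psi> a" using V(2)[OF xc xc, of 1 a] unfolding X(2) Va by simp
    thus ?thesis using z by (simp add: mult.assoc)
  qed
  have XC: "sn_Cauchy \<omega> X" using X(1) by (simp add: gns_Cauchy_iff)
  obtain M where M: "M > 0" "\<And>n. sn \<omega> (X n) \<le> M" using sn_Cauchy_bounded[OF fl XC] by blast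
  have s1: "(\<lambda>n. (sn \<omega> (X n))\<^sup>2) \<longlonglongrightarrow> 1"
    using tendsto_Re[OF lim[of 1]] by (simp add: sn_power2[OF fl] \<psi>1)
  have "\<psi> \<in> closure (unitary_orbit \<omega>)"
    unfolding closure_approachable
  proof (intro allI impI)
    fix e :: real assume e: "e > 0"
    \<comment> \<open>Three errors of size \<open>c\<close> occur: passing from
      \<open>\<psi>\<close> to the functional of \<open>X n\<close>, normalising \<open>X n\<close>,
      and moving into the orbit.\<close>
    define c where "c = e / 4"
    have c: "c > 0" using e by (simp add: c_def)
    obtain N where N: "\<And>m n. m \<ge> N \<Longrightarrow> n \<ge> N \<Longrightarrow> sn \<omega> (X m - X n) < c / (2 * M)"
      using XC c M(1) unfolding sn_Cauchy_def by (meson divide_pos_pos mult_pos_pos zero_less_numeral)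
    have "eventually (\<lambda>n. dist ((sn \<omega> (X n))\<^sup>2) 1 < min c (1/2)) sequentially"
      using tendstoD[OF s1, of "min c (1/2)"] c by simp
    then obtain N' where N': "\<And>n. n \<ge> N' \<Longrightarrow> dist ((sn \<omega> (X n))\<^sup>2) 1 < min c (1/2)"
      by (auto simp: eventually_sequentially)
    define n where "n = max N N'"
    define t where "t = sn \<omega> (X n)"
    have t2: "\<bar>t\<^sup>2 - 1\<bar> < c" "\<bar>t\<^sup>2 - 1\<bar> < 1/2" using N'[of n] by (auto simp: n_def t_def dist_real_def)
    have t0: "t > 0"
    proof -
      have "t \<noteq> 0" using t2(2) by auto
      thus ?thesis using sn_nonneg[OF fl, of "X n"] by (simp add: t_def)
    qed
    have near: "cmod (\<omega> (adj (X n) * a * X n) - \<psi> a) \<le> c * norm a" for a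
    proof (rule LIMSEQ_le_const2)
      show "(\<lambda>m. cmod (\<omega> (adj (X n) * a * X n) - \<omega> (adj (X m) * a * X m))) \<longlonglongrightarrow> cmod (\<omega> (adj (X n) * a * X n) - \<psi> a)"
        by (intro tendsto_intros lim)
      have "cmod (\<omega> (adj (X n) * a * X n) - \<omega> (adj (X m) * a * X m)) \<le> c * norm a" if "m \<ge> N" for m
      proof -
        have "cmod (\<omega> (adj (X n) * a * X n) - \<omega> (adj (X m) * a * X m)) \<le> norm a * (sn \<omega> (X n) + sn \<omega> (X m)) * sn \<omega> (X n - X m)"
          by (rule conj_diff[OF fp])
        also have "\<dots> \<le> norm a * (M + M) * (c / (2 * M))"
          using that M N[of n m] by (intro mult_mono add_mono) (auto simp: n_def fl)
        also have "\<dots> = c * norm a" using M(1) by (simp add: field_simps)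
        finally show ?thesis .
      qed
      thus "\<exists>N. \<forall>m\<ge>N. cmod (\<omega> (adj (X n) * a * X n) - \<omega> (adj (X m) * a * X m)) \<le> c * norm a" by blast
    qed
    define x where "x = (1 / t) *\<^sub>R X n"
    have x1: "sn \<omega> x = 1" using t0 by (simp add: x_def sn_scaleR[OF fl]) (simp add: t_def)
    obtain \<xi> where \<xi>: "\<xi> \<in> unitary_orbit \<omega>" "\<And>a. cmod (\<xi> a - \<omega> (adj x * a * x)) \<le> c * norm a"
      using vector_state_in_orbit_closure[OF f x1 c] by blast
    have "cmod (\<omega> (adj x * a * x) - \<omega> (adj (X n) * a * X n)) \<le> c * norm a" for a
    proof -
      have "\<omega> (adj (X n) * a * X n) = of_real (t\<^sup>2) * \<omega> (adj x * a * x)"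
        using t0 by (simp add: x_def adj_scaleR blinfun.scaleR_right scaleR_conv_of_real[where 'a=complex] power2_eq_square)
      hence "\<omega> (adj x * a * x) - \<omega> (adj (X n) * a * X n) = of_real (1 - t\<^sup>2) * \<omega> (adj x * a * x)"
        by (simp add: left_diff_distrib)
      hence "cmod (\<omega> (adj x * a * x) - \<omega> (adj (X n) * a * X n)) = \<bar>1 - t\<^sup>2\<bar> * cmod (\<omega> (adj x * a * x))"
        by (simp only: norm_mult norm_of_real)
      also have "\<dots> \<le> c * norm a"
      proof (rule mult_mono)
        have "cmod (\<omega> (adj x * (a * x))) \<le> sn \<omega> x * sn \<omega> (a * x)" by (rule Cauchy_Schwarz[OF fl])
        also have "\<dots> \<le> norm a" using sn_mult[OF fp, of a x] by (simp add: x1)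
        finally show "cmod (\<omega> (adj x * a * x)) \<le> norm a" by (simp add: mult.assoc)
      qed (use t2 c in \<open>auto simp: abs_minus_commute\<close>)
      finally show ?thesis .
    qed
    have "norm (\<xi> - \<psi>) \<le> 3 * c"
    proof (rule norm_blinfun_bound)
      fix a
      have "(\<xi> - \<psi>) a = (\<xi> a - \<omega> (adj x * a * x)) + ((\<omega> (adj x * a * x) - \<omega> (adj (X n) * a * X n)) + (\<omega> (adj (X n) * a * X n) - \<psi> a))"
        by (simp add: blinfun.diff_left)
      also have "cmod \<dots> \<le> c * norm a + (c * norm a + c * norm a)"
        by (intro order_trans[OF norm_triangle_ineq] add_mono \<xi>(2) near \<open>\<And>a. cmod (\<omega> (adj x * a * x) - \<omega> (adj (X n) * a * X n)) \<le> c * norm a\<close>)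
      finally show "norm ((\<xi> - \<psi>) a) \<le> 3 * c * norm a" by simp
    qed (use c in simp)
    also have "3 * c < e" using e by (simp add: c_def)
    finally show "\<exists>y\<in>unitary_orbit \<omega>. dist y \<psi> < e" using \<xi>(1) by (auto simp: dist_norm)
  qed
  thus ?thesis using closed_unitary_orbit[OF f] by simp
qed

lemma unitary_act_state:
  assumes "u \<in> unitaries" "\<phi> \<in> states" shows "unitary_act u \<phi> \<in> states"
proof -
  have e: "blinfun_apply (unitary_act u \<phi>) = (\<lambda>a. \<phi> (adj u * a * u))" by (rule ext) (simp add: unitary_act.rep_eq)
  show ?thesis using assms pos_fun_conj[of "blinfun_apply \<phi>" u] by (simp add: states_iff e unitaries_def)
qed

lemma unitary_act_pure_state:
  assumes u: "u \<in> unitaries" and \<omega>: "\<omega> \<in> pure_states" shows "unitary_act u \<omega> \<in> pure_states"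
proof -
  have ext: "\<omega> extreme_point_of states" using \<omega> by (simp add: pure_states_def)
  note u' = unitaries_adj[OF u]
  have "unitary_act u \<omega> \<notin> open_segment a b" if ab: "a \<in> states" "b \<in> states" for a b
  proof
    assume "unitary_act u \<omega> \<in> open_segment a b"
    then obtain t where t: "a \<noteq> b" "0 < t" "t < 1" "unitary_act u \<omega> = (1 - t) *\<^sub>R a + t *\<^sub>R b"
      by (auto simp: in_segment)
    have "\<omega> = unitary_act (adj u) (unitary_act u \<omega>)" by (simp add: unitary_act_cancel[OF u])
    also have "\<dots> = (1 - t) *\<^sub>R unitary_act (adj u) a + t *\<^sub>R unitary_act (adj u) b"
      unfolding t(4) by (simp add: unitary_act_add unitary_act_scaleR)
    finally have "\<omega> = (1 - t) *\<^sub>R unitary_act (adj u) a + t *\<^sub>R unitary_act (adj u) b" .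
    moreover have "unitary_act (adj u) a \<noteq> unitary_act (adj u) b"
      using t(1) unitary_act_cancel(2)[OF u] by metis
    ultimately have "\<omega> \<in> open_segment (unitary_act (adj u) a) (unitary_act (adj u) b)"
      using t(2,3) unfolding in_segment by blast
    thus False using ext unitary_act_state[OF u' ab(1)] unitary_act_state[OF u' ab(2)]
      unfolding extreme_point_of_def by blast
  qed
  thus ?thesis using ext unitary_act_state[OF u]
    unfolding pure_states_def extreme_point_of_def by blast
qed

text \<open>Right multiplication commutes with the left action and, since the state moved by
  \<open>u\<close> pairs a and b as \<open>\<omega>\<close> pairs a u and b u, it is isometric
  between the two GNS spaces. The union over representatives makes it a map of classes.\<close>

definition gns_right_mult ::
  "('a::unital_cstar_algebra \<Rightarrow>\<^sub>L complex) \<Rightarrow> 'a \<Rightarrow> (nat \<Rightarrow> 'a) set \<Rightarrow> (nat \<Rightarrow> 'a) set" where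
  "gns_right_mult \<omega> u x = (\<Union>X\<in>x. gns_class \<omega> (\<lambda>n. X n * u))"

lemma unitary_orbit_subset_superselection_sector:
  assumes \<omega>: "\<omega> \<in> pure_states" and \<psi>: "\<psi> \<in> unitary_orbit \<omega>"
  shows "\<psi> \<in> superselection_sector \<omega>"
proof -
  obtain u where u: "u \<in> unitaries" "\<psi> = unitary_act u \<omega>" using \<psi> by (auto simp: unitary_orbit_def)
  have \<psi>p: "\<psi> \<in> pure_states" using unitary_act_pure_state[OF u(1) \<omega>] u(2) by simp
  have fp: "pos_fun (blinfun_apply \<omega>)" and gp: "pos_fun (blinfun_apply \<psi>)"
    using pure_state_pure_fun[OF \<omega>] pure_state_pure_fun[OF \<psi>p] by (auto simp: pure_fun_pos)
  have ap: "\<psi> a = \<omega> (adj u * a * u)" for a by (simp add: u unitary_act.rep_eq)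
  have sn\<psi>: "sn \<psi> a = sn \<omega> (a * u)" for a
    by (simp add: sn_def ap adj_mult mult.assoc)
  have sn\<omega>: "sn \<omega> a = sn \<psi> (a * adj u)" for a
    by (simp add: sn\<psi> mult.assoc) (use u(1) in \<open>simp add: unitaries_def\<close>)
  have C1: "(\<lambda>n. X n * u) \<in> gns_Cauchy \<omega>" if "X \<in> gns_Cauchy \<psi>" for X
    using that by (simp add: gns_Cauchy_iff sn_Cauchy_def sn\<psi> left_diff_distrib)
  have C2: "(\<lambda>n. X n * adj u) \<in> gns_Cauchy \<psi>" if "X \<in> gns_Cauchy \<omega>" for X
    using that by (simp add: gns_Cauchy_iff sn_Cauchy_def sn\<omega> left_diff_distrib)
  have R1: "(\<lambda>n. X n * u, \<lambda>n. Y n * u) \<in> gns_rel \<omega>" if "(X, Y) \<in> gns_rel \<psi>" for X Y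
    using that C1 by (simp add: gns_rel_iff[OF fp] gns_rel_iff[OF gp] sn\<psi> left_diff_distrib)
  have R2: "(\<lambda>n. X n * adj u, \<lambda>n. Y n * adj u) \<in> gns_rel \<psi>" if "(X, Y) \<in> gns_rel \<omega>" for X Y
    using that C2 by (simp add: gns_rel_iff[OF fp] gns_rel_iff[OF gp] sn\<omega> left_diff_distrib)
  let ?V = "gns_right_mult \<omega> u" and ?W = "gns_right_mult \<psi> (adj u)"
  have V: "?V (gns_class \<psi> X) = gns_class \<omega> (\<lambda>n. X n * u)" if "X \<in> gns_Cauchy \<psi>" for X
  proof -
    have "gns_class \<omega> (\<lambda>n. Y n * u) = gns_class \<omega> (\<lambda>n. X n * u)" if "Y \<in> gns_class \<psi> X" for Y
      by (rule gns_class_eq[OF fp R1, symmetric]) (rule gns_class_relD[OF gp that])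
    thus ?thesis using gns_class_self[OF gp that] unfolding gns_right_mult_def by blast
  qed
  have W: "?W (gns_class \<omega> X) = gns_class \<psi> (\<lambda>n. X n * adj u)" if "X \<in> gns_Cauchy \<omega>" for X
  proof -
    have "gns_class \<psi> (\<lambda>n. Y n * adj u) = gns_class \<psi> (\<lambda>n. X n * adj u)" if "Y \<in> gns_class \<omega> X" for Y
      by (rule gns_class_eq[OF gp R2, symmetric]) (rule gns_class_relD[OF fp that])
    thus ?thesis using gns_class_self[OF fp that] unfolding gns_right_mult_def by blast
  qed
  have "unitarily_equivalent (gns \<psi>) (gns \<omega>)"
    unfolding unitarily_equivalent_def
  proof (intro exI[of _ ?V] conjI ballI allI)
    show "bij_betw ?V (hcarrier (gns \<psi>)) (hcarrier (gns \<omega>))"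
      by (rule bij_betw_byWitness[of _ ?W])
         (auto simp: hcarrier_gns V W C1 C2 unitary_cancel(3,4)[OF u(1)])
    fix x assume "x \<in> hcarrier (gns \<psi>)"
    then obtain X where X: "X \<in> gns_Cauchy \<psi>" "x = gns_class \<psi> X" by (auto simp: hcarrier_gns)
    show "?V (hscale (gns \<psi>) c x) = hscale (gns \<omega>) c (?V x)" for c
      by (simp add: X V C1 hscale_gns[OF gp] hscale_gns[OF fp] gns_Cauchy_scaleC[OF gp] mult_scaleC_left)
    show "?V (hact (gns \<psi>) a x) = hact (gns \<omega>) a (?V x)" for a
      by (simp add: X V C1 hact_gns[OF gp] hact_gns[OF fp] gns_Cauchy_mult[OF gp] mult.assoc)
    fix y assume "y \<in> hcarrier (gns \<psi>)"
    then obtain Y where Y: "Y \<in> gns_Cauchy \<psi>" "y = gns_class \<psi> Y" by (auto simp: hcarrier_gns)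
    show "?V (hadd (gns \<psi>) x y) = hadd (gns \<omega>) (?V x) (?V y)"
      by (simp add: X Y V C1 hadd_gns[OF gp] hadd_gns[OF fp] gns_Cauchy_add[OF gp] distrib_right)
    obtain z where z: "(\<lambda>n. \<psi> (adj (X n) * Y n)) \<longlonglongrightarrow> z"
      using gns_inner_convergent[OF gp X(1) Y(1)] by blast
    have "(\<lambda>n. \<omega> (adj (X n * u) * (Y n * u))) \<longlonglongrightarrow> z"
      using z by (simp add: ap adj_mult mult.assoc)
    from hinner_gns[OF fp C1[OF X(1)] C1[OF Y(1)] this] hinner_gns[OF gp X(1) Y(1) z]
    show "hinner (gns \<omega>) (?V x) (?V y) = hinner (gns \<psi>) x y" by (simp add: X Y V)
  qed
  thus ?thesis using \<psi>p by (simp add: superselection_sector_def)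
qed

lemma superselection_sector_eq_orbit:
  assumes "\<omega> \<in> pure_states" shows "superselection_sector \<omega> = unitary_orbit \<omega>"
  using superselection_sector_subset_orbit[OF pure_state_pure_fun[OF assms]]
    unitary_orbit_subset_superselection_sector[OF assms] by blast

section \<open>The principal bundle\<close>

lemma isotropy_iff: "u \<in> isotropy_unitaries \<omega> \<longleftrightarrow> u \<in> unitaries \<and> unitary_act u \<omega> = \<omega>"
  by (simp add: isotropy_unitaries_def)

lemma isotropy_mult:
  "u \<in> isotropy_unitaries \<omega> \<Longrightarrow> v \<in> isotropy_unitaries \<omega> \<Longrightarrow> u * v \<in> isotropy_unitaries \<omega>"
  by (simp add: isotropy_iff unitaries_mult unitary_act_mult)

lemma isotropy_adj: "u \<in> isotropy_unitaries \<omega> \<Longrightarrow> adj u \<in> isotropy_unitaries \<omega>"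
  unfolding isotropy_iff using unitary_act_cancel(1)[of u \<omega>] unitaries_adj by metis

lemma isotropy_diff:
  "u \<in> unitaries \<Longrightarrow> v \<in> unitaries \<Longrightarrow> unitary_act u \<omega> = unitary_act v \<omega> \<Longrightarrow>
    adj v * u \<in> isotropy_unitaries \<omega>"
  by (simp add: isotropy_iff unitaries_mult unitaries_adj unitary_act_mult unitary_act_cancel)

lemma isotropy_group_simps [simp]:
  "carrier (isotropy_group \<omega>) = isotropy_unitaries \<omega>"
  "x \<otimes>\<^bsub>isotropy_group \<omega>\<^esub> y = x * y"
  "\<one>\<^bsub>isotropy_group \<omega>\<^esub> = 1"
  by (simp_all add: isotropy_group_def)

lemma group_isotropy: "group (isotropy_group \<omega>)"
proof (rule groupI)
  show "\<exists>y\<in>carrier (isotropy_group \<omega>). y \<otimes>\<^bsub>isotropy_group \<omega>\<^esub> x = \<one>\<^bsub>isotropy_group \<omega>\<^esub>"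
    if "x \<in> carrier (isotropy_group \<omega>)" for x
    using that isotropy_adj[of x \<omega>] by (intro bexI[of _ "adj x"]) (auto simp: isotropy_iff unitaries_def)
qed (auto simp: isotropy_iff unitaries_mult unitary_act_mult mult.assoc)

lemma isotropy_inv:
  assumes "u \<in> isotropy_unitaries \<omega>" shows "inv\<^bsub>isotropy_group \<omega>\<^esub> u = adj u"
  by (rule group.inv_equality[OF group_isotropy]) 
     (use assms isotropy_adj[OF assms] in \<open>auto simp: isotropy_iff unitaries_def\<close>)

lemma topological_group_isotropy:
  "is_topological_group (isotropy_group \<omega>) (top_of_set (isotropy_unitaries \<omega>))"
  unfolding is_topological_group_def
proof (intro conjI group_isotropy)
  let ?H = "isotropy_unitaries \<omega>"
  show "continuous_map (prod_topology (top_of_set ?H) (top_of_set ?H)) (top_of_set ?H)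
      (\<lambda>(g, h). g \<otimes>\<^bsub>isotropy_group \<omega>\<^esub> h)"
    unfolding prod_topology_subtopology_eu continuous_map_subtopology_eu
    by (auto simp: case_prod_unfold isotropy_mult intro!: continuous_intros)
  have "continuous_map (top_of_set ?H) (top_of_set ?H) adj"
    unfolding continuous_map_subtopology_eu by (auto simp: isotropy_adj intro!: continuous_intros)
  thus "continuous_map (top_of_set ?H) (top_of_set ?H) (\<lambda>g. inv\<^bsub>isotropy_group \<omega>\<^esub> g)"
    by (rule continuous_map_eq) (simp add: isotropy_inv)
qed simp

text \<open>Homogeneity: the section around \<open>\<omega>\<close> is translated by a unitary
  \<open>u\<close> with b = u \<cdot> \<omega>. The strict inequality makes \<open>W\<close> open in
  the orbit.\<close>

lemma local_section_near:
  assumes f: "pure_fun (blinfun_apply \<omega>)" and b: "b \<in> unitary_orbit \<omega>"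
  shows "\<exists>W \<sigma>. openin (top_of_set (unitary_orbit \<omega>)) W \<and> b \<in> W \<and> continuous_on W \<sigma> \<and>
    (\<forall>\<psi>\<in>W. \<sigma> \<psi> \<in> unitaries \<and> unitary_act (\<sigma> \<psi>) \<omega> = \<psi>)"
proof -
  obtain u where u: "u \<in> unitaries" "b = unitary_act u \<omega>" using b by (auto simp: unitary_orbit_def)
  define d :: real where "d = 1 / (4 * 10 ^ 14)"
  have d: "0 < d" "4 * 10 ^ 14 * d \<le> 1" by (simp_all add: d_def)
  define S where "S = {\<psi> \<in> unitary_orbit \<omega>. norm (\<psi> - \<omega>) \<le> d}"
  obtain s where s: "continuous_on S s" "\<And>\<psi>. \<psi> \<in> S \<Longrightarrow> s \<psi> \<in> unitaries" "\<And>\<psi>. \<psi> \<in> S \<Longrightarrow> unitary_act (s \<psi>) \<omega> = \<psi>"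
    using local_section[OF f d] unfolding S_def by blast
  define g where "g \<psi> = unitary_act (adj u) \<psi>" for \<psi>
  define W where "W = unitary_orbit \<omega> \<inter> (\<lambda>\<psi>. norm (g \<psi> - \<omega>)) -` {..<d}"
  have gc: "continuous_on A g" for A
    unfolding g_def by (intro continuous_intros) (simp add: unitaries_adj u)
  have gW: "g \<psi> \<in> S" if "\<psi> \<in> W" for \<psi>
    using that unitary_orbit_act[OF _ unitaries_adj[OF u(1)], of \<psi> \<omega>] by (simp add: W_def S_def g_def)
  show ?thesis
  proof (intro exI[of _ W] exI[of _ "\<lambda>\<psi>. u * s (g \<psi>)"] conjI ballI)
    show "openin (top_of_set (unitary_orbit \<omega>)) W"
      unfolding W_def by (intro continuous_openin_preimage_gen continuous_intros gc)
    show "b \<in> W" using b d(1) by (simp add: W_def g_def u(2) unitary_act_cancel[OF u(1)])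
    show "continuous_on W (\<lambda>\<psi>. u * s (g \<psi>))"
      by (intro continuous_intros continuous_on_compose2[OF s(1) gc]) (use gW in auto)
    fix \<psi> assume \<psi>: "\<psi> \<in> W"
    show "u * s (g \<psi>) \<in> unitaries" by (intro unitaries_mult u s gW \<psi>)
    show "unitary_act (u * s (g \<psi>)) \<omega> = \<psi>"
      by (simp add: unitary_act_mult s(3) gW \<psi>) (simp add: g_def unitary_act_cancel[OF u(1)])
  qed
qed

text \<open>A local section \<open>\<sigma>\<close> trivialises the orbit map:
  \<open>adj (\<sigma> (?p e)) * e\<close> measures \<open>e\<close> against the section in the
  isotropy group, and its inverse is multiplication by \<open>\<sigma> \<psi>\<close> from the left.
  Equivariance is associativity, as the group acts from the right.\<close>

lemma locally_trivial_orbit_map: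
  assumes f: "pure_fun (blinfun_apply \<omega>)"
  shows "locally_trivial_principal_bundle (isotropy_group \<omega>) (top_of_set (isotropy_unitaries \<omega>))
    (top_of_set unitaries) (\<lambda>u h. u * h) (top_of_set (unitary_orbit \<omega>)) (\<lambda>u. unitary_act u \<omega>)"
  unfolding locally_trivial_principal_bundle_def
proof (intro conjI topological_group_isotropy)
  let ?H = "isotropy_unitaries \<omega>" and ?O = "unitary_orbit \<omega>" and ?p = "\<lambda>u. unitary_act u \<omega>"
  show "continuous_right_action (isotropy_group \<omega>) (top_of_set ?H) (top_of_set unitaries) (\<lambda>u h. u * h)"
    unfolding continuous_right_action_def prod_topology_subtopology_eu continuous_map_subtopology_eu
    by (auto simp: case_prod_unfold isotropy_iff unitaries_mult mult.assoc intro!: continuous_intros)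
  show "continuous_map (top_of_set unitaries) (top_of_set ?O) ?p"
    unfolding continuous_map_subtopology_eu by (auto intro!: continuous_intros simp: unitary_orbitI)
  show "?p ` topspace (top_of_set unitaries) = topspace (top_of_set ?O)"
    by (auto simp: unitary_orbit_def)
  show "\<forall>e\<in>topspace (top_of_set unitaries). \<forall>g\<in>carrier (isotropy_group \<omega>). ?p (e * g) = ?p e"
    by (simp add: isotropy_iff unitary_act_mult)
  show "\<forall>b\<in>topspace (top_of_set ?O). \<exists>W \<phi>. openin (top_of_set ?O) W \<and> b \<in> W \<and>
      homeomorphic_map (subtopology (top_of_set unitaries) {e \<in> topspace (top_of_set unitaries). ?p e \<in> W})
        (prod_topology (subtopology (top_of_set ?O) W) (top_of_set ?H)) \<phi> \<and>
      (\<forall>e\<in>topspace (top_of_set unitaries). ?p e \<in> W \<longrightarrow> fst (\<phi> e) = ?p e \<and>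
        (\<forall>g\<in>carrier (isotropy_group \<omega>). \<phi> (e * g) = (?p e, snd (\<phi> e) \<otimes>\<^bsub>isotropy_group \<omega>\<^esub> g)))"
  proof
    fix b assume "b \<in> topspace (top_of_set ?O)"
    then obtain W \<sigma> where W: "openin (top_of_set ?O) W" "b \<in> W" and \<sigma>c: "continuous_on W \<sigma>"
      and \<sigma>: "\<And>\<psi>. \<psi> \<in> W \<Longrightarrow> \<sigma> \<psi> \<in> unitaries" "\<And>\<psi>. \<psi> \<in> W \<Longrightarrow> unitary_act (\<sigma> \<psi>) \<omega> = \<psi>"
      using local_section_near[OF f, of b] by auto
    define E where "E = {e \<in> unitaries. ?p e \<in> W}"
    define \<phi> where "\<phi> e = (?p e, adj (\<sigma> (?p e)) * e)" for e
    define \<theta> where "\<theta> = (\<lambda>(\<psi>, g). \<sigma> \<psi> * g)"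
    have WO: "W \<subseteq> ?O" using openin_imp_subset[OF W(1)] .
    have topE: "subtopology (top_of_set unitaries) {e \<in> topspace (top_of_set unitaries). ?p e \<in> W} = top_of_set E"
      by (simp add: subtopology_subtopology E_def) (rule arg_cong[of _ _ top_of_set], auto)
    have topP: "prod_topology (subtopology (top_of_set ?O) W) (top_of_set ?H) = top_of_set (W \<times> ?H)"
      using WO by (simp add: subtopology_subtopology Int_absorb1 prod_topology_subtopology_eu)
    have pc: "continuous_on E ?p" by (auto intro!: continuous_intros simp: E_def)
    have "homeomorphic_maps (top_of_set E) (top_of_set (W \<times> ?H)) \<phi> \<theta>"
      unfolding homeomorphic_maps_def continuous_map_subtopology_eu
    proof (intro conjI)
      show "continuous_on E \<phi>" unfolding \<phi>_def
        by (intro continuous_intros pc continuous_on_compose2[OF \<sigma>c pc]) (auto simp: E_def)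
      show "\<phi> \<in> E \<rightarrow> W \<times> ?H" using \<sigma> by (auto simp: E_def \<phi>_def intro!: isotropy_diff)
      have "continuous_on (W \<times> ?H) (\<lambda>x. \<sigma> (fst x) * snd x)"
        by (intro continuous_intros continuous_on_compose2[OF \<sigma>c continuous_on_fst[OF continuous_on_id]]) auto
      thus "continuous_on (W \<times> ?H) \<theta>" by (simp add: \<theta>_def case_prod_unfold)
      show "\<theta> \<in> W \<times> ?H \<rightarrow> E"
        using \<sigma> by (auto simp: \<theta>_def E_def isotropy_iff unitaries_mult unitary_act_mult)
      show "\<forall>x\<in>topspace (top_of_set E). \<theta> (\<phi> x) = x"
        using \<sigma> by (auto simp: \<theta>_def \<phi>_def E_def unitary_cancel)
      show "\<forall>y\<in>topspace (top_of_set (W \<times> ?H)). \<phi> (\<theta> y) = y"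
        using \<sigma> by (auto simp: \<theta>_def \<phi>_def isotropy_iff unitary_act_mult unitary_cancel)
    qed
    hence "homeomorphic_map (top_of_set E) (top_of_set (W \<times> ?H)) \<phi>"
      using homeomorphic_maps_map by blast
    moreover have "fst (\<phi> e) = ?p e \<and> (\<forall>g\<in>?H. \<phi> (e * g) = (?p e, snd (\<phi> e) * g))" for e
      by (simp add: \<phi>_def isotropy_iff unitary_act_mult mult.assoc)
    ultimately show "\<exists>W \<phi>. openin (top_of_set ?O) W \<and> b \<in> W \<and>
      homeomorphic_map (subtopology (top_of_set unitaries) {e \<in> topspace (top_of_set unitaries). ?p e \<in> W})
        (prod_topology (subtopology (top_of_set ?O) W) (top_of_set ?H)) \<phi> \<and>
      (\<forall>e\<in>topspace (top_of_set unitaries). ?p e \<in> W \<longrightarrow> fst (\<phi> e) = ?p e \<and>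
        (\<forall>g\<in>carrier (isotropy_group \<omega>). \<phi> (e * g) = (?p e, snd (\<phi> e) \<otimes>\<^bsub>isotropy_group \<omega>\<^esub> g)))"
      using W unfolding isotropy_group_simps by (intro exI[of _ W] exI[of _ \<phi>]) (simp only: topE topP simp_thms, simp)
  qed
qed

lemma orbit_map_fiber:
  assumes v: "v \<in> unitaries"
  shows "{u \<in> unitaries. unitary_act u \<omega> = unitary_act v \<omega>} = {v * h | h. h \<in> isotropy_unitaries \<omega>}"
proof (intro equalityI subsetI)
  fix u assume "u \<in> {u \<in> unitaries. unitary_act u \<omega> = unitary_act v \<omega>}"
  hence u: "u \<in> unitaries" "unitary_act u \<omega> = unitary_act v \<omega>" by auto
  have "u = v * (adj v * u)" by (simp add: unitary_cancel[OF v])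
  thus "u \<in> {v * h | h. h \<in> isotropy_unitaries \<omega>}" using isotropy_diff[OF u(1) v u(2)] by blast
qed (auto simp: isotropy_iff unitaries_mult unitary_act_mult v)

theorem corollary3p13:
  fixes \<omega> :: "'a::unital_cstar_algebra \<Rightarrow>\<^sub>L complex"
    and p :: "'a \<Rightarrow> ('a \<Rightarrow>\<^sub>L complex)"
  assumes "\<omega> \<in> pure_states"
  defines "p \<equiv> \<lambda>u. unitary_act u \<omega>"
  shows "{{u \<in> unitaries. p u = \<psi>} | \<psi>. \<psi> \<in> superselection_sector \<omega>} =
           {{u * h | h. h \<in> isotropy_unitaries \<omega>} | u. u \<in> unitaries} \<and>
         locally_trivial_principal_bundle
           (isotropy_group \<omega>) (top_of_set (isotropy_unitaries \<omega>))
           (top_of_set unitaries) (\<lambda>u h. u * h)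
           (top_of_set (superselection_sector \<omega>)) p"
proof
  note sector = superselection_sector_eq_orbit[OF assms(1)]
  have "{{u \<in> unitaries. p u = \<psi>} | \<psi>. \<psi> \<in> superselection_sector \<omega>} =
      {{u \<in> unitaries. p u = p v} | v. v \<in> unitaries}"
    unfolding sector unitary_orbit_def p_def by blast
  also have "\<dots> = {{v * h | h. h \<in> isotropy_unitaries \<omega>} | v. v \<in> unitaries}"
    unfolding p_def using orbit_map_fiber[of _ \<omega>] by (intro Collect_cong ex_cong1) auto
  finally show "{{u \<in> unitaries. p u = \<psi>} | \<psi>. \<psi> \<in> superselection_sector \<omega>} =
           {{u * h | h. h \<in> isotropy_unitaries \<omega>} | u. u \<in> unitaries}" .
  show "locally_trivial_principal_bundle (isotropy_group \<omega>) (top_of_set (isotropy_unitaries \<omega>))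
           (top_of_set unitaries) (\<lambda>u h. u * h) (top_of_set (superselection_sector \<omega>)) p"
    unfolding sector p_def by (rule locally_trivial_orbit_map[OF pure_state_pure_fun[OF assms(1)]])
qed

end
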